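(* Let $k\ge2$, $\Omega$ a finite non-empty set, $\Psi$ a finite set of functions $\Omega^k\to(0,\infty)$, $P$ a probability distribution on $\Psi$, and $d>0$. For any sequence $L=L(n)\to\infty$ there exist $\varepsilon=\varepsilon(n)\to0$ and $K=K(n)\to\infty$ such that, asymptotically almost surely, the random factor graph $\mathbb G=\mathbb G(n,\mathbf m,P)$ has the following property: there exist pairwise disjoint non-empty sets $S_1,\dots,S_l\subset\Omega^{V_n}$ with $1\le l\le L(n)$ such that (i) $\sum_{j=1}^l\mu_{\mathbb G}(S_j)\ge1-\varepsilon$; (ii) for each $j=1,\dots,l$, $S_j$ is an $(\varepsilon,\ell)$-Bethe state of $\mathbb G$ for each $\ell=1,\dots,K$.
   Context: An $\Omega$-factor graph $G=(V,F,(\partial a)_{a\in F},(\psi_a)_{a\in F})$ consists of finite sets $V$ (variable nodes) and $F$ (constraint nodes), for each $a\in F$ a tuple $\partial a=(\partial_1a,\dots,\partial_ka)\in V^k$ and a weight function $\psi_a:\Omega^k\to(0,\infty)$. Its Gibbs distribution is $\mu_G(\sigma)=\psi_G(\sigma)/Z(G)$ with $\psi_G(\sigma)=\prod_{a\in F}\psi_a(\sigma_{\partial_1a},\dots,\sigma_{\partial_ka})$, $Z(G)=\sum_\tau\psi_G(\tau)$; $\mu_{G,U}$ is the marginal on $U\subset V$, and for $\emptyset\ne S\subset\Omega^V$, $\mu_{G,U}[\cdot|S]$ is the marginal on $U$ of $\mu_G$ conditioned on $S$. $G$ induces a bipartite graph joining $a\in F$ to $\partial_1a,\dots,\partial_ka$;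 $\partial x$ is the set of constraint nodes adjacent to $x$, and $\partial a$ also denotes the set $\{\partial_1a,\dots,\partial_ka\}$. The random factor graph $\mathbb G(n,m,P)$ has $V=V_n=\{x_1,\dots,x_n\}$, $F=\{a_1,\dots,a_m\}$, with independently for each $i$: $\partial a_i$ uniform in $V^k$ and $\psi_{a_i}$ drawn from $P$; $\mathbb G=\mathbb G(n,\mathbf m,P)$ with $\mathbf m\sim\mathrm{Po}(dn/k)$. A property holds asymptotically almost surely if its probability tends to 1 as $n\to\infty$. A set $\emptyset\ne U\subset V$ is a cavity if (CAV1) the induced subgraph $G[U]$ (variable nodes $U$ and all $a\in F$ with $\partial a\subset U$) is acyclic; (CAV2) every $a\in F$ with $\partial a\not\subset U$ has $|\partial a\cap U|\le1$; (CAV3) for distinct $a,b\in F$ with $\partial a\cap U\ne\emptyset\ne\partial b\cap U$, $(\partial a\cap\partial b)\setminus U=\emptyset$. $\partial U$ is the set of $a\in F$ with $\partial a\cap U\ne\emptyset$ and $\partial a\setminus U\ne\emptyset$; for $a\in\partial U$, $x_{a\to U}$ is the unique variable node in $U\cap\partial a$. $\mathcal C(G,l,r)$ is the set of cavities $U$ with $|U|=l$ such that $G[U]$ has exactly $r$ connected components. For $\emptyset\ne S\subset\Omega^V$, $x\in V$, $a\in\partial x$, the standard message is $\mu_{G,a\to x}[\tau|S]\propto\sum_{\sigma\in S}\mathbf 1\{\sigma_x=\tau\}\prod_{b\in F\setminus(\partial x\setminus\{a\})}\psi_b(\sigma|_{\partial b})$ ($\tau\in\Omega$). Define $\mu_{G[U]}(\sigma)\propto\prod_{a\in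 F,\,\partial a\subset U}\psi_a(\sigma|_{\partial a})$ and $\bar\mu_{G,U}[\sigma|S]\propto\mu_{G[U]}(\sigma)\prod_{a\in\partial U}\mu_{G,a\to x_{a\to U}}[\sigma_{x_{a\to U}}|S]$ for $\sigma\in\Omega^U$. $S$ is an $(\varepsilon,\ell)$-Bethe state of $G$ if for all $1\le r\le l\le\ell$: $\sum_{U\in\mathcal C(G,l,r)}\sum_{\sigma\in\Omega^U}|\mu_{G,U}[\sigma|S]-\bar\mu_{G,U}[\sigma|S]|<\varepsilon|\mathcal C(G,l,r)|$.
   Formalization: In the definition of an (ε,ℓ)-Bethe state the inequality is required only for those l, r for which C(G,l,r) is non-empty; for empty C(G,l,r) (e.g. k=3, l=2, r=1, with probability bounded away from 0) it would read 0<0 and the claim would fail. *)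

theory Defs
  imports "HOL-Probability.Probability"
begin

text \<open>A factor graph with variable nodes V = {0..<n} and constraint nodes F = {0..<m}
  is a pair (n, cs) where cs is a list of length m; the i-th entry (xs, psi) gives
  the neighbourhood tuple (a list of length k) and the weight function of constraint i.
  Weight functions take the tuple of values (a list over Omega) as argument.\<close>

type_synonym 'o fg = "nat \<times> (nat list \<times> ('o list \<Rightarrow> real)) list"

definition vars :: "'o fg \<Rightarrow> nat set" where "vars G = {..<fst G}"
definition facs :: "'o fg \<Rightarrow> nat set" where "facs G = {..<length (snd G)}"
definition nb :: "'o fg \<Rightarrow> nat \<Rightarrow> nat list" where "nb G a = fst (snd G ! a)"
definition nbset :: "'o fg \<Rightarrow> nat \<Rightarrow> nat set" where "nbset G a = set (nb G a)"
definition wt :: "'o fg \<Rightarrow> nat \<Rightarrow> 'o list \<Rightarrow> real" where "wt G a = snd (snd G ! a)"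

text \<open>Configurations on U: Omega^U, as extensional functions.\<close>
definition configs :: "nat set \<Rightarrow> (nat \<Rightarrow> 'o) set" where
  "configs U = PiE U (\<lambda>_. UNIV)"

definition psi_fac :: "'o fg \<Rightarrow> nat \<Rightarrow> (nat \<Rightarrow> 'o) \<Rightarrow> real" where
  "psi_fac G a \<sigma> = wt G a (map \<sigma> (nb G a))"

definition psi_G :: "'o fg \<Rightarrow> (nat \<Rightarrow> 'o) \<Rightarrow> real" where
  "psi_G G \<sigma> = (\<Prod>a\<in>facs G. psi_fac G a \<sigma>)"

definition Zfn :: "'o fg \<Rightarrow> real" where
  "Zfn G = (\<Sum>\<tau>\<in>configs (vars G). psi_G G \<tau>)"

text \<open>Gibbs measure of a set of configurations.\<close>
definition gibbs_set :: "'o fg \<Rightarrow> (nat \<Rightarrow> 'o) set \<Rightarrow> real" where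
  "gibbs_set G S = (\<Sum>\<sigma>\<in>S. psi_G G \<sigma> / Zfn G)"

text \<open>Marginal on U of the Gibbs measure conditioned on S.\<close>
definition marg_cond :: "'o fg \<Rightarrow> nat set \<Rightarrow> (nat \<Rightarrow> 'o) set \<Rightarrow> (nat \<Rightarrow> 'o) \<Rightarrow> real" where
  "marg_cond G U S \<tau> =
     (\<Sum>\<sigma>\<in>S. if restrict \<sigma> U = \<tau> then psi_G G \<sigma> else 0) / (\<Sum>\<sigma>\<in>S. psi_G G \<sigma>)"

text \<open>Set of constraint nodes adjacent to x.\<close>
definition dvar :: "'o fg \<Rightarrow> nat \<Rightarrow> nat set" where
  "dvar G x = {a\<in>facs G. x \<in> nbset G a}"

text \<open>Standard message mu_{G, a -> x}[tau | S].\<close>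
definition msg_w :: "'o fg \<Rightarrow> (nat \<Rightarrow> 'o) set \<Rightarrow> nat \<Rightarrow> nat \<Rightarrow> 'o \<Rightarrow> real" where
  "msg_w G S a x \<tau> =
     (\<Sum>\<sigma>\<in>S. if \<sigma> x = \<tau> then (\<Prod>b\<in>facs G - (dvar G x - {a}). psi_fac G b \<sigma>) else 0)"

definition msg :: "'o fg \<Rightarrow> (nat \<Rightarrow> 'o) set \<Rightarrow> nat \<Rightarrow> nat \<Rightarrow> 'o \<Rightarrow> real" where
  "msg G S a x \<tau> = msg_w G S a x \<tau> / (\<Sum>\<tau>'\<in>UNIV. msg_w G S a x \<tau>')"

text \<open>Constraint nodes of the induced subgraph G[U], and boundary of U.\<close>
definition inner :: "'o fg \<Rightarrow> nat set \<Rightarrow> nat set" where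
  "inner G U = {a\<in>facs G. nbset G a \<subseteq> U}"

definition bdry :: "'o fg \<Rightarrow> nat set \<Rightarrow> nat set" where
  "bdry G U = {a\<in>facs G. nbset G a \<inter> U \<noteq> {} \<and> nbset G a - U \<noteq> {}}"

definition xto :: "'o fg \<Rightarrow> nat \<Rightarrow> nat set \<Rightarrow> nat" where
  "xto G a U = the_elem (nbset G a \<inter> U)"

text \<open>The bipartite graph G[U]: vertices Inl x (x in U) and Inr a (a in inner G U).\<close>
definition sub_verts :: "'o fg \<Rightarrow> nat set \<Rightarrow> (nat + nat) set" where
  "sub_verts G U = Inl ` U \<union> Inr ` inner G U"

definition sub_adj :: "'o fg \<Rightarrow> nat set \<Rightarrow> (nat + nat) \<Rightarrow> (nat + nat) \<Rightarrow> bool" where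
  "sub_adj G U v w \<longleftrightarrow>
     (\<exists>x a. x \<in> U \<and> a \<in> inner G U \<and> x \<in> nbset G a \<and>
        ((v = Inl x \<and> w = Inr a) \<or> (v = Inr a \<and> w = Inl x)))"

definition sub_acyclic :: "'o fg \<Rightarrow> nat set \<Rightarrow> bool" where
  "sub_acyclic G U \<longleftrightarrow>
     \<not> (\<exists>vs. length vs \<ge> 3 \<and> distinct vs \<and>
          (\<forall>i<length vs. sub_adj G U (vs ! i) (vs ! ((i + 1) mod length vs))))"

definition sub_ncomp :: "'o fg \<Rightarrow> nat set \<Rightarrow> nat" where
  "sub_ncomp G U = card (sub_verts G U // ({(v, w). sub_adj G U v w})\<^sup>*)"

definition cavity :: "'o fg \<Rightarrow> nat set \<Rightarrow> bool" where
  "cavity G U \<longleftrightarrow> U \<noteq> {} \<and> U \<subseteq> vars G \<and>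
     sub_acyclic G U \<and>
     (\<forall>a\<in>facs G. \<not> nbset G a \<subseteq> U \<longrightarrow> card (nbset G a \<inter> U) \<le> 1) \<and>
     (\<forall>a\<in>facs G. \<forall>b\<in>facs G. a \<noteq> b \<and> nbset G a \<inter> U \<noteq> {} \<and> nbset G b \<inter> U \<noteq> {}
          \<longrightarrow> (nbset G a \<inter> nbset G b) - U = {})"

definition cav_set :: "'o fg \<Rightarrow> nat \<Rightarrow> nat \<Rightarrow> nat set set" where
  "cav_set G l r = {U. cavity G U \<and> card U = l \<and> sub_ncomp G U = r}"

text \<open>bar mu_{G,U}[sigma | S], the normalisation of mu_{G[U]} cancelling.\<close>
definition bar_w :: "'o fg \<Rightarrow> nat set \<Rightarrow> (nat \<Rightarrow> 'o) set \<Rightarrow> (nat \<Rightarrow> 'o) \<Rightarrow> real" where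
  "bar_w G U S \<sigma> = (\<Prod>a\<in>inner G U. psi_fac G a \<sigma>) *
       (\<Prod>a\<in>bdry G U. msg G S a (xto G a U) (\<sigma> (xto G a U)))"

definition bar_mu :: "'o fg \<Rightarrow> nat set \<Rightarrow> (nat \<Rightarrow> 'o) set \<Rightarrow> (nat \<Rightarrow> 'o) \<Rightarrow> real" where
  "bar_mu G U S \<sigma> = bar_w G U S \<sigma> / (\<Sum>\<tau>\<in>configs U. bar_w G U S \<tau>)"

definition bethe_state :: "'o fg \<Rightarrow> real \<Rightarrow> nat \<Rightarrow> (nat \<Rightarrow> 'o) set \<Rightarrow> bool" where
  "bethe_state G \<epsilon> ell S \<longleftrightarrow>
     (\<forall>l r. 1 \<le> r \<and> r \<le> l \<and> l \<le> ell \<and> cav_set G l r \<noteq> {} \<longrightarrow>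
        (\<Sum>U\<in>cav_set G l r. \<Sum>\<sigma>\<in>configs U. \<bar>marg_cond G U S \<sigma> - bar_mu G U S \<sigma>\<bar>)
          < \<epsilon> * real (card (cav_set G l r)))"

text \<open>Random factor graphs.\<close>
fun iid_list :: "nat \<Rightarrow> 'a pmf \<Rightarrow> 'a list pmf" where
  "iid_list 0 p = return_pmf []"
| "iid_list (Suc m) p = bind_pmf p (\<lambda>x. map_pmf (Cons x) (iid_list m p))"

definition rand_con :: "nat \<Rightarrow> ('o list \<Rightarrow> real) pmf \<Rightarrow> nat \<Rightarrow> (nat list \<times> ('o list \<Rightarrow> real)) pmf" where
  "rand_con k P n = pair_pmf (pmf_of_set {xs. length xs = k \<and> set xs \<subseteq> {..<n}}) P"

definition rand_fg_m :: "nat \<Rightarrow> ('o list \<Rightarrow> real) pmf \<Rightarrow> nat \<Rightarrow> nat \<Rightarrow> 'o fg pmf" where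
  "rand_fg_m k P n m = map_pmf (\<lambda>cs. (n, cs)) (iid_list m (rand_con k P n))"

definition rand_fg :: "nat \<Rightarrow> ('o list \<Rightarrow> real) pmf \<Rightarrow> real \<Rightarrow> nat \<Rightarrow> 'o fg pmf" where
  "rand_fg k P d n = bind_pmf (poisson_pmf (d * real n / real k)) (rand_fg_m k P n)"

end

(*
The states are the subcubes obtained by fixing the spins of the first theta variables, where theta
is bounded in terms of the desired accuracy and depends on n and m only. The energy, i.e. the mean
square of the conditional marginal of one further variable given the pinned ones, is bounded and
increases with the number of pinned variables, so it is nearly constant on a long stretch for some
theta; since the random graph is exchangeable, boundedly many further variables are then nearly
independent given the pinned spins, on average over the graph and the state.

For a cavity U, the constraints that do not touch U form a graph independent of the touching ones.
If the outer neighbours of U are nearly independent under its Gibbs measure, then both the true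
marginal on U and the Bethe approximation are close to the same product expression.

Summing over cavities by the first moment method, the total error over cavities with f inner
constraints is small compared to n^(l - (k-1) f). Conversely, one such cavity already forces that
many cavities with the same l and r: its components C with |C| = 1 + (k-1) * (number of inner
constraints) can be replaced by isolated vertices and one isolated star, of which there are linearly
many by a variance bound.
*)
theory Submission
  imports Defs "HOL-Real_Asymp.Real_Asymp"
begin

section \<open>Expectations over lists of independent entries\<close>

text \<open>The number of pinned variables must not look at the graph: exchangeability and Markov's
  inequality both need it fixed in advance. So the energy is replaced by its mean, and one flat
  stretch has to serve every cavity size up to K and every number of touching constraints up to M at
  once; the mean energies are therefore summed over all these pairs before the pigeonhole step. Sets
  touched by more than M constraints are charged the trivial error 2, at the cost of the tail of an
  exponential series.

  The second obstacle is the denominator. A Bethe state is judged relative to the number of cavities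
  with given l and r, which is random, and l and r do not determine the number f of inner
  constraints, since a constraint may list a variable repeatedly. The error of each cavity is
  therefore divided by its own power n^(l - (k-1) f). The sum of these quotients has small mean,
  while each cavity that is present certifies a number of cavities of at least a constant times its
  power of n. Comparing term by term avoids any concentration statement for the cavity counts.

  All errors at one cavity are relative, at the price of powers of c, where the weights lie in
  [1/c, c].\<close>

primrec iid_mean :: "'a pmf \<Rightarrow> nat \<Rightarrow> ('a list \<Rightarrow> real) \<Rightarrow> real" where
  "iid_mean p 0 f = f []"
| "iid_mean p (Suc m) f = (\<Sum>c\<in>set_pmf p. pmf p c * iid_mean p m (\<lambda>cs. f (c # cs)))"

lemma iid_mean_add: "iid_mean p m (\<lambda>cs. f cs + g cs) = iid_mean p m f + iid_mean p m g"
  by (induction m arbitrary: f g) (simp_all add: distrib_left sum.distrib)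

lemma iid_mean_cmult: "iid_mean p m (\<lambda>cs. a * f cs) = a * iid_mean p m f"
  by (induction m arbitrary: f) (simp_all add: sum_distrib_left mult.left_commute)

lemma iid_mean_cmult_right: "iid_mean p m (\<lambda>cs. f cs * a) = iid_mean p m f * a"
  using iid_mean_cmult[of p m a f] by (simp add: mult.commute)

lemma iid_mean_zero [simp]: "iid_mean p m (\<lambda>cs. 0) = 0"
  by (induction m) simp_all

lemma iid_mean_diff: "iid_mean p m (\<lambda>cs. f cs - g cs) = iid_mean p m f - iid_mean p m g"
  by (induction m arbitrary: f g) (simp_all add: right_diff_distrib sum_subtractf)

lemma iid_mean_sum: "iid_mean p m (\<lambda>cs. \<Sum>i\<in>I. f i cs) = (\<Sum>i\<in>I. iid_mean p m (f i))"
  by (induction I rule: infinite_finite_induct) (simp_all add: iid_mean_add)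

lemma iid_mean_mono:
  assumes "\<And>cs. length cs = m \<Longrightarrow> set cs \<subseteq> set_pmf p \<Longrightarrow> f cs \<le> g cs"
  shows "iid_mean p m f \<le> iid_mean p m g"
  using assms
proof (induction m arbitrary: f g)
  case (Suc m)
  have "iid_mean p m (\<lambda>cs. f (c # cs)) \<le> iid_mean p m (\<lambda>cs. g (c # cs))" if "c \<in> set_pmf p" for c
    using Suc.prems that by (intro Suc.IH) auto
  then show ?case by (auto intro!: sum_mono mult_left_mono)
qed simp

lemma iid_mean_cong:
  assumes "\<And>cs. length cs = m \<Longrightarrow> set cs \<subseteq> set_pmf p \<Longrightarrow> f cs = g cs"
  shows "iid_mean p m f = iid_mean p m g"
  using assms by (intro antisym iid_mean_mono) auto

lemma iid_mean_nonneg: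
  assumes "\<And>cs. length cs = m \<Longrightarrow> set cs \<subseteq> set_pmf p \<Longrightarrow> 0 \<le> f cs"
  shows "0 \<le> iid_mean p m f"
  using iid_mean_mono[of m p "\<lambda>_. 0" f] assms by simp

lemma iid_mean_const:
  assumes "finite (set_pmf p)"
  shows "iid_mean p m (\<lambda>cs. a) = a"
  using assms by (induction m) (simp_all add: sum_distrib_right[symmetric] sum_pmf_eq_1)

lemma iid_mean_prod_list:
  "iid_mean p m (\<lambda>cs. prod_list (map \<phi> cs)) = (\<Sum>c\<in>set_pmf p. pmf p c * \<phi> c) ^ m"
  by (induction m) (simp_all add: iid_mean_cmult sum_distrib_right mult.assoc)

lemma set_iid_list: "set_pmf (iid_list m p) = {cs. length cs = m \<and> set cs \<subseteq> set_pmf p}"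
proof (induction m)
  case (Suc m)
  then show ?case by (auto simp: length_Suc_conv)
qed auto

text \<open>\<open>iid_mean\<close> is an iterated sum over the support, so linearity and
  monotonicity are plain inductions without integrability; for finite support this is the true
  expectation.\<close>

lemma expectation_iid_list:
  assumes "finite (set_pmf p)"
  shows "measure_pmf.expectation (iid_list m p) f = iid_mean p m f"
proof (induction m arbitrary: f)
  case (Suc m)
  have fin: "finite (set_pmf (iid_list m p))"
    using assms finite_lists_length_eq[of "set_pmf p" m] by (simp add: set_iid_list conj_commute)
  show ?case
    using assms fin Suc
    by (simp add: pmf_expectation_bind[of "set_pmf p"])
qed simp

lemma prob_iid_list:
  assumes "finite (set_pmf p)"
  shows "measure_pmf.prob (iid_list m p) A = iid_mean p m (indicator A)"
  using expectation_iid_list[OF assms, of m "indicator A"] by simp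

lemma iid_markov:
  assumes fin: "finite (set_pmf p)" and a: "0 < a"
    and nn: "\<And>cs. length cs = m \<Longrightarrow> set cs \<subseteq> set_pmf p \<Longrightarrow> 0 \<le> f cs"
  shows "measure_pmf.prob (iid_list m p) {cs. a \<le> f cs} \<le> iid_mean p m f / a"
proof -
  have "iid_mean p m (indicator {cs. a \<le> f cs}) \<le> iid_mean p m (\<lambda>cs. f cs * (1 / a))"
  proof (rule iid_mean_mono)
    fix cs assume "length cs = m" "set cs \<subseteq> set_pmf p"
    then show "indicator {cs. a \<le> f cs} cs \<le> f cs * (1 / a)"
      using nn[of cs] a by (auto simp: indicator_def field_simps)
  qed
  then show ?thesis unfolding iid_mean_cmult_right prob_iid_list[OF fin] by simp
qed

section \<open>Splitting an independent sample by a property of its entries\<close>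

definition split_mean :: "'a pmf \<Rightarrow> ('a \<Rightarrow> bool) \<Rightarrow> nat \<Rightarrow> nat \<Rightarrow> ('a list \<Rightarrow> 'a list \<Rightarrow> real) \<Rightarrow> real" where
  "split_mean p Q t u g = iid_mean p t (\<lambda>ts. of_bool (\<forall>c\<in>set ts. Q c) *
     iid_mean p u (\<lambda>gs. of_bool (\<forall>c\<in>set gs. \<not> Q c) * g ts gs))"

lemma split_mean_Suc_left:
  "split_mean p Q (Suc t) u g =
     (\<Sum>c\<in>set_pmf p. pmf p c * (of_bool (Q c) * split_mean p Q t u (\<lambda>ts. g (c # ts))))"
  unfolding split_mean_def
  by (auto intro!: sum.cong simp: iid_mean_cmult[symmetric] of_bool_def intro!: iid_mean_cong)

lemma split_mean_Suc_right:
  "split_mean p Q t (Suc u) g =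
     (\<Sum>c\<in>set_pmf p. pmf p c * (of_bool (\<not> Q c) * split_mean p Q t u (\<lambda>ts gs. g ts (c # gs))))"
proof -
  have "split_mean p Q t (Suc u) g = iid_mean p t (\<lambda>ts. \<Sum>c\<in>set_pmf p. pmf p c * (of_bool (\<not> Q c) *
     (of_bool (\<forall>c\<in>set ts. Q c) * iid_mean p u (\<lambda>gs. of_bool (\<forall>c\<in>set gs. \<not> Q c) * g ts (c # gs)))))"
    unfolding split_mean_def
    by (intro iid_mean_cong) (auto simp: sum_distrib_left of_bool_def intro!: sum.cong)
  then show ?thesis
    by (simp add: iid_mean_sum iid_mean_cmult split_mean_def)
qed

text \<open>All m choose t placements of the entries with property \<open>Q\<close> contribute the
  same, and the two sublists are then independent samples. In the induction the new entry goes in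
  front of either block, and Pascal's rule merges the two sums. This is what makes the constraints
  touching a set independent of the remaining ones.\<close>

lemma iid_mean_split:
  "iid_mean p m (\<lambda>cs. g (filter Q cs) (filter (\<lambda>c. \<not> Q c) cs)) =
     (\<Sum>t\<le>m. real (m choose t) * split_mean p Q t (m - t) g)"
proof (induction m arbitrary: g)
  case 0
  then show ?case by (simp add: split_mean_def)
next
  case (Suc m)
  let ?H = "\<lambda>t u. split_mean p Q t u g"
  have "iid_mean p (Suc m) (\<lambda>cs. g (filter Q cs) (filter (\<lambda>c. \<not> Q c) cs)) =
    (\<Sum>c\<in>set_pmf p. pmf p c * (\<Sum>t\<le>m. real (m choose t) *
       (of_bool (Q c) * split_mean p Q t (m - t) (\<lambda>ts. g (c # ts)) +
        of_bool (\<not> Q c) * split_mean p Q t (m - t) (\<lambda>ts gs. g ts (c # gs)))))"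
  proof (simp only: iid_mean.simps, intro sum.cong refl arg_cong2[where f="(*)"])
    fix c
    show "iid_mean p m (\<lambda>cs. g (filter Q (c # cs)) (filter (\<lambda>c. \<not> Q c) (c # cs))) =
      (\<Sum>t\<le>m. real (m choose t) *
       (of_bool (Q c) * split_mean p Q t (m - t) (\<lambda>ts. g (c # ts)) +
        of_bool (\<not> Q c) * split_mean p Q t (m - t) (\<lambda>ts gs. g ts (c # gs))))"
      using Suc.IH[of "\<lambda>ts. g (c # ts)"] Suc.IH[of "\<lambda>ts gs. g ts (c # gs)"]
      by (cases "Q c") simp_all
  qed
  also have "\<dots> = (\<Sum>t\<le>m. real (m choose t) * (?H (Suc t) (m - t) + ?H t (Suc (m - t))))"
    unfolding sum_distrib_left
    by (subst sum.swap)
       (auto intro!: sum.cong simp: split_mean_Suc_left split_mean_Suc_right sum_distrib_left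
         distrib_left sum.distrib mult.left_commute)
  also have "\<dots> = (\<Sum>t\<le>m. real (m choose t) * ?H (Suc t) (m - t)) +
                    (\<Sum>t\<le>m. real (m choose t) * ?H t (Suc m - t))"
    by (simp add: distrib_left sum.distrib Suc_diff_le)
  also have "(\<Sum>t\<le>m. real (m choose t) * ?H t (Suc m - t)) =
      (\<Sum>t\<le>Suc m. real (m choose t) * ?H t (Suc m - t))"
    by simp
  also have "\<dots> = ?H 0 (Suc m) + (\<Sum>t\<le>m. real (m choose Suc t) * ?H (Suc t) (m - t))"
    by (subst sum.atMost_Suc_shift) simp
  finally show ?case
    by (subst sum.atMost_Suc_shift) (simp add: distrib_right sum.distrib)
qed

text \<open>Bounded differences, by conditioning on the first entry: the conditional mean varies by
  at most \<open>b\<close>, which adds the square of \<open>b\<close> to the conditional variance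
  bounded by induction.\<close>

lemma variance_iid:
  assumes fin: "finite (set_pmf p)"
    and bd: "\<And>xs ys c c'. set (xs @ c # c' # ys) \<subseteq> set_pmf p \<Longrightarrow> length xs + length ys + 1 = m \<Longrightarrow>
               \<bar>f (xs @ c # ys) - f (xs @ c' # ys)\<bar> \<le> b"
    and b: "0 \<le> b"
  shows "iid_mean p m (\<lambda>cs. (f cs - iid_mean p m f)\<^sup>2) \<le> real m * b\<^sup>2"
  using bd
proof (induction m arbitrary: f)
  case (Suc m)
  let ?E = "\<lambda>h. \<Sum>c\<in>set_pmf p. pmf p c * h c"
  define g where "g c = iid_mean p m (\<lambda>cs. f (c # cs))" for c
  define \<mu> where "\<mu> = iid_mean p (Suc m) f"
  have one: "(\<Sum>c\<in>set_pmf p. pmf p c) = 1" using fin by (simp add: sum_pmf_eq_1)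
  have \<mu>: "\<mu> = ?E g" by (simp add: \<mu>_def g_def)
  have gg: "\<bar>g c - g c'\<bar> \<le> b" if "c \<in> set_pmf p" "c' \<in> set_pmf p" for c c'
  proof -
    have "g c - g c' \<le> b" if "c \<in> set_pmf p" "c' \<in> set_pmf p" for c c'
    proof -
      have "iid_mean p m (\<lambda>cs. f (c # cs) - f (c' # cs)) \<le> iid_mean p m (\<lambda>cs. b)"
        using Suc.prems[of "[]" c c'] that
        by (intro iid_mean_mono) (smt (verit) append_Nil insert_subset list.simps(15) list.size(3) Suc_eq_plus1 add_0)
      then show ?thesis by (simp add: iid_mean_diff iid_mean_const[OF fin] g_def)
    qed
    from this[of c c'] this[of c' c] show ?thesis using that by auto
  qed
  have dev: "(g c - \<mu>)\<^sup>2 \<le> b\<^sup>2" if "c \<in> set_pmf p" for c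
  proof -
    have "g c - \<mu> = ?E (\<lambda>c'. g c - g c')"
      using one by (simp add: \<mu> right_diff_distrib sum_subtractf sum_distrib_right[symmetric])
    also have "\<bar>\<dots>\<bar> \<le> ?E (\<lambda>c'. b)"
      using gg that by (intro order_trans[OF sum_abs] sum_mono) (auto simp: abs_mult intro!: mult_left_mono)
    also have "\<dots> = b" using one by (simp add: sum_distrib_right[symmetric])
    finally show ?thesis using b by (metis abs_le_square_iff abs_of_nonneg)
  qed
  have inner: "iid_mean p m (\<lambda>cs. (f (c # cs) - \<mu>)\<^sup>2) \<le> real m * b\<^sup>2 + b\<^sup>2"
    if c: "c \<in> set_pmf p" for c
  proof -
    have "iid_mean p m (\<lambda>cs. (f (c # cs) - \<mu>)\<^sup>2) =
      iid_mean p m (\<lambda>cs. (f (c # cs) - g c)\<^sup>2 + (2 * (g c - \<mu>)) * (f (c # cs) - g c) + (g c - \<mu>)\<^sup>2)"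
      by (intro iid_mean_cong) (simp add: power2_eq_square algebra_simps)
    \<comment> \<open>The cross term has mean zero, because \<open>g c\<close> is the mean of
      \<open>f (c # cs)\<close>.\<close>
    also have "\<dots> = iid_mean p m (\<lambda>cs. (f (c # cs) - g c)\<^sup>2) + (g c - \<mu>)\<^sup>2"
      unfolding iid_mean_add iid_mean_cmult iid_mean_diff iid_mean_const[OF fin]
      by (simp add: g_def)
    also have "iid_mean p m (\<lambda>cs. (f (c # cs) - g c)\<^sup>2) \<le> real m * b\<^sup>2"
      unfolding g_def
    proof (rule Suc.IH)
      fix xs ys a a' assume "set (xs @ a # a' # ys) \<subseteq> set_pmf p" "length xs + length ys + 1 = m"
      then show "\<bar>f (c # xs @ a # ys) - f (c # xs @ a' # ys)\<bar> \<le> b"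
        using Suc.prems[of "c # xs" a a' ys] c by auto
    qed
    finally show ?thesis using dev[OF c] by linarith
  qed
  have "?E (\<lambda>c. iid_mean p m (\<lambda>cs. (f (c # cs) - \<mu>)\<^sup>2)) \<le> ?E (\<lambda>c. real m * b\<^sup>2 + b\<^sup>2)"
    using inner by (intro sum_mono mult_left_mono) auto
  also have "\<dots> = real (Suc m) * b\<^sup>2"
    using one by (simp only: sum_distrib_right[symmetric]) (simp add: algebra_simps)
  finally show ?case by (simp add: \<mu>_def)
qed (simp)

section \<open>Pinning\<close>

lemma finite_configs [simp]: "finite U \<Longrightarrow> finite (configs U :: (nat \<Rightarrow> 'o::finite) set)"
  unfolding configs_def by (intro finite_PiE) auto

lemma configs_nonempty [simp]: "configs U \<noteq> {}"
  unfolding configs_def by (simp add: PiE_eq_empty_iff)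

definition vecs :: "nat \<Rightarrow> 'o list set" where "vecs j = {\<tau>. length \<tau> = j}"

lemma finite_vecs [simp]: "finite (vecs j :: 'o::finite list set)"
  using finite_lists_length_eq[of "UNIV :: 'o set" j] by (simp add: vecs_def)

lemma map_in_vecs [simp]: "map \<sigma> zs \<in> vecs j \<longleftrightarrow> length zs = j"
  by (simp add: vecs_def)

lemma sum_vecs_Suc:
  "(\<Sum>\<eta>\<in>vecs (Suc j). f \<eta>) = (\<Sum>\<eta>\<in>vecs j. \<Sum>s\<in>(UNIV :: 'o::finite set). f (\<eta> @ [s]))"
proof -
  have "(\<Sum>\<eta>\<in>vecs (Suc j). f \<eta>) = (\<Sum>(\<eta>, s)\<in>vecs j \<times> (UNIV :: 'o set). f (\<eta> @ [s]))"
    by (rule sum.reindex_bij_witness[of _ "\<lambda>(\<eta>, s). \<eta> @ [s]" "\<lambda>\<eta>. (butlast \<eta>, last \<eta>)"])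
       (auto simp: vecs_def length_Suc_conv_rev)
  then show ?thesis by (simp add: sum.cartesian_product)
qed

lemma sum_vecs_add:
  "(\<Sum>\<tau>\<in>(vecs (i + j) :: 'o::finite list set). f \<tau>) = (\<Sum>\<tau>\<in>vecs i. \<Sum>\<eta>\<in>vecs j. f (\<tau> @ \<eta>))"
proof -
  have "(\<Sum>\<tau>\<in>(vecs (i + j) :: 'o list set). f \<tau>) = (\<Sum>(\<tau>, \<eta>)\<in>vecs i \<times> vecs j. f (\<tau> @ \<eta>))"
    by (rule sum.reindex_bij_witness[of _ "\<lambda>(\<tau>, \<eta>). \<tau> @ \<eta>" "\<lambda>\<tau>. (take i \<tau>, drop i \<tau>)"])
       (auto simp: vecs_def)
  then show ?thesis by (simp add: sum.cartesian_product)
qed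

section \<open>Joint laws of spin tuples, energy and dependence\<close>

definition law :: "nat set \<Rightarrow> ((nat \<Rightarrow> 'o) \<Rightarrow> real) \<Rightarrow> nat list \<Rightarrow> 'o list \<Rightarrow> real" where
  "law V w zs \<tau> =
     (\<Sum>\<sigma>\<in>configs V. if map \<sigma> zs = \<tau> then w \<sigma> else 0) / (\<Sum>\<sigma>\<in>configs V. w \<sigma>)"

text \<open>The probability of \<tau> times the squared conditional probability of s, with one
  factor cancelled. If a pinned value is impossible, the numerator vanishes too and the quotient is
  0 by convention.\<close>

definition energy :: "nat set \<Rightarrow> ((nat \<Rightarrow> 'o::finite) \<Rightarrow> real) \<Rightarrow> nat list \<Rightarrow> nat \<Rightarrow> real" where
  "energy V w zs y = (\<Sum>\<tau>\<in>vecs (length zs). \<Sum>s\<in>UNIV. (law V w (zs @ [y]) (\<tau> @ [s]))\<^sup>2 / law V w zs \<tau>)"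

text \<open>The l1 distance between the joint law and the law in which the spins along
  \<open>ys\<close> are conditionally independent given those along \<open>zs\<close>; the factor
  \<open>law V w zs \<tau>\<close> makes it an average over the pinned value.\<close>

definition dep :: "nat set \<Rightarrow> ((nat \<Rightarrow> 'o::finite) \<Rightarrow> real) \<Rightarrow> nat list \<Rightarrow> nat list \<Rightarrow> real" where
  "dep V w zs ys = (\<Sum>\<tau>\<in>vecs (length zs). \<Sum>\<eta>\<in>vecs (length ys).
     \<bar>law V w (zs @ ys) (\<tau> @ \<eta>) -
       law V w zs \<tau> * (\<Prod>i<length ys. law V w (zs @ [ys ! i]) (\<tau> @ [\<eta> ! i]) / law V w zs \<tau>)\<bar>)"

locale pos_weight =
  fixes V :: "nat set" and w :: "(nat \<Rightarrow> 'o::finite) \<Rightarrow> real"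
  assumes finV [simp]: "finite V" and pos: "\<And>\<sigma>. \<sigma> \<in> configs V \<Longrightarrow> 0 < w \<sigma>"
begin

abbreviation "Q \<equiv> law V w"

lemma total_pos: "0 < (\<Sum>\<sigma>\<in>configs V. w \<sigma>)"
  by (intro sum_pos) (auto intro: pos)

lemma law_nonneg: "0 \<le> Q zs \<tau>"
  unfolding law_def using total_pos pos
  by (intro divide_nonneg_pos sum_nonneg) (auto intro: less_imp_le)

text \<open>Every configuration shows exactly one value on \<open>us\<close>. The summed block
  stands in the middle, since the pinned spins precede it and the observed spin follows it.\<close>

lemma law_middle:
  assumes "length \<tau> = length zs"
  shows "(\<Sum>\<eta>\<in>vecs (length us). Q (zs @ us @ vs) (\<tau> @ \<eta> @ \<nu>)) = Q (zs @ vs) (\<tau> @ \<nu>)"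
proof -
  have "(\<Sum>\<eta>\<in>vecs (length us). \<Sum>\<sigma>\<in>configs V. if map \<sigma> (zs @ us @ vs) = \<tau> @ \<eta> @ \<nu> then w \<sigma> else 0)
      = (\<Sum>\<sigma>\<in>configs V. \<Sum>\<eta>\<in>vecs (length us). if map \<sigma> us = \<eta> then
           (if map \<sigma> (zs @ vs) = \<tau> @ \<nu> then w \<sigma> else 0) else 0)"
    using assms by (subst sum.swap) (auto intro!: sum.cong simp: vecs_def append_eq_append_conv)
  also have "\<dots> = (\<Sum>\<sigma>\<in>configs V. if map \<sigma> (zs @ vs) = \<tau> @ \<nu> then w \<sigma> else 0)"
    by (intro sum.cong refl) (subst sum.delta', auto)
  finally show ?thesis by (simp add: law_def sum_divide_distrib[symmetric])
qed

lemma law_sum: "(\<Sum>\<tau>\<in>vecs (length zs). Q zs \<tau>) = 1"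
  using law_middle[of "[]" "[]" zs "[]" "[]"] total_pos by (simp add: law_def)

lemma law_last:
  assumes "length \<tau> = length zs"
  shows "(\<Sum>s\<in>UNIV. Q (zs @ [y]) (\<tau> @ [s])) = Q zs \<tau>"
  using law_middle[of \<tau> zs "[y]" "[]" "[]"] assms
  by (simp add: sum_vecs_Suc[of _ 0, simplified]) (simp add: vecs_def)

lemma law_mono: 
  assumes "length \<tau> = length zs" "length \<eta> = length us"
  shows "Q (zs @ us @ vs) (\<tau> @ \<eta> @ \<nu>) \<le> Q (zs @ vs) (\<tau> @ \<nu>)"
  unfolding law_middle[OF assms(1), of us vs \<nu>, symmetric]
  using assms(2) by (intro member_le_sum[of \<eta>]) (auto simp: law_nonneg, simp add: vecs_def)

lemma law_last_le: "length \<tau> = length zs \<Longrightarrow> Q (zs @ [y]) (\<tau> @ [s]) \<le> Q zs \<tau>"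
  using law_mono[of \<tau> zs "[s]" "[y]" "[]" "[]"] by simp

lemma energy_nonneg: "0 \<le> energy V w zs y"
  unfolding energy_def by (intro sum_nonneg divide_nonneg_nonneg) (auto intro: law_nonneg)

lemma energy_le_1: "energy V w zs y \<le> 1"
proof -
  have "energy V w zs y \<le> (\<Sum>\<tau>\<in>vecs (length zs). \<Sum>s\<in>UNIV. Q (zs @ [y]) (\<tau> @ [s]))"
    unfolding energy_def
  proof (intro sum_mono)
    fix \<tau> :: "'o list" and s assume "\<tau> \<in> vecs (length zs)"
    then have "Q (zs @ [y]) (\<tau> @ [s]) \<le> Q zs \<tau>" by (simp add: vecs_def law_last_le)
    then show "(Q (zs @ [y]) (\<tau> @ [s]))\<^sup>2 / Q zs \<tau> \<le> Q (zs @ [y]) (\<tau> @ [s])"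
      using law_nonneg[of "zs @ [y]" "\<tau> @ [s]"] law_nonneg[of zs \<tau>]
      by (cases "Q zs \<tau> = 0") (auto simp: power2_eq_square divide_simps intro: mult_mono)
  qed
  also have "\<dots> = (\<Sum>\<tau>\<in>vecs (length zs). Q zs \<tau>)"
    by (intro sum.cong refl law_last) (simp add: vecs_def)
  finally show ?thesis by (simp add: law_sum)
qed

text \<open>Pythagoras for the martingale of conditional marginals of \<open>y\<close>.\<close>

lemma energy_increment:
  "energy V w (zs @ us) y - energy V w zs y =
     (\<Sum>\<tau>\<in>vecs (length zs). \<Sum>\<eta>\<in>vecs (length us). \<Sum>s\<in>UNIV. Q (zs @ us) (\<tau> @ \<eta>) *
       (Q (zs @ us @ [y]) (\<tau> @ \<eta> @ [s]) / Q (zs @ us) (\<tau> @ \<eta>) -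
        Q (zs @ [y]) (\<tau> @ [s]) / Q zs \<tau>)\<^sup>2)"
proof -
  have main: "(\<Sum>\<eta>\<in>vecs (length us). Q (zs @ us) (\<tau> @ \<eta>) *
       (Q (zs @ us @ [y]) (\<tau> @ \<eta> @ [s]) / Q (zs @ us) (\<tau> @ \<eta>) - Q (zs @ [y]) (\<tau> @ [s]) / Q zs \<tau>)\<^sup>2) =
     (\<Sum>\<eta>\<in>vecs (length us). (Q (zs @ us @ [y]) (\<tau> @ \<eta> @ [s]))\<^sup>2 / Q (zs @ us) (\<tau> @ \<eta>)) -
      (Q (zs @ [y]) (\<tau> @ [s]))\<^sup>2 / Q zs \<tau>"
    if \<tau>: "\<tau> \<in> vecs (length zs)" for \<tau> s
  proof -
    have len: "length \<tau> = length zs" using \<tau> by (simp add: vecs_def)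
    define c where "c = Q (zs @ [y]) (\<tau> @ [s]) / Q zs \<tau>"
    have "Q (zs @ us) (\<tau> @ \<eta>) * (Q (zs @ us @ [y]) (\<tau> @ \<eta> @ [s]) / Q (zs @ us) (\<tau> @ \<eta>) - c)\<^sup>2 =
      (Q (zs @ us @ [y]) (\<tau> @ \<eta> @ [s]))\<^sup>2 / Q (zs @ us) (\<tau> @ \<eta>)
        - 2 * c * Q (zs @ us @ [y]) (\<tau> @ \<eta> @ [s]) + c\<^sup>2 * Q (zs @ us) (\<tau> @ \<eta>)"
      if "\<eta> \<in> vecs (length us)" for \<eta>
    \<comment> \<open>If the finer pinned value is impossible, all terms are zero under the
      convention x / 0 = 0.\<close>
    proof (cases "Q (zs @ us) (\<tau> @ \<eta>) = 0")
      case True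
      have "Q (zs @ us @ [y]) (\<tau> @ \<eta> @ [s]) \<le> Q (zs @ us) (\<tau> @ \<eta>)"
        using law_last_le[of "\<tau> @ \<eta>" "zs @ us" y s] len that by (simp add: vecs_def)
      then have "Q (zs @ us @ [y]) (\<tau> @ \<eta> @ [s]) = 0"
        using True law_nonneg[of "zs @ us @ [y]" "\<tau> @ \<eta> @ [s]"] by linarith
      then show ?thesis using True by simp
    next
      case False
      then show ?thesis by (simp add: power2_eq_square field_simps)
    qed
    then have "(\<Sum>\<eta>\<in>vecs (length us). Q (zs @ us) (\<tau> @ \<eta>) *
       (Q (zs @ us @ [y]) (\<tau> @ \<eta> @ [s]) / Q (zs @ us) (\<tau> @ \<eta>) - c)\<^sup>2) =
      (\<Sum>\<eta>\<in>vecs (length us). (Q (zs @ us @ [y]) (\<tau> @ \<eta> @ [s]))\<^sup>2 / Q (zs @ us) (\<tau> @ \<eta>))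
        - 2 * c * (\<Sum>\<eta>\<in>vecs (length us). Q (zs @ us @ [y]) (\<tau> @ \<eta> @ [s]))
        + c\<^sup>2 * (\<Sum>\<eta>\<in>vecs (length us). Q (zs @ us) (\<tau> @ \<eta>))"
      by (simp add: sum.distrib sum_subtractf sum_distrib_left)
    \<comment> \<open>Summing out \<open>us\<close> returns the coarse laws; the cross term is then
      minus twice the last term, which leaves the difference of energies.\<close>
    also have "(\<Sum>\<eta>\<in>vecs (length us). Q (zs @ us @ [y]) (\<tau> @ \<eta> @ [s])) = Q (zs @ [y]) (\<tau> @ [s])"
      using law_middle[OF len] by simp
    also have "(\<Sum>\<eta>\<in>vecs (length us). Q (zs @ us) (\<tau> @ \<eta>)) = Q zs \<tau>"
      using law_middle[OF len, of us "[]" "[]"] by simp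
    finally show ?thesis
      unfolding c_def[symmetric] by (cases "Q zs \<tau> = 0") (simp_all add: c_def power2_eq_square)
  qed
  have "energy V w (zs @ us) y = (\<Sum>\<tau>\<in>vecs (length zs). \<Sum>\<eta>\<in>vecs (length us). \<Sum>s\<in>UNIV.
     (Q (zs @ us @ [y]) (\<tau> @ \<eta> @ [s]))\<^sup>2 / Q (zs @ us) (\<tau> @ \<eta>))"
    by (simp add: energy_def sum_vecs_add)
  then show ?thesis
    unfolding energy_def
    by (simp add: sum_subtractf[symmetric] sum.swap[of _ UNIV] main)
qed

lemma energy_mono: "energy V w zs y \<le> energy V w (zs @ us) y"
proof -
  have "0 \<le> energy V w (zs @ us) y - energy V w zs y"
    unfolding energy_increment by (intro sum_nonneg mult_nonneg_nonneg) (auto intro: law_nonneg)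
  then show ?thesis by simp
qed

text \<open>In place of the Cauchy-Schwarz inequality, |x| is bounded by \<kappa> + x^2 / \<kappa>:
  the constant part costs \<kappa> for each spin value, and the quadratic part sums to the energy
  increment.\<close>

lemma dep_step:
  assumes "0 < \<kappa>"
  shows "(\<Sum>\<tau>\<in>vecs (length zs). \<Sum>\<eta>\<in>vecs (length us). \<Sum>s\<in>UNIV.
       \<bar>Q (zs @ us @ [y]) (\<tau> @ \<eta> @ [s]) - Q (zs @ us) (\<tau> @ \<eta>) * (Q (zs @ [y]) (\<tau> @ [s]) / Q zs \<tau>)\<bar>)
     \<le> real CARD('o) * \<kappa> + (energy V w (zs @ us) y - energy V w zs y) / \<kappa>"
proof -
  let ?d = "\<lambda>\<tau> \<eta> s. Q (zs @ us @ [y]) (\<tau> @ \<eta> @ [s]) / Q (zs @ us) (\<tau> @ \<eta>) - Q (zs @ [y]) (\<tau> @ [s]) / Q zs \<tau>"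
  have "(\<Sum>\<tau>\<in>vecs (length zs). \<Sum>\<eta>\<in>vecs (length us). \<Sum>s\<in>UNIV.
       \<bar>Q (zs @ us @ [y]) (\<tau> @ \<eta> @ [s]) - Q (zs @ us) (\<tau> @ \<eta>) * (Q (zs @ [y]) (\<tau> @ [s]) / Q zs \<tau>)\<bar>)
    \<le> (\<Sum>\<tau>\<in>vecs (length zs). \<Sum>\<eta>\<in>vecs (length us). \<Sum>s\<in>(UNIV::'o set).
         Q (zs @ us) (\<tau> @ \<eta>) * \<kappa> + Q (zs @ us) (\<tau> @ \<eta>) * (?d \<tau> \<eta> s)\<^sup>2 / \<kappa>)"
  proof (intro sum_mono)
    fix \<tau> \<eta> :: "'o list" and s :: 'o
    assume t: "\<tau> \<in> vecs (length zs)" "\<eta> \<in> vecs (length us)"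
    have "Q (zs @ us @ [y]) (\<tau> @ \<eta> @ [s]) \<le> Q (zs @ us) (\<tau> @ \<eta>)"
      using law_last_le[of "\<tau> @ \<eta>" "zs @ us" y s] t by (simp add: vecs_def)
    then have eq: "Q (zs @ us @ [y]) (\<tau> @ \<eta> @ [s]) - Q (zs @ us) (\<tau> @ \<eta>) * (Q (zs @ [y]) (\<tau> @ [s]) / Q zs \<tau>)
        = Q (zs @ us) (\<tau> @ \<eta>) * ?d \<tau> \<eta> s"
      using law_nonneg[of "zs @ us @ [y]" "\<tau> @ \<eta> @ [s]"]
      by (cases "Q (zs @ us) (\<tau> @ \<eta>) = 0") (auto simp: right_diff_distrib)
    have am: "\<bar>x\<bar> \<le> \<kappa> + x\<^sup>2 / \<kappa>" for x
    proof (cases "\<bar>x\<bar> \<le> \<kappa>")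
      case True
      then show ?thesis using assms by (simp add: add_increasing2)
    next
      case False
      then have "\<bar>x\<bar> * \<kappa> \<le> \<bar>x\<bar> * \<bar>x\<bar>" by (intro mult_left_mono) auto
      then have "\<bar>x\<bar> \<le> x\<^sup>2 / \<kappa>" using assms by (simp add: field_simps power2_eq_square)
      then show ?thesis using assms by simp
    qed
    show "\<bar>Q (zs @ us @ [y]) (\<tau> @ \<eta> @ [s]) - Q (zs @ us) (\<tau> @ \<eta>) * (Q (zs @ [y]) (\<tau> @ [s]) / Q zs \<tau>)\<bar>
      \<le> Q (zs @ us) (\<tau> @ \<eta>) * \<kappa> + Q (zs @ us) (\<tau> @ \<eta>) * (?d \<tau> \<eta> s)\<^sup>2 / \<kappa>"
      using mult_left_mono[OF am[of "?d \<tau> \<eta> s"] law_nonneg[of "zs @ us" "\<tau> @ \<eta>"]]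
        law_nonneg[of "zs @ us" "\<tau> @ \<eta>"]
      unfolding eq abs_mult by (simp add: distrib_left)
  qed
  also have "\<dots> = real CARD('o) * \<kappa> * (\<Sum>\<tau>\<in>vecs (length zs). \<Sum>\<eta>\<in>vecs (length us). Q (zs @ us) (\<tau> @ \<eta>))
      + (energy V w (zs @ us) y - energy V w zs y) / \<kappa>"
    unfolding energy_increment
    by (simp add: sum.distrib sum_divide_distrib sum_distrib_left sum_distrib_right mult_ac)
  also have "(\<Sum>\<tau>\<in>vecs (length zs). \<Sum>\<eta>\<in>vecs (length us). Q (zs @ us) (\<tau> @ \<eta>)) = 1"
    using law_sum[of "zs @ us"] by (simp add: sum_vecs_add)
  finally show ?thesis by simp
qed

text \<open>Hybrid argument: with p the product law of \<open>ys\<close>, q their joint law and c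
  the conditional marginal of \<open>y\<close>, write a - p c = (q - p) c + (a - q c). Summing c
  over the spins of \<open>y\<close> gives at most 1, so the old error is not amplified.\<close>

lemma dep_snoc:
  "dep V w zs (ys @ [y]) \<le> dep V w zs ys + (\<Sum>\<tau>\<in>vecs (length zs). \<Sum>\<eta>\<in>vecs (length ys). \<Sum>s\<in>UNIV.
       \<bar>Q (zs @ ys @ [y]) (\<tau> @ \<eta> @ [s]) - Q (zs @ ys) (\<tau> @ \<eta>) * (Q (zs @ [y]) (\<tau> @ [s]) / Q zs \<tau>)\<bar>)"
proof -
  let ?P = "\<lambda>\<tau> \<eta>. Q zs \<tau> * (\<Prod>i<length ys. Q (zs @ [ys ! i]) (\<tau> @ [\<eta> ! i]) / Q zs \<tau>)"
  let ?c = "\<lambda>\<tau> s. Q (zs @ [y]) (\<tau> @ [s]) / Q zs \<tau>"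
  have gen: "a - p * c = (q - p) * c + (a - q * c)" for a p q c :: real
    by (simp add: algebra_simps)
  have "dep V w zs (ys @ [y]) = (\<Sum>\<tau>\<in>vecs (length zs). \<Sum>\<eta>\<in>vecs (length ys). \<Sum>s\<in>UNIV.
     \<bar>Q (zs @ ys @ [y]) (\<tau> @ \<eta> @ [s]) - ?P \<tau> \<eta> * ?c \<tau> s\<bar>)"
  proof -
    have "dep V w zs (ys @ [y]) = (\<Sum>\<tau>\<in>vecs (length zs). \<Sum>\<eta>\<in>vecs (length ys). \<Sum>s\<in>UNIV.
      \<bar>Q (zs @ ys @ [y]) (\<tau> @ \<eta> @ [s]) - Q zs \<tau> * (\<Prod>i<Suc (length ys).
         Q (zs @ [(ys @ [y]) ! i]) (\<tau> @ [(\<eta> @ [s]) ! i]) / Q zs \<tau>)\<bar>)"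
      unfolding dep_def by (simp only: length_append_singleton sum_vecs_Suc append_assoc)
    also have "\<dots> = (\<Sum>\<tau>\<in>vecs (length zs). \<Sum>\<eta>\<in>vecs (length ys). \<Sum>s\<in>UNIV.
      \<bar>Q (zs @ ys @ [y]) (\<tau> @ \<eta> @ [s]) - ?P \<tau> \<eta> * ?c \<tau> s\<bar>)"
    proof (intro sum.cong refl arg_cong[where f = abs] arg_cong2[where f = "(-)"])
      fix \<tau> \<eta> :: "'o list" and s
      assume "\<eta> \<in> vecs (length ys)"
      then have "length \<eta> = length ys" by (simp add: vecs_def)
      then show "Q zs \<tau> * (\<Prod>i<Suc (length ys). Q (zs @ [(ys @ [y]) ! i]) (\<tau> @ [(\<eta> @ [s]) ! i]) / Q zs \<tau>) =
        ?P \<tau> \<eta> * ?c \<tau> s"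
        by (simp only: prod.lessThan_Suc mult.assoc) (simp add: nth_append)
    qed
    finally show ?thesis .
  qed
  also have "\<dots> \<le> (\<Sum>\<tau>\<in>vecs (length zs). \<Sum>\<eta>\<in>vecs (length ys). \<Sum>s\<in>UNIV.
       \<bar>Q (zs @ ys) (\<tau> @ \<eta>) - ?P \<tau> \<eta>\<bar> * ?c \<tau> s +
       \<bar>Q (zs @ ys @ [y]) (\<tau> @ \<eta> @ [s]) - Q (zs @ ys) (\<tau> @ \<eta>) * ?c \<tau> s\<bar>)"
  proof (intro sum_mono)
    fix \<tau> \<eta> :: "'o list" and s :: 'o
    have c: "0 \<le> ?c \<tau> s" by (intro divide_nonneg_nonneg law_nonneg)
    have eq: "Q (zs @ ys @ [y]) (\<tau> @ \<eta> @ [s]) - ?P \<tau> \<eta> * ?c \<tau> s =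
      (Q (zs @ ys) (\<tau> @ \<eta>) - ?P \<tau> \<eta>) * ?c \<tau> s + (Q (zs @ ys @ [y]) (\<tau> @ \<eta> @ [s]) - Q (zs @ ys) (\<tau> @ \<eta>) * ?c \<tau> s)"
      by (rule gen)
    show "\<bar>Q (zs @ ys @ [y]) (\<tau> @ \<eta> @ [s]) - ?P \<tau> \<eta> * ?c \<tau> s\<bar> \<le>
       \<bar>Q (zs @ ys) (\<tau> @ \<eta>) - ?P \<tau> \<eta>\<bar> * ?c \<tau> s +
       \<bar>Q (zs @ ys @ [y]) (\<tau> @ \<eta> @ [s]) - Q (zs @ ys) (\<tau> @ \<eta>) * ?c \<tau> s\<bar>"
      by (simp only: eq) (rule order_trans[OF abs_triangle_ineq], simp only: abs_mult abs_of_nonneg[OF c] order_refl)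
  qed
  also have "\<dots> = (\<Sum>\<tau>\<in>vecs (length zs). \<Sum>\<eta>\<in>vecs (length ys). \<bar>Q (zs @ ys) (\<tau> @ \<eta>) - ?P \<tau> \<eta>\<bar> * (\<Sum>s\<in>UNIV. ?c \<tau> s)) +
    (\<Sum>\<tau>\<in>vecs (length zs). \<Sum>\<eta>\<in>vecs (length ys). \<Sum>s\<in>UNIV. \<bar>Q (zs @ ys @ [y]) (\<tau> @ \<eta> @ [s]) - Q (zs @ ys) (\<tau> @ \<eta>) * ?c \<tau> s\<bar>)"
    by (simp add: sum.distrib sum_distrib_left)
  also have "(\<Sum>\<tau>\<in>vecs (length zs). \<Sum>\<eta>\<in>vecs (length ys). \<bar>Q (zs @ ys) (\<tau> @ \<eta>) - ?P \<tau> \<eta>\<bar> * (\<Sum>s\<in>UNIV. ?c \<tau> s))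
      \<le> dep V w zs ys"
    unfolding dep_def
  proof (intro sum_mono mult_left_le)
    fix \<tau> :: "'o list" assume "\<tau> \<in> vecs (length zs)"
    then have "(\<Sum>s\<in>UNIV. ?c \<tau> s) = Q zs \<tau> / Q zs \<tau>"
      by (simp add: sum_divide_distrib[symmetric] law_last vecs_def)
    \<comment> \<open>The sum is 1, or 0 if the pinned value is impossible.\<close>
    then show "(\<Sum>s\<in>UNIV. ?c \<tau> s) \<le> 1" by simp
  qed simp
  finally show ?thesis by simp
qed

text \<open>The vertices of \<open>ys\<close> are added one by one. When the i-th is added, the
  earlier ones act as additional pins, and the cost is measured by how much they raise its
  energy.\<close>

lemma dep_le_energy:
  assumes "0 < \<kappa>"
  shows "dep V w zs ys \<le> (\<Sum>i<length ys. real CARD('o) * \<kappa> +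
           (energy V w (zs @ take i ys) (ys ! i) - energy V w zs (ys ! i)) / \<kappa>)"
proof (induction ys rule: rev_induct)
  case Nil
  show ?case using law_nonneg by (simp add: dep_def vecs_def)
next
  case (snoc y ys)
  have "(\<Sum>i<length (ys @ [y]). real CARD('o) * \<kappa> +
      (energy V w (zs @ take i (ys @ [y])) ((ys @ [y]) ! i) - energy V w zs ((ys @ [y]) ! i)) / \<kappa>) =
    (\<Sum>i<length ys. real CARD('o) * \<kappa> + (energy V w (zs @ take i ys) (ys ! i) - energy V w zs (ys ! i)) / \<kappa>) +
     (real CARD('o) * \<kappa> + (energy V w (zs @ ys) y - energy V w zs y) / \<kappa>)"
    by (simp add: nth_append)
  then show ?case using dep_snoc[of zs ys y] dep_step[OF assms, of zs ys y] snoc by linarith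
qed

end

subsection \<open>Exchangeability\<close>

definition con_wt :: "nat list \<times> ('o list \<Rightarrow> real) \<Rightarrow> (nat \<Rightarrow> 'o) \<Rightarrow> real" where
  "con_wt c \<sigma> = snd c (map \<sigma> (fst c))"

definition list_wt :: "(nat list \<times> ('o list \<Rightarrow> real)) list \<Rightarrow> (nat \<Rightarrow> 'o) \<Rightarrow> real" where
  "list_wt cs \<sigma> = prod_list (map (\<lambda>c. con_wt c \<sigma>) cs)"

definition rel :: "(nat \<Rightarrow> nat) \<Rightarrow> nat list \<times> ('o list \<Rightarrow> real) \<Rightarrow> nat list \<times> ('o list \<Rightarrow> real)" where
  "rel \<pi> c = (map \<pi> (fst c), snd c)"

definition avoid :: "nat set \<Rightarrow> nat list \<times> ('o list \<Rightarrow> real) \<Rightarrow> bool" where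
  "avoid U c \<longleftrightarrow> set (fst c) \<inter> U = {}"

lemma list_wt_rel: "list_wt (map (rel \<pi>) cs) \<sigma> = list_wt cs (\<sigma> \<circ> \<pi>)"
  by (simp add: list_wt_def con_wt_def rel_def comp_def)

lemma configs_permutes:
  assumes "\<pi> permutes V"
  shows "bij_betw (\<lambda>\<sigma>. \<sigma> \<circ> \<pi>) (configs V) (configs V :: (nat \<Rightarrow> 'o) set)"
proof (rule bij_betwI[where g = "\<lambda>\<sigma>. \<sigma> \<circ> inv \<pi>"])
  have *: "\<sigma> \<circ> \<rho> \<in> configs V" if "\<rho> permutes V" "\<sigma> \<in> configs V" for \<rho> and \<sigma> :: "nat \<Rightarrow> 'o"
    using that permutes_in_image[OF that(1)] by (auto simp: configs_def PiE_def extensional_def)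
  show "(\<lambda>\<sigma>. \<sigma> \<circ> \<pi>) \<in> configs V \<rightarrow> (configs V :: (nat \<Rightarrow> 'o) set)"
    "(\<lambda>\<sigma>. \<sigma> \<circ> inv \<pi>) \<in> configs V \<rightarrow> (configs V :: (nat \<Rightarrow> 'o) set)"
    using *[OF assms] *[OF permutes_inv[OF assms]] by auto
qed (use permutes_inv_o[OF assms] in \<open>auto simp: o_assoc[symmetric]\<close>)

text \<open>Composition with \<pi> permutes the configurations; moving constraints and observed
  vertices along with it is a change of variables in both sums.\<close>

lemma law_rel:
  assumes "\<pi> permutes V"
  shows "law V (list_wt (map (rel \<pi>) cs)) (map \<pi> zs) \<tau> = law V (list_wt cs) zs \<tau>"
  using sum.reindex_bij_betw[OF configs_permutes[OF assms], of "\<lambda>\<sigma>. if map \<sigma> zs = \<tau> then list_wt cs \<sigma> else 0"]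
    sum.reindex_bij_betw[OF configs_permutes[OF assms], of "list_wt cs"]
  by (simp add: law_def list_wt_rel cong: if_cong)

lemma energy_rel:
  assumes "\<pi> permutes V"
  shows "energy V (list_wt (map (rel \<pi>) cs)) (map \<pi> zs) (\<pi> y) = energy V (list_wt cs) zs y"
  using law_rel[OF assms, of cs "zs @ [y]"] law_rel[OF assms, of cs zs]
  by (simp add: energy_def)

lemma iid_list_map: "map_pmf (map f) (iid_list m p) = iid_list m (map_pmf f p)"
proof (induction m)
  case (Suc m)
  then show ?case
    by (simp add: map_bind_pmf bind_map_pmf map_pmf_comp flip: Suc)
qed simp

definition tuples :: "nat \<Rightarrow> nat \<Rightarrow> nat list set" where
  "tuples k n = {xs. length xs = k \<and> set xs \<subseteq> {..<n}}"

lemma finite_tuples [simp]: "finite (tuples k n)"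
  using finite_lists_length_eq[of "{..<n}" k] by (simp add: tuples_def conj_commute)

lemma card_tuples: "card (tuples k n) = n ^ k"
  using card_lists_length_eq[of "{..<n}" k] by (simp add: tuples_def conj_commute)

lemma tuples_nonempty: "0 < n \<Longrightarrow> tuples k n \<noteq> {}"
  using card_tuples[of k n] by force

lemma rand_con_alt: "rand_con k P n = pair_pmf (pmf_of_set (tuples k n)) P"
  by (simp add: rand_con_def tuples_def)

lemma set_rand_con: "0 < n \<Longrightarrow> set_pmf (rand_con k P n) = tuples k n \<times> set_pmf P"
  by (simp add: rand_con_alt tuples_nonempty)

lemma rand_con_rel:
  fixes P :: "('o list \<Rightarrow> real) pmf"
  assumes "0 < n" and \<pi>: "\<pi> permutes {..<n}"
  shows "map_pmf (rel \<pi>) (rand_con k P n) = rand_con k P n"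
proof -
  have "bij_betw (map \<pi>) (tuples k n) (tuples k n)"
  proof (rule bij_betwI[where g = "map (inv \<pi>)"])
    show "map \<pi> \<in> tuples k n \<rightarrow> tuples k n" "map (inv \<pi>) \<in> tuples k n \<rightarrow> tuples k n"
      using permutes_in_image[OF \<pi>] permutes_in_image[OF permutes_inv[OF \<pi>]]
      by (auto simp: tuples_def subset_eq)
  qed (use permutes_inverses[OF \<pi>] in \<open>auto simp: comp_def\<close>)
  then have "map_pmf (map \<pi>) (pmf_of_set (tuples k n)) = pmf_of_set (tuples k n)"
    using tuples_nonempty[OF assms(1)] by (intro map_pmf_of_set_bij_betw) auto
  moreover have "(rel \<pi> :: _ \<Rightarrow> _ \<times> ('o list \<Rightarrow> real)) = apfst (map \<pi>)"
    by (auto simp: rel_def fun_eq_iff)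
  ultimately show ?thesis by (simp add: rand_con_alt pair_map_pmf1[symmetric])
qed

lemma finite_set_rand_con:
  assumes "0 < n" "finite (set_pmf P)"
  shows "finite (set_pmf (rand_con k P n))"
  using assms by (simp add: set_rand_con)

lemma iid_mean_rel:
  assumes "0 < n" and "\<pi> permutes {..<n}" and "finite (set_pmf P)"
  shows "iid_mean (rand_con k P n) m (\<lambda>gs. f (map (rel \<pi>) gs)) = iid_mean (rand_con k P n) m f"
proof -
  note fin = finite_set_rand_con[OF assms(1,3), of k]
  have "measure_pmf.expectation (iid_list m (rand_con k P n)) (\<lambda>gs. f (map (rel \<pi>) gs)) =
        measure_pmf.expectation (map_pmf (map (rel \<pi>)) (iid_list m (rand_con k P n))) f"
    by simp
  then show ?thesis
    by (simp add: iid_list_map rand_con_rel assms expectation_iid_list[OF fin])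
qed

text \<open>A normal form for all mean energies that occur: by exchangeability the last
  \<open>l\<close> vertices stand for a cavity, the first \<open>j\<close> for the pinned vertices
  and vertex \<open>j\<close> for the observed one. Avoiding the cavity is kept as an indicator and
  not conditioned on.\<close>

definition pin_mean :: "nat \<Rightarrow> ('o::finite list \<Rightarrow> real) pmf \<Rightarrow> nat \<Rightarrow> nat \<Rightarrow> nat \<Rightarrow> nat \<Rightarrow> real" where
  "pin_mean k P n m l j = iid_mean (rand_con k P n) m (\<lambda>gs.
     of_bool (\<forall>c\<in>set gs. avoid {n - l..<n} c) * energy {..<n} (list_wt gs) [0..<j] j)"

lemma exchange:
  fixes P :: "('o::finite list \<Rightarrow> real) pmf"
  assumes fin: "finite (set_pmf P)" and U: "U \<subseteq> {..<n}" "card U = l"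
    and d: "distinct (zs @ [y])" "set (zs @ [y]) \<subseteq> {..<n} - U"
  shows "iid_mean (rand_con k P n) m (\<lambda>gs.
     of_bool (\<forall>c\<in>set gs. avoid U c) * energy {..<n} (list_wt gs) zs y) = pin_mean k P n m l (length zs)"
proof -
  have finU: "finite U" using U finite_subset by blast
  define R where "R = sorted_list_of_set ({..<n} - U - set (zs @ [y]))"
  \<comment> \<open>\<open>L\<close> lists all vertices, with \<open>zs\<close> in front, then
    \<open>y\<close>, and \<open>U\<close> at the end; the relabelling sends each vertex to its
    position in \<open>L\<close>.\<close>
  define L where "L = zs @ y # R @ sorted_list_of_set U"
  have setL: "set L = {..<n}" using U d finU by (auto simp: L_def R_def)
  have dL: "distinct L" using U d finU by (auto simp: L_def R_def)
  have lenL: "length L = n" using distinct_card[OF dL] setL by simp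
  have n: "0 < n" using d by auto
  define \<rho> where "\<rho> i = (if i < n then L ! i else i)" for i
  have perm: "\<rho> permutes {..<n}"
  proof (rule bij_imp_permutes)
    have "bij_betw ((!) L) {..<n} {..<n}"
      using bij_betw_nth[OF dL] lenL setL by auto
    then show "bij_betw \<rho> {..<n} {..<n}"
      by (rule bij_betw_cong[THEN iffD2, rotated]) (simp add: \<rho>_def)
  qed (auto simp: \<rho>_def)
  define \<pi> where "\<pi> = inv \<rho>"
  have perm': "\<pi> permutes {..<n}" unfolding \<pi>_def by (rule permutes_inv[OF perm])
  have \<pi>L: "\<pi> (L ! i) = i" if "i < n" for i
    using permutes_inverses(2)[OF perm, of i] that by (simp add: \<pi>_def \<rho>_def)
  have "map \<pi> L = [0..<n]" using \<pi>L lenL by (intro nth_equalityI) auto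
  then have split: "map \<pi> zs @ \<pi> y # map \<pi> R @ map \<pi> (sorted_list_of_set U) = [0..<n]"
    by (simp add: L_def)
  have lz: "length zs < n" using lenL by (simp add: L_def)
  have zs: "map \<pi> zs = [0..<length zs]"
    using arg_cong[OF split, of "take (length zs)"] lz by (simp add: take_upt)
  have y: "\<pi> y = length zs"
    using \<pi>L[OF lz] by (simp add: L_def)
  have lU: "length (sorted_list_of_set U) = l" using U by simp
  have lenR: "length zs + Suc (length R) = n - l" "l \<le> n"
    using lenL lU by (auto simp: L_def)
  have "map \<pi> (sorted_list_of_set U) = [n - l..<n]"
    using arg_cong[OF split, of "drop (n - l)"] lenR(1)[symmetric] lenR(2) by (simp add: drop_upt)
  then have "\<pi> ` U = {n - l..<n}"
    using finU by (metis image_set set_sorted_list_of_set set_upt)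
  moreover have "avoid (\<pi> ` U) (rel \<pi> c) = avoid U c" for c :: "nat list \<times> ('o list \<Rightarrow> real)"
    using permutes_inj[OF perm'] by (simp add: avoid_def rel_def image_Int[symmetric])
  ultimately have av: "avoid {n - l..<n} (rel \<pi> c) = avoid U c" for c :: "nat list \<times> ('o list \<Rightarrow> real)"
    by simp
  have er: "energy {..<n} (list_wt (map (rel \<pi>) gs)) [0..<length zs] (length zs) =
      energy {..<n} (list_wt gs) zs y" for gs :: "(nat list \<times> ('o list \<Rightarrow> real)) list"
    using energy_rel[OF perm', of gs zs y] by (simp add: zs y)
  have "pin_mean k P n m l (length zs) = iid_mean (rand_con k P n) m (\<lambda>gs.
     of_bool (\<forall>c\<in>set (map (rel \<pi>) gs). avoid {n - l..<n} c) *
       energy {..<n} (list_wt (map (rel \<pi>) gs)) [0..<length zs] (length zs))"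
    unfolding pin_mean_def by (subst iid_mean_rel[OF n perm' fin, symmetric]) simp
  also have "\<dots> = iid_mean (rand_con k P n) m (\<lambda>gs.
     of_bool (\<forall>c\<in>set gs. avoid U c) * energy {..<n} (list_wt gs) zs y)"
    by (simp add: av er)
  finally show ?thesis by simp
qed

section \<open>Constraints with weights bounded above and away from zero\<close>

definition valid_con :: "nat \<Rightarrow> nat \<Rightarrow> real \<Rightarrow> nat list \<times> ('o list \<Rightarrow> real) \<Rightarrow> bool" where
  "valid_con k n c a \<longleftrightarrow> fst a \<in> tuples k n \<and> (\<forall>xs. length xs = k \<longrightarrow> 1 / c \<le> snd a xs \<and> snd a xs \<le> c)"

lemma con_wt_bounds:
  assumes "valid_con k n c a"
  shows "1 / c \<le> con_wt a \<sigma>" "con_wt a \<sigma> \<le> c"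
  using assms by (auto simp: valid_con_def con_wt_def tuples_def)

lemma con_wt_pos: "valid_con k n c a \<Longrightarrow> 0 < c \<Longrightarrow> 0 < con_wt a \<sigma>"
  using con_wt_bounds(1)[of k n c a \<sigma>] by (meson less_le_trans zero_less_divide_1_iff)

lemma list_wt_pos:
  assumes "\<And>a. a \<in> set cs \<Longrightarrow> valid_con k n c a" "0 < c"
  shows "0 < list_wt cs \<sigma>"
proof -
  have "\<forall>a\<in>set cs. 0 < con_wt a \<sigma>" using assms con_wt_pos by blast
  then show ?thesis unfolding list_wt_def by (induction cs) auto
qed

lemma rand_con_valid:
  assumes "0 < n" "\<forall>\<psi>\<in>set_pmf P. \<forall>xs. length xs = k \<longrightarrow> 1 / c \<le> \<psi> xs \<and> \<psi> xs \<le> c"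
    and "a \<in> set_pmf (rand_con k P n)"
  shows "valid_con k n c a"
  using assms by (auto simp: set_rand_con valid_con_def)

section \<open>Mean energies and the choice of the number of pins\<close>

context
  fixes k n :: nat and P :: "('o::finite list \<Rightarrow> real) pmf" and c :: real
  assumes n: "0 < n" and finP: "finite (set_pmf P)" and c: "0 < c"
    and bounds: "\<forall>\<psi>\<in>set_pmf P. \<forall>xs. length xs = k \<longrightarrow> 1 / c \<le> \<psi> xs \<and> \<psi> xs \<le> c"
begin

lemma pos_weight_rand:
  assumes "set gs \<subseteq> set_pmf (rand_con k P n)"
  shows "pos_weight {..<n} (list_wt gs)"
proof
  show "0 < list_wt gs \<sigma>" for \<sigma>
    using assms rand_con_valid[OF n bounds] by (intro list_wt_pos[of gs k n c] c) auto
qed simp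

text \<open>The mean energies for different \<open>j\<close> observe different vertices.
  Exchangeability moves the observed vertex from \<open>j\<close> to \<open>j'\<close>; after that,
  pinning the vertices in between raises the energy sample by sample.\<close>

lemma pin_mean_mono:
  assumes "j \<le> j'" "j' + l < n"
  shows "pin_mean k P n m l j \<le> pin_mean k P n m l j'"
proof -
  let ?U = "{n - l..<n}"
  have "pin_mean k P n m l j = iid_mean (rand_con k P n) m (\<lambda>gs.
     of_bool (\<forall>c\<in>set gs. avoid ?U c) * energy {..<n} (list_wt gs) [0..<j] j')"
  proof -
    have "?U \<subseteq> {..<n}" "{0..<j} \<subseteq> {..<n} - ?U" using assms by auto
    then show ?thesis
      using exchange[of P ?U n l "[0..<j]" j' k m] finP assms by auto
  qed
  also have "\<dots> \<le> pin_mean k P n m l j'"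
    unfolding pin_mean_def
  proof (rule iid_mean_mono)
    fix gs :: "(nat list \<times> ('o list \<Rightarrow> real)) list" assume "set gs \<subseteq> set_pmf (rand_con k P n)"
    then interpret pos_weight "{..<n}" "list_wt gs" by (rule pos_weight_rand)
    have "[0..<j] @ [j..<j'] = [0..<j']" using upt_add_eq_append[of 0 j "j' - j"] assms by simp
    then have "energy {..<n} (list_wt gs) [0..<j] j' \<le> energy {..<n} (list_wt gs) [0..<j'] j'"
      using energy_mono[of "[0..<j]" j' "[j..<j']"] by simp
    then show "of_bool (\<forall>c\<in>set gs. avoid ?U c) * energy {..<n} (list_wt gs) [0..<j] j' \<le>
      of_bool (\<forall>c\<in>set gs. avoid ?U c) * energy {..<n} (list_wt gs) [0..<j'] j'"
      by (simp add: mult_left_mono)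
  qed
  finally show ?thesis .
qed

lemma pin_mean_bounds: "0 \<le> pin_mean k P n m l j" "pin_mean k P n m l j \<le> 1"
proof -
  note pw = pos_weight.energy_nonneg[OF pos_weight_rand] pos_weight.energy_le_1[OF pos_weight_rand]
  show "0 \<le> pin_mean k P n m l j" unfolding pin_mean_def
    by (intro iid_mean_nonneg mult_nonneg_nonneg) (auto intro: pw)
  have "pin_mean k P n m l j \<le> iid_mean (rand_con k P n) m (\<lambda>_. 1)"
    unfolding pin_mean_def
    by (intro iid_mean_mono mult_le_one) (auto intro: pw)
  then show "pin_mean k P n m l j \<le> 1"
    using iid_mean_const[OF finite_set_rand_con[OF n finP]] by simp
qed

text \<open>For a fixed list \<open>ys\<close>, each step has at most \<open>N\<close> pins beyond
  \<open>zs\<close>, so by monotonicity its mean energy increment is at most that of the whole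
  stretch, which is at most \<kappa>^2. Divided by \<kappa> it has the same order as the other
  term.\<close>

lemma dep_mean:
  assumes U: "U \<subseteq> {..<n}" "card U = l" and d: "distinct (zs @ ys)" "set (zs @ ys) \<subseteq> {..<n} - U"
    and N: "length ys \<le> N" "length zs + N + l < n" and \<kappa>: "0 < \<kappa>"
    and inc: "pin_mean k P n m l (length zs + N) - pin_mean k P n m l (length zs) \<le> \<kappa>\<^sup>2"
  shows "iid_mean (rand_con k P n) m (\<lambda>gs. of_bool (\<forall>c\<in>set gs. avoid U c) *
      dep {..<n} (list_wt gs) zs ys) \<le> real N * (real CARD('o) + 1) * \<kappa>"
proof -
  let ?av = "\<lambda>gs. of_bool (\<forall>c\<in>set gs. avoid U c) :: real"
  let ?E = "iid_mean (rand_con k P n) m"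
  let ?en = "\<lambda>zs y gs. energy {..<n} (list_wt gs) zs y"
  have "?E (\<lambda>gs. ?av gs * dep {..<n} (list_wt gs) zs ys) \<le> ?E (\<lambda>gs. \<Sum>i<length ys.
     real CARD('o) * \<kappa> + (1 / \<kappa>) * (?av gs * ?en (zs @ take i ys) (ys ! i) gs - ?av gs * ?en zs (ys ! i) gs))"
  proof (rule iid_mean_mono)
    fix gs :: "(nat list \<times> ('o list \<Rightarrow> real)) list" assume "set gs \<subseteq> set_pmf (rand_con k P n)"
    then interpret pos_weight "{..<n}" "list_wt gs" by (rule pos_weight_rand)
    show "?av gs * dep {..<n} (list_wt gs) zs ys \<le> (\<Sum>i<length ys.
     real CARD('o) * \<kappa> + (1 / \<kappa>) * (?av gs * ?en (zs @ take i ys) (ys ! i) gs - ?av gs * ?en zs (ys ! i) gs))"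
      using dep_le_energy[OF \<kappa>, of zs ys] \<kappa>
      by (auto simp: of_bool_def intro!: sum_nonneg)
  qed
  also have "\<dots> = (\<Sum>i<length ys. real CARD('o) * \<kappa> + (1 / \<kappa>) *
      (pin_mean k P n m l (length zs + i) - pin_mean k P n m l (length zs)))"
    unfolding iid_mean_sum iid_mean_add iid_mean_cmult iid_mean_diff
      iid_mean_const[OF finite_set_rand_con[OF n finP]]
  proof (intro sum.cong refl arg_cong2[where f = "(+)"] arg_cong2[where f = "(*)"] arg_cong2[where f = "(-)"])
    fix i assume i: "i \<in> {..<length ys}"
    have mem: "ys ! i \<in> set ys" using i by simp
    have "take i ys @ [ys ! i] = take (Suc i) ys" using i by (simp add: take_Suc_conv_app_nth)
    then have "distinct (take i ys @ [ys ! i])" "set (take i ys @ [ys ! i]) \<subseteq> set ys"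
      using d(1) set_take_subset[of "Suc i" ys] by (auto simp del: set_append)
    then have "distinct ((zs @ take i ys) @ [ys ! i])" "set ((zs @ take i ys) @ [ys ! i]) \<subseteq> {..<n} - U"
      using d by auto
    from exchange[OF finP U this, of k m]
    show "?E (\<lambda>gs. ?av gs * ?en (zs @ take i ys) (ys ! i) gs) = pin_mean k P n m l (length zs + i)"
      using i by simp
    show "?E (\<lambda>gs. ?av gs * ?en zs (ys ! i) gs) = pin_mean k P n m l (length zs)"
      using d mem by (intro exchange finP U) auto
  qed
  also have "\<dots> \<le> (\<Sum>i<length ys. real CARD('o) * \<kappa> + (1 / \<kappa>) * \<kappa>\<^sup>2)"
  proof (intro sum_mono add_left_mono mult_left_mono)
    fix i assume "i \<in> {..<length ys}"
    then have "pin_mean k P n m l (length zs + i) \<le> pin_mean k P n m l (length zs + N)"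
      using N by (intro pin_mean_mono) auto
    then show "pin_mean k P n m l (length zs + i) - pin_mean k P n m l (length zs) \<le> \<kappa>\<^sup>2"
      using inc by linarith
  qed (use \<kappa> in simp)
  also have "\<dots> = real (length ys) * (real CARD('o) + 1) * \<kappa>"
    using \<kappa> by (simp add: power2_eq_square algebra_simps)
  also have "\<dots> \<le> real N * (real CARD('o) + 1) * \<kappa>"
    using N \<kappa> by (intro mult_right_mono) auto
  finally show ?thesis .
qed

text \<open>Pigeonhole for the sum of all the mean energies: it is nondecreasing and at most
  \<open>(l\<^sub>0 + 1) * (M + 1)\<close>, so one of \<open>J\<close> consecutive stretches of
  length \<open>N\<close> raises it by at most a \<open>J\<close>-th part. Each single increment is
  nonnegative and hence below the total, so one \<theta> serves all cavity sizes and all numbers of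
  removed constraints.\<close>

lemma exists_pinning:
  assumes J: "0 < J" and large: "J * N + l\<^sub>0 < n"
  shows "\<exists>\<theta>\<le>(J - 1) * N. \<forall>l\<le>l\<^sub>0. \<forall>t\<le>M.
     pin_mean k P n (m - t) l (\<theta> + N) - pin_mean k P n (m - t) l \<theta> \<le> real ((l\<^sub>0 + 1) * (M + 1)) / real J"
proof -
  define G where "G j = (\<Sum>(l, t)\<in>{..l\<^sub>0} \<times> {..M}. pin_mean k P n (m - t) l j)" for j
  define R where "R = real ((l\<^sub>0 + 1) * (M + 1))"
  have G0: "0 \<le> G j" for j unfolding G_def by (intro sum_nonneg) (auto intro: pin_mean_bounds)
  have GR: "G j \<le> R" for j
    using sum_bounded_above[of "{..l\<^sub>0} \<times> {..M}" "\<lambda>(l, t). pin_mean k P n (m - t) l j" 1]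
    by (auto simp: G_def R_def intro: pin_mean_bounds)
  have "(\<Sum>i<J. G (Suc i * N) - G (i * N)) = G (J * N) - G 0"
    using sum_lessThan_telescope[of "\<lambda>i. G (i * N)" J] by simp
  then have le: "(\<Sum>i<J. G (Suc i * N) - G (i * N)) \<le> R" using GR[of "J * N"] G0[of 0] by linarith
  have "\<exists>i<J. G (Suc i * N) - G (i * N) \<le> R / real J"
  proof (rule ccontr)
    assume "\<not> ?thesis"
    then have "(\<Sum>i<J. R / real J) < (\<Sum>i<J. G (Suc i * N) - G (i * N))"
      using J by (intro sum_strict_mono) (auto simp: not_le)
    then show False using le J by simp
  qed
  then obtain i where i: "i < J" "G (Suc i * N) - G (i * N) \<le> R / real J" by blast
  have "pin_mean k P n (m - t) l (i * N + N) - pin_mean k P n (m - t) l (i * N) \<le> R / real J"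
    if "l \<le> l\<^sub>0" "t \<le> M" for l t
  proof -
    have "pin_mean k P n (m - t) l (i * N) \<le> pin_mean k P n (m - t) l (i * N + N)"
      if "l \<le> l\<^sub>0" "t \<le> M" for l t
    proof (rule pin_mean_mono)
      have "Suc i * N \<le> J * N" using i(1) by (intro mult_right_mono) auto
      then show "i * N + N + l < n" using large that by simp
    qed simp
    then have "pin_mean k P n (m - t) l (i * N + N) - pin_mean k P n (m - t) l (i * N) \<le>
      (\<Sum>(l, t)\<in>{..l\<^sub>0} \<times> {..M}. pin_mean k P n (m - t) l (i * N + N) - pin_mean k P n (m - t) l (i * N))"
      using that member_le_sum[of "(l, t)" "{..l\<^sub>0} \<times> {..M}"
        "\<lambda>(l, t). pin_mean k P n (m - t) l (i * N + N) - pin_mean k P n (m - t) l (i * N)"] by auto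
    also have "\<dots> = G (Suc i * N) - G (i * N)"
      by (simp add: G_def sum_subtractf case_prod_beta add.commute)
    finally show ?thesis using i(2) by linarith
  qed
  moreover have "i * N \<le> (J - 1) * N" using i(1) by (intro mult_right_mono) auto
  ultimately show ?thesis unfolding R_def by blast
qed

end

section \<open>Cavities and product measures\<close>

definition merge_on :: "nat set \<Rightarrow> (nat \<Rightarrow> 'o) \<Rightarrow> (nat \<Rightarrow> 'o) \<Rightarrow> nat \<Rightarrow> 'o" where
  "merge_on A \<alpha> \<beta> = (\<lambda>x. if x \<in> A then \<alpha> x else \<beta> x)"

lemma sum_configs_Un:
  assumes "A \<inter> B = {}"
  shows "(\<Sum>\<sigma>\<in>configs (A \<union> B). f \<sigma>) = (\<Sum>\<alpha>\<in>configs A. \<Sum>\<beta>\<in>configs B. f (merge_on A \<alpha> \<beta>))"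
proof -
  have "(\<Sum>\<sigma>\<in>configs (A \<union> B). f \<sigma>) = (\<Sum>(\<alpha>, \<beta>)\<in>configs A \<times> configs B. f (merge_on A \<alpha> \<beta>))"
    by (rule sum.reindex_bij_witness[of _ "\<lambda>(\<alpha>, \<beta>). merge_on A \<alpha> \<beta>" "\<lambda>\<sigma>. (restrict \<sigma> A, restrict \<sigma> B)"])
       (use assms in \<open>auto simp: configs_def PiE_def extensional_def merge_on_def restrict_def fun_eq_iff
          split: if_splits intro!: arg_cong[where f = f]\<close>)
  then show ?thesis by (simp add: sum.cartesian_product)
qed

lemma sum_configs_prod:
  assumes "finite Y"
  shows "(\<Sum>\<eta>\<in>configs Y. \<Prod>y\<in>Y. q y (\<eta> y)) = (\<Prod>y\<in>Y. \<Sum>s\<in>(UNIV :: 'o::finite set). q y s :: real)"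
  unfolding configs_def by (rule prod_sum_PiE[symmetric]) (use assms in auto)

section \<open>Means under product measures\<close>

definition pmean :: "nat set \<Rightarrow> (nat \<Rightarrow> 'o \<Rightarrow> real) \<Rightarrow> ((nat \<Rightarrow> 'o) \<Rightarrow> real) \<Rightarrow> real" where
  "pmean Y q F = (\<Sum>\<eta>\<in>configs Y. (\<Prod>y\<in>Y. q y (\<eta> y)) * F \<eta>)"

definition determined :: "nat set \<Rightarrow> ((nat \<Rightarrow> 'o) \<Rightarrow> 'a) \<Rightarrow> bool" where
  "determined C F \<longleftrightarrow> (\<forall>\<sigma> \<sigma>'. (\<forall>x\<in>C. \<sigma> x = \<sigma>' x) \<longrightarrow> F \<sigma> = F \<sigma>')"

lemma determinedD: "determined C F \<Longrightarrow> (\<And>x. x \<in> C \<Longrightarrow> \<sigma> x = \<sigma>' x) \<Longrightarrow> F \<sigma> = F \<sigma>'"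
  by (auto simp: determined_def)

lemma determined_prod:
  assumes "\<And>a. a \<in> B \<Longrightarrow> determined C (F a)"
  shows "determined C (\<lambda>\<sigma>. \<Prod>a\<in>B. F a \<sigma>)"
  using assms by (auto simp: determined_def intro!: prod.cong)

lemma determined_mono: "determined C F \<Longrightarrow> C \<subseteq> D \<Longrightarrow> determined D F"
  by (auto simp: determined_def)

context
  fixes Y :: "nat set" and q :: "nat \<Rightarrow> 'o::finite \<Rightarrow> real"
  assumes finY: "finite Y" and q1: "\<And>y. y \<in> Y \<Longrightarrow> (\<Sum>s\<in>UNIV. q y s) = 1"
begin

lemma pmean_1: "pmean Y q (\<lambda>_. 1) = 1"
  using sum_configs_prod[OF finY, of q] by (simp add: pmean_def q1)

lemma pmean_mult:
  assumes A: "A \<subseteq> Y" and F: "determined A F" and H: "determined (Y - A) H"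
  shows "pmean Y q (\<lambda>\<eta>. F \<eta> * H \<eta>) = pmean Y q F * pmean Y q H"
proof -
  let ?\<pi> = "\<lambda>A \<eta>. \<Prod>y\<in>A. q y (\<eta> y)"
  define B where "B = Y - A"
  have Y: "Y = A \<union> B" "A \<inter> B = {}" using A by (auto simp: B_def)
  have fin: "finite A" "finite B" using finY A finite_subset by (auto simp: B_def)
  \<comment> \<open>\<open>u\<close> fills the coordinates that the function in question does not
    read.\<close>
  define u :: "nat \<Rightarrow> 'o" where "u = (\<lambda>_. undefined)"
  have prod: "?\<pi> Y (merge_on A \<alpha> \<beta>) = ?\<pi> A \<alpha> * ?\<pi> B \<beta>" for \<alpha> \<beta>
    unfolding Y(1) using Y(2) by (subst prod.union_disjoint[OF fin])
      (auto intro!: arg_cong2[where f = "(*)"] prod.cong simp: merge_on_def)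
  have Fm: "F (merge_on A \<alpha> \<beta>) = F (merge_on A \<alpha> u)" for \<alpha> \<beta>
    by (rule determinedD[OF F]) (simp add: merge_on_def)
  have Hm: "H (merge_on A \<alpha> \<beta>) = H (merge_on A u \<beta>)" for \<alpha> \<beta>
    by (rule determinedD[OF H]) (simp add: merge_on_def)
  have one: "(\<Sum>\<alpha>\<in>configs A. ?\<pi> A \<alpha>) = 1" "(\<Sum>\<beta>\<in>configs B. ?\<pi> B \<beta>) = 1"
    using q1 Y(1) by (simp_all add: sum_configs_prod fin)
  have expand: "pmean Y q f = (\<Sum>\<alpha>\<in>configs A. \<Sum>\<beta>\<in>configs B. ?\<pi> A \<alpha> * ?\<pi> B \<beta> * f (merge_on A \<alpha> \<beta>))" for f
    unfolding pmean_def by (subst (1) Y(1), subst sum_configs_Un[OF Y(2)]) (simp add: prod)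
  have "pmean Y q F = (\<Sum>\<alpha>\<in>configs A. ?\<pi> A \<alpha> * F (merge_on A \<alpha> u)) * (\<Sum>\<beta>\<in>configs B. ?\<pi> B \<beta>)"
    unfolding expand sum_product by (intro sum.cong refl) (use Fm in \<open>simp add: mult_ac\<close>)
  moreover have "pmean Y q H = (\<Sum>\<alpha>\<in>configs A. ?\<pi> A \<alpha>) * (\<Sum>\<beta>\<in>configs B. ?\<pi> B \<beta> * H (merge_on A u \<beta>))"
    unfolding expand sum_product by (intro sum.cong refl) (use Hm in \<open>simp add: mult_ac\<close>)
  moreover have "pmean Y q (\<lambda>\<eta>. F \<eta> * H \<eta>) =
     (\<Sum>\<alpha>\<in>configs A. ?\<pi> A \<alpha> * F (merge_on A \<alpha> u)) * (\<Sum>\<beta>\<in>configs B. ?\<pi> B \<beta> * H (merge_on A u \<beta>))"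
    unfolding expand sum_product
  proof (intro sum.cong refl)
    fix \<alpha> \<beta>
    show "?\<pi> A \<alpha> * ?\<pi> B \<beta> * (F (merge_on A \<alpha> \<beta>) * H (merge_on A \<alpha> \<beta>)) =
      ?\<pi> A \<alpha> * F (merge_on A \<alpha> u) * (?\<pi> B \<beta> * H (merge_on A u \<beta>))"
      using Fm[of \<alpha> \<beta>] Hm[of \<alpha> \<beta>] by simp
  qed
  ultimately show ?thesis by (simp add: one)
qed

lemma pmean_prod:
  assumes "finite B" and "\<And>a. a \<in> B \<Longrightarrow> A a \<subseteq> Y" and "\<And>a. a \<in> B \<Longrightarrow> determined (A a) (F a)"
    and "\<And>a b. a \<in> B \<Longrightarrow> b \<in> B \<Longrightarrow> a \<noteq> b \<Longrightarrow> A a \<inter> A b = {}"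
  shows "pmean Y q (\<lambda>\<eta>. \<Prod>a\<in>B. F a \<eta>) = (\<Prod>a\<in>B. pmean Y q (F a))"
  using assms
proof (induction B rule: finite_induct)
  case empty
  then show ?case by (simp add: pmean_1)
next
  case (insert a B)
  have "determined (Y - A a) (\<lambda>\<eta>. \<Prod>b\<in>B. F b \<eta>)"
  proof (intro determined_prod)
    fix b assume b: "b \<in> B"
    then have "A a \<inter> A b = {}" "A b \<subseteq> Y" using insert.prems(1,3)[of b] insert.prems(3)[of a b] insert.hyps by auto
    then show "determined (Y - A a) (F b)"
      using insert.prems(2)[of b] b by (auto intro: determined_mono)
  qed
  then show ?case using insert by (simp add: pmean_mult[of "A a"])
qed

text \<open>An absolute error in total variation becomes a relative one, since the mean of
  \<open>F\<close> is at least \<alpha>. Relative errors are what survives multiplication over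
  constraints and normalisation.\<close>

lemma pmean_approx:
  assumes "\<And>\<eta>. \<eta> \<in> configs Y \<Longrightarrow> \<alpha> \<le> F \<eta> \<and> F \<eta> \<le> \<beta>" and "0 < \<alpha>" and q0: "\<And>y s. 0 \<le> q y s"
    and tv: "(\<Sum>\<eta>\<in>configs Y. \<bar>\<nu> \<eta> - (\<Prod>y\<in>Y. q y (\<eta> y))\<bar>) = tv"
  shows "\<bar>(\<Sum>\<eta>\<in>configs Y. \<nu> \<eta> * F \<eta>) - pmean Y q F\<bar> \<le> \<beta> / \<alpha> * tv * pmean Y q F" "\<alpha> \<le> pmean Y q F"
proof -
  have ab: "\<alpha> \<le> \<beta>" using assms(1) configs_nonempty[of Y] by (meson all_not_in_conv order_trans)
  have "\<alpha> * pmean Y q (\<lambda>_. 1) \<le> pmean Y q F"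
    unfolding pmean_def sum_distrib_left using assms(1) q0
    by (intro sum_mono) (auto simp: mult.commute[of \<alpha>] intro!: mult_left_mono prod_nonneg)
  then show le: "\<alpha> \<le> pmean Y q F" by (simp add: pmean_1)
  have "(\<Sum>\<eta>\<in>configs Y. \<nu> \<eta> * F \<eta>) - pmean Y q F = (\<Sum>\<eta>\<in>configs Y. (\<nu> \<eta> - (\<Prod>y\<in>Y. q y (\<eta> y))) * F \<eta>)"
    by (simp add: pmean_def sum_subtractf left_diff_distrib)
  also have "\<bar>\<dots>\<bar> \<le> (\<Sum>\<eta>\<in>configs Y. \<bar>\<nu> \<eta> - (\<Prod>y\<in>Y. q y (\<eta> y))\<bar> * \<beta>)"
  proof (intro order_trans[OF sum_abs] sum_mono)
    fix \<eta> :: "nat \<Rightarrow> 'o" assume "\<eta> \<in> configs Y"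
    then have "\<bar>F \<eta>\<bar> \<le> \<beta>" using assms(1)[of \<eta>] assms(2) by auto
    then show "\<bar>(\<nu> \<eta> - (\<Prod>y\<in>Y. q y (\<eta> y))) * F \<eta>\<bar> \<le> \<bar>\<nu> \<eta> - (\<Prod>y\<in>Y. q y (\<eta> y))\<bar> * \<beta>"
      by (simp add: abs_mult mult_left_mono)
  qed
  also have "\<dots> = \<beta> * tv" by (simp add: tv[symmetric] sum_distrib_left mult.commute)
  also have "\<dots> = \<beta> / \<alpha> * tv * \<alpha>" using assms(2) by simp
  also have "\<dots> \<le> \<beta> / \<alpha> * tv * pmean Y q F"
  proof (rule mult_left_mono[OF le])
    have "0 \<le> tv" unfolding tv[symmetric] by (intro sum_nonneg) auto
    then show "0 \<le> \<beta> / \<alpha> * tv" using ab assms(2) by simp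
  qed
  finally show "\<bar>(\<Sum>\<eta>\<in>configs Y. \<nu> \<eta> * F \<eta>) - pmean Y q F\<bar> \<le> \<beta> / \<alpha> * tv * pmean Y q F" .
qed

end

text \<open>The unknown factor \<open>K\<close> cancels on normalising, and a relative error
  \<delta> counts once in the numerator and once in the total.\<close>

lemma normalised_diff:
  fixes f g :: "'a \<Rightarrow> real"
  assumes X: "finite X" "X \<noteq> {}" and g: "\<And>x. x \<in> X \<Longrightarrow> 0 < g x" and f: "\<And>x. x \<in> X \<Longrightarrow> 0 < f x"
    and "0 < K" and d: "\<And>x. x \<in> X \<Longrightarrow> \<bar>f x - K * g x\<bar> \<le> \<delta> * (K * g x)"
  shows "(\<Sum>x\<in>X. \<bar>f x / sum f X - g x / sum g X\<bar>) \<le> 2 * \<delta>"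
proof -
  define h where "h x = K * g x" for x
  have h: "0 < h x" if "x \<in> X" for x using g that assms(5) by (simp add: h_def)
  have F: "0 < sum f X" and H: "0 < sum h X" using X f h by (auto intro: sum_pos)
  have gh: "g x / sum g X = h x / sum h X" for x
    using assms(5) by (simp add: h_def sum_distrib_left[symmetric])
  have abs1: "(\<Sum>x\<in>X. \<bar>f x - h x\<bar>) \<le> \<delta> * sum h X"
    unfolding sum_distrib_left using d by (intro sum_mono) (simp add: h_def)
  have abs2: "\<bar>sum h X - sum f X\<bar> \<le> (\<Sum>x\<in>X. \<bar>f x - h x\<bar>)"
    using sum_abs[of "\<lambda>x. f x - h x" X] by (simp add: sum_subtractf abs_minus_commute)
  have "(\<Sum>x\<in>X. \<bar>f x / sum f X - h x / sum h X\<bar>) \<le>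
    (\<Sum>x\<in>X. f x * (\<bar>sum h X - sum f X\<bar> / (sum f X * sum h X)) + \<bar>f x - h x\<bar> / sum h X)"
  proof (rule sum_mono)
    fix x assume x: "x \<in> X"
    have "f x / sum f X - h x / sum h X = f x * ((sum h X - sum f X) / (sum f X * sum h X)) + (f x - h x) / sum h X"
      using F H by (simp add: field_simps)
    also have "\<bar>\<dots>\<bar> \<le> f x * (\<bar>sum h X - sum f X\<bar> / (sum f X * sum h X)) + \<bar>f x - h x\<bar> / sum h X"
      using F H f[OF x] by (intro order_trans[OF abs_triangle_ineq]) (simp add: abs_mult)
    finally show "\<bar>f x / sum f X - h x / sum h X\<bar> \<le> f x * (\<bar>sum h X - sum f X\<bar> / (sum f X * sum h X)) + \<bar>f x - h x\<bar> / sum h X" .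
  qed
  also have "\<dots> = sum f X * (\<bar>sum h X - sum f X\<bar> / (sum f X * sum h X)) + (\<Sum>x\<in>X. \<bar>f x - h x\<bar>) / sum h X"
    by (simp add: sum.distrib sum_distrib_right[symmetric] sum_divide_distrib[symmetric])
  also have "\<dots> = \<bar>sum h X - sum f X\<bar> / sum h X + (\<Sum>x\<in>X. \<bar>f x - h x\<bar>) / sum h X"
    using F by simp
  also have "\<dots> \<le> \<delta> + \<delta>"
    using abs1 abs2 H by (intro add_mono) (simp_all add: pos_divide_le_eq)
  finally show ?thesis by (simp add: gh)
qed

text \<open>A normalised nonnegative vector has total 1, or 0 if its total vanishes; the second case
  covers empty states.\<close>

lemma normalised_diff_le_2:
  fixes f g :: "'a \<Rightarrow> real"
  assumes "\<And>x. x \<in> X \<Longrightarrow> 0 \<le> g x" "\<And>x. x \<in> X \<Longrightarrow> 0 \<le> f x"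
  shows "(\<Sum>x\<in>X. \<bar>f x / sum f X - g x / sum g X\<bar>) \<le> 2"
proof -
  have "(\<Sum>x\<in>X. \<bar>f x / sum f X - g x / sum g X\<bar>) \<le> (\<Sum>x\<in>X. f x / sum f X + g x / sum g X)"
  proof (rule sum_mono)
    fix x assume "x \<in> X"
    then have "0 \<le> f x / sum f X" "0 \<le> g x / sum g X" using assms by (auto intro!: divide_nonneg_nonneg sum_nonneg)
    then show "\<bar>f x / sum f X - g x / sum g X\<bar> \<le> f x / sum f X + g x / sum g X" by linarith
  qed
  also have "\<dots> = sum f X / sum f X + sum g X / sum g X"
    by (simp add: sum.distrib sum_divide_distrib[symmetric])
  also have "\<dots> \<le> 2" by simp
  finally show ?thesis .
qed

text \<open>Every factor is at most 2 in absolute value, so an error e of the product becomes at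
  most 2 e + \<delta> with one more factor.\<close>

lemma prod_near_1:
  fixes p :: "'a \<Rightarrow> real"
  assumes "finite B" "\<And>a. a \<in> B \<Longrightarrow> \<bar>p a - 1\<bar> \<le> \<delta>" "\<delta> \<le> 1" "0 \<le> \<delta>"
  shows "\<bar>(\<Prod>a\<in>B. p a) - 1\<bar> \<le> (2 ^ card B - 1) * \<delta>"
  using assms(1,2)
proof (induction B rule: finite_induct)
  case (insert a B)
  let ?P = "\<Prod>a\<in>B. p a"
  have IH: "\<bar>?P - 1\<bar> \<le> (2 ^ card B - 1) * \<delta>" using insert by auto
  have pa: "\<bar>p a - 1\<bar> \<le> \<delta>" using insert by auto
  then have pa2: "\<bar>p a\<bar> \<le> 2" using assms(3) by auto
  have "\<bar>p a * ?P - 1\<bar> = \<bar>p a * (?P - 1) + (p a - 1)\<bar>" by (simp add: right_diff_distrib)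
  also have "\<dots> \<le> \<bar>p a\<bar> * \<bar>?P - 1\<bar> + \<bar>p a - 1\<bar>"
    by (rule order_trans[OF abs_triangle_ineq]) (simp add: abs_mult)
  also have "\<dots> \<le> 2 * ((2 ^ card B - 1) * \<delta>) + \<delta>"
    using IH pa pa2 by (intro add_mono mult_mono) auto
  also have "\<dots> = (2 ^ card (insert a B) - 1) * \<delta>" using insert by (simp add: algebra_simps)
  finally show ?case using insert by simp
qed simp

section \<open>The factor graph without the constraints at a cavity\<close>

definition fibre :: "nat \<Rightarrow> nat list \<Rightarrow> 'o list \<Rightarrow> (nat \<Rightarrow> 'o) set" where
  "fibre n zs \<tau> = {\<sigma>\<in>configs {..<n}. map \<sigma> zs = \<tau>}"

definition bethe_err :: "'o fg \<Rightarrow> nat set \<Rightarrow> (nat \<Rightarrow> 'o::finite) set \<Rightarrow> real" where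
  "bethe_err G U S = (\<Sum>\<sigma>\<in>configs U. \<bar>marg_cond G U S \<sigma> - bar_mu G U S \<sigma>\<bar>)"

definition touching :: "'o fg \<Rightarrow> nat set \<Rightarrow> nat set" where
  "touching G U = {a\<in>facs G. nbset G a \<inter> U \<noteq> {}}"

text \<open>The reduced weight: it does not read the spins on \<open>U\<close>, and in a random
  graph it involves only constraints that are independent of the deleted ones.\<close>

definition rest_wt :: "'o fg \<Rightarrow> nat set \<Rightarrow> (nat \<Rightarrow> 'o) \<Rightarrow> real" where
  "rest_wt G U \<sigma> = (\<Prod>a\<in>facs G - touching G U. psi_fac G a \<sigma>)"

definition valid_fg :: "nat \<Rightarrow> nat \<Rightarrow> real \<Rightarrow> 'o fg \<Rightarrow> bool" where
  "valid_fg k n c G \<longleftrightarrow> fst G = n \<and> (\<forall>a\<in>set (snd G). valid_con k n c a)"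

lemma finite_facs [simp]: "finite (facs G)"
  by (simp add: facs_def)

lemma psi_fac_cong: "(\<And>x. x \<in> nbset G a \<Longrightarrow> \<sigma> x = \<sigma>' x) \<Longrightarrow> psi_fac G a \<sigma> = psi_fac G a \<sigma>'"
  unfolding psi_fac_def nbset_def by (simp cong: map_cong)

lemma psi_fac_con_wt: "psi_fac G a = con_wt (snd G ! a)"
  by (simp add: psi_fac_def con_wt_def nb_def wt_def fun_eq_iff)

lemma prod_bounds:
  fixes f :: "'a \<Rightarrow> real"
  assumes "finite B" "1 \<le> c" "\<And>a. a \<in> B \<Longrightarrow> 1 / c \<le> f a \<and> f a \<le> c" "card B \<le> t"
  shows "1 / c ^ t \<le> (\<Prod>a\<in>B. f a)" "(\<Prod>a\<in>B. f a) \<le> c ^ t"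
proof -
  have "0 < 1 / c" using assms(2) by simp
  then have nn: "0 \<le> f a" if "a \<in> B" for a using assms(3)[OF that] by linarith
  have "(\<Prod>a\<in>B. f a) \<le> (\<Prod>a\<in>B. c)" using assms(3) nn by (intro prod_mono) auto
  also have "\<dots> \<le> c ^ t" using assms by (simp add: power_increasing)
  finally show "(\<Prod>a\<in>B. f a) \<le> c ^ t" .
  have "1 / c ^ t \<le> (1 / c) ^ card B"
    using assms by (simp add: power_one_over frac_le power_increasing)
  also have "\<dots> = (\<Prod>a\<in>B. 1 / c)" by simp
  also have "\<dots> \<le> (\<Prod>a\<in>B. f a)" using assms by (intro prod_mono) auto
  finally show "1 / c ^ t \<le> (\<Prod>a\<in>B. f a)" .
qed

locale valid_graph =
  fixes k n :: nat and c :: real and G :: "'o::finite fg"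
  assumes valid: "valid_fg k n c G" and c1: "1 \<le> c" and n0: "0 < n" and k0: "0 < k"
begin

lemma vars_G: "vars G = {..<n}"
  using valid by (simp add: valid_fg_def vars_def)

lemma con_valid: "a \<in> facs G \<Longrightarrow> valid_con k n c (snd G ! a)"
  using valid by (auto simp: valid_fg_def facs_def)

lemma psi_fac_bounds:
  assumes "a \<in> facs G"
  shows "1 / c \<le> psi_fac G a \<sigma> \<and> psi_fac G a \<sigma> \<le> c"
  using con_wt_bounds[OF con_valid[OF assms]] by (simp add: psi_fac_con_wt)

lemma psi_fac_pos: "a \<in> facs G \<Longrightarrow> 0 < psi_fac G a \<sigma>"
  using con_wt_pos[OF con_valid] c1 by (simp add: psi_fac_con_wt)

lemma nbset_vars: "a \<in> facs G \<Longrightarrow> nbset G a \<subseteq> {..<n}"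
  using con_valid[of a] by (auto simp: valid_con_def tuples_def nbset_def nb_def)

lemma card_nbset: "a \<in> facs G \<Longrightarrow> card (nbset G a) \<le> k"
  using con_valid[of a] card_length[of "nb G a"] by (auto simp: valid_con_def tuples_def nbset_def nb_def)

lemma nbset_nonempty: "a \<in> facs G \<Longrightarrow> nbset G a \<noteq> {}"
  using con_valid[of a] k0 by (auto simp: valid_con_def tuples_def nbset_def nb_def)

lemma rest_wt_pos: "0 < rest_wt G U \<sigma>"
  unfolding rest_wt_def by (intro prod_pos) (auto intro: psi_fac_pos)

lemma psi_G_pos: "0 < psi_G G \<sigma>"
  unfolding psi_G_def by (intro prod_pos) (auto intro: psi_fac_pos)

lemma psi_G_split: "psi_G G \<sigma> = rest_wt G U \<sigma> * (\<Prod>a\<in>touching G U. psi_fac G a \<sigma>)"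
  unfolding psi_G_def rest_wt_def
  by (subst prod.subset_diff[of "touching G U"]) (auto simp: touching_def)

lemma psi_G_bounds:
  "psi_G G \<sigma> \<le> c ^ card (touching G U) * rest_wt G U \<sigma>"
  "rest_wt G U \<sigma> / c ^ card (touching G U) \<le> psi_G G \<sigma>"
proof -
  have "finite (touching G U)" by (simp add: touching_def)
  then have "1 / c ^ card (touching G U) \<le> (\<Prod>a\<in>touching G U. psi_fac G a \<sigma>)"
    "(\<Prod>a\<in>touching G U. psi_fac G a \<sigma>) \<le> c ^ card (touching G U)"
    using c1 psi_fac_bounds by (auto intro!: prod_bounds simp: touching_def)
  from mult_left_mono[OF this(1), of "rest_wt G U \<sigma>"] mult_left_mono[OF this(2), of "rest_wt G U \<sigma>"]
  show "psi_G G \<sigma> \<le> c ^ card (touching G U) * rest_wt G U \<sigma>"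
    "rest_wt G U \<sigma> / c ^ card (touching G U) \<le> psi_G G \<sigma>"
    using rest_wt_pos[of U \<sigma>] by (simp_all add: psi_G_split[of _ U] mult.commute)
qed

lemma rest_wt_cong: "(\<And>x. x \<notin> U \<Longrightarrow> \<sigma> x = \<sigma>' x) \<Longrightarrow> rest_wt G U \<sigma> = rest_wt G U \<sigma>'"
  unfolding rest_wt_def by (intro prod.cong refl psi_fac_cong) (auto simp: touching_def)

sublocale rest: pos_weight "{..<n}" "rest_wt G U" for U
  by unfold_locales (auto intro: rest_wt_pos)

text \<open>Deleting the touching constraints changes every weight by a factor between c^-t and c^t,
  t being their number; numerator and partition function each cost one such factor.\<close>

lemma gibbs_fibre_le:
  "gibbs_set G (fibre n zs \<tau>) \<le> c ^ (2 * card (touching G U)) * law {..<n} (rest_wt G U) zs \<tau>"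
proof -
  let ?t = "card (touching G U)"
  let ?Z = "\<Sum>\<sigma>\<in>configs {..<n}. rest_wt G U \<sigma>"
  have ct: "0 < c ^ ?t" using c1 by simp
  have "?Z / c ^ ?t \<le> Zfn G"
    unfolding Zfn_def vars_G sum_divide_distrib by (intro sum_mono psi_G_bounds)
  moreover have "0 < ?Z / c ^ ?t" using rest.total_pos[of U] ct by simp
  moreover have "(\<Sum>\<sigma>\<in>fibre n zs \<tau>. psi_G G \<sigma>) \<le> c ^ ?t * (\<Sum>\<sigma>\<in>fibre n zs \<tau>. rest_wt G U \<sigma>)"
    unfolding sum_distrib_left by (intro sum_mono psi_G_bounds)
  moreover have "0 \<le> (\<Sum>\<sigma>\<in>fibre n zs \<tau>. rest_wt G U \<sigma>)"
    by (intro sum_nonneg less_imp_le rest_wt_pos)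
  ultimately have "(\<Sum>\<sigma>\<in>fibre n zs \<tau>. psi_G G \<sigma>) / Zfn G \<le>
      c ^ ?t * (\<Sum>\<sigma>\<in>fibre n zs \<tau>. rest_wt G U \<sigma>) / (?Z / c ^ ?t)"
    using ct by (intro frac_le) auto
  also have "\<dots> = c ^ (2 * ?t) * ((\<Sum>\<sigma>\<in>fibre n zs \<tau>. rest_wt G U \<sigma>) / ?Z)"
    by (simp add: mult_2 power_add)
  also have "(\<Sum>\<sigma>\<in>fibre n zs \<tau>. rest_wt G U \<sigma>) = (\<Sum>\<sigma>\<in>configs {..<n}. if map \<sigma> zs = \<tau> then rest_wt G U \<sigma> else 0)"
    unfolding fibre_def by (rule sum.inter_filter) simp
  finally show ?thesis by (simp add: gibbs_set_def law_def sum_divide_distrib)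
qed

text \<open>Brings the conditional marginal into the form weight over total weight on
  \<open>configs U\<close>, which is also the form of \<open>bar_mu\<close>.\<close>

lemma marg_alt:
  assumes "finite U" "finite S"
  shows "marg_cond G U S u = (\<Sum>\<sigma>\<in>S. if restrict \<sigma> U = u then psi_G G \<sigma> else 0) /
   (\<Sum>u\<in>configs U. \<Sum>\<sigma>\<in>S. if restrict \<sigma> U = u then psi_G G \<sigma> else 0)"
proof -
  have "(\<Sum>u\<in>configs U. \<Sum>\<sigma>\<in>S. if restrict \<sigma> U = u then psi_G G \<sigma> else 0) = (\<Sum>\<sigma>\<in>S. psi_G G \<sigma>)"
  proof (subst sum.swap, intro sum.cong refl)
    fix \<sigma> :: "nat \<Rightarrow> 'o"
    have "restrict \<sigma> U \<in> configs U" by (simp add: configs_def)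
    then show "(\<Sum>u\<in>configs U. if restrict \<sigma> U = u then psi_G G \<sigma> else 0) = psi_G G \<sigma>" using assms by simp
  qed
  then show ?thesis by (simp add: marg_cond_def)
qed

lemma bar_w_nonneg: "0 \<le> bar_w G U S u"
proof -
  have "0 \<le> msg_w G S a x s" if "a \<in> bdry G U" for a x s
    unfolding msg_w_def by (intro sum_nonneg) (auto intro!: prod_nonneg intro: less_imp_le[OF psi_fac_pos])
  then have "0 \<le> msg G S a x s" if "a \<in> bdry G U" for a x s
    unfolding msg_def using that by (auto intro!: divide_nonneg_nonneg sum_nonneg)
  then show ?thesis unfolding bar_w_def
    by (intro mult_nonneg_nonneg prod_nonneg) (auto intro: less_imp_le[OF psi_fac_pos] simp: inner_def)
qed

lemma bethe_err_le_2:
  assumes "finite U" "finite S"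
  shows "bethe_err G U S \<le> 2"
  unfolding bethe_err_def marg_alt[OF assms] bar_mu_def
  by (rule normalised_diff_le_2) (auto intro!: sum_nonneg less_imp_le[OF psi_G_pos] bar_w_nonneg)

end

section \<open>The Bethe approximation at one cavity within one subcube\<close>

locale cavity_fibre = valid_graph k n c G for k n c and G :: "'o::finite fg" +
  fixes U :: "nat set" and zs :: "nat list" and \<tau> :: "'o list"
  assumes cav: "cavity G U" and zsd: "distinct zs" and zsV: "set zs \<subseteq> {..<n} - U" and len: "length \<tau> = length zs"
begin

abbreviation "S \<equiv> fibre n zs \<tau>"
abbreviation "W \<equiv> set zs"
abbreviation "T \<equiv> touching G U"
abbreviation "t \<equiv> card (touching G U)"
abbreviation "I \<equiv> inner G U"
abbreviation "B \<equiv> bdry G U"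
abbreviation "Q \<equiv> law {..<n} (rest_wt G U)"

definition "Y = (\<Union>a\<in>bdry G U. nbset G a) - U - set zs"
definition "ys = sorted_list_of_set Y"
text \<open>Conditional marginals, and below the joint law \<open>\<nu>\<close>, of the outer
  neighbours given the pinned value, in the graph without the constraints touching
  \<open>U\<close>.\<close>

definition "q y s = Q (zs @ [y]) (\<tau> @ [s]) / Q zs \<tau>"
definition "\<nu> \<eta> = Q (zs @ ys) (\<tau> @ map \<eta> ys) / Q zs \<tau>"
definition "tv = (\<Sum>\<eta>\<in>configs Y. \<bar>\<nu> \<eta> - (\<Prod>y\<in>Y. q y (\<eta> y))\<bar>)"
definition "tval x = the (map_of (zip zs \<tau>) x)"
text \<open>Assembles a configuration from cavity spins, outer spins and pinned values. Outside
  \<open>U\<close>, \<open>Y\<close> and \<open>zs\<close> it takes a dummy value, which no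
  constraint touching \<open>U\<close> reads.\<close>

definition "cfg \<eta> u = (\<lambda>x. if x \<in> U then u x else if x \<in> Y then \<eta> x else tval x)"

lemma U_sub: "U \<subseteq> {..<n}" "U \<noteq> {}" using cav by (auto simp: cavity_def vars_G)
lemma finU [simp]: "finite U" using U_sub finite_subset by blast
lemma finY [simp]: "finite Y"
  unfolding Y_def by (rule finite_subset[of _ "{..<n}"]) (use nbset_vars in \<open>auto simp: bdry_def\<close>)
lemma set_ys [simp]: "set ys = Y" "distinct ys" by (auto simp: ys_def)
lemma Y_sub: "Y \<subseteq> {..<n} - U - W" using nbset_vars by (auto simp: Y_def bdry_def)

lemma T_split: "T = I \<union> B" "I \<inter> B = {}" "finite I" "finite B" "finite T"
  using nbset_nonempty by (auto simp: touching_def inner_def bdry_def)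

lemma xto_inter:
  assumes "a \<in> B"
  shows "nbset G a \<inter> U = {xto G a U}"
proof -
  have a: "a \<in> facs G" "\<not> nbset G a \<subseteq> U" "nbset G a \<inter> U \<noteq> {}" using assms by (auto simp: bdry_def)
  then have "card (nbset G a \<inter> U) \<le> 1" using cav by (auto simp: cavity_def)
  moreover have "0 < card (nbset G a \<inter> U)" using a by (simp add: card_gt_0_iff)
  ultimately have "card (nbset G a \<inter> U) = 1" by simp
  then obtain x where "nbset G a \<inter> U = {x}" by (rule card_1_singletonE)
  then show ?thesis by (simp add: xto_def)
qed

text \<open>Condition CAV3: boundary constraints read disjoint blocks of \<open>Y\<close>, so their
  factors are independent under a product measure on \<open>Y\<close>.\<close>

lemma bdry_disjoint:
  assumes "a \<in> B" "b \<in> B" "a \<noteq> b"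
  shows "nbset G a \<inter> nbset G b - U = {}"
  using cav assms unfolding cavity_def bdry_def by blast

lemma tval: "\<sigma> \<in> S \<Longrightarrow> x \<in> W \<Longrightarrow> \<sigma> x = tval x"
proof -
  assume "\<sigma> \<in> S" "x \<in> W"
  then have "map_of (zip zs (map \<sigma> zs)) x = Some (\<sigma> x)" "\<tau> = map \<sigma> zs"
    by (auto simp: fibre_def map_of_zip_map)
  then show ?thesis unfolding tval_def by simp
qed

lemma S_nonempty: "S \<noteq> {}"
proof -
  define \<sigma> where "\<sigma> = restrict tval {..<n}"
  have "map \<sigma> zs = \<tau>"
  proof (rule nth_equalityI)
    fix i assume i: "i < length (map \<sigma> zs)"
    have "zs ! i < n" using zsV i nth_mem[of i zs] by (auto simp del: nth_mem)
    moreover have "map_of (zip zs \<tau>) (zs ! i) = Some (\<tau> ! i)"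
      using i len zsd by (simp add: map_of_zip_nth)
    ultimately show "map \<sigma> zs ! i = \<tau> ! i" using i by (simp add: \<sigma>_def tval_def)
  qed (simp add: len)
  then have "\<sigma> \<in> S" by (simp add: fibre_def \<sigma>_def configs_def)
  then show ?thesis by blast
qed

lemma finS [simp]: "finite S" by (simp add: fibre_def)

lemma Q_zs: "Q zs \<tau> = (\<Sum>\<sigma>\<in>S. rest_wt G U \<sigma>) / (\<Sum>\<sigma>\<in>configs {..<n}. rest_wt G U \<sigma>)"
  unfolding law_def fibre_def by (subst sum.inter_filter) auto

lemma Q_pos: "0 < Q zs \<tau>"
  unfolding Q_zs using S_nonempty rest_wt_pos rest.total_pos by (intro divide_pos_pos sum_pos) auto

lemma q_nonneg: "0 \<le> q y s"
  unfolding q_def using Q_pos by (intro divide_nonneg_pos rest.law_nonneg)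

lemma q_sum: "(\<Sum>s\<in>UNIV. q y s) = 1"
  unfolding q_def sum_divide_distrib[symmetric] using rest.law_last[OF len, of U y] Q_pos by simp

lemma bij_ys: "bij_betw (\<lambda>\<eta>. map \<eta> ys) (configs Y) (vecs (length ys) :: 'o list set)"
proof (rule bij_betwI[where g = "\<lambda>xs. restrict (\<lambda>y. the (map_of (zip ys xs) y)) Y"])
  show "(\<lambda>xs. restrict (\<lambda>y. the (map_of (zip ys xs) y)) Y) \<in> vecs (length ys) \<rightarrow> (configs Y :: (nat \<Rightarrow> 'o) set)"
    by (auto simp: configs_def)
  show "restrict (\<lambda>y. the (map_of (zip ys (map \<eta> ys)) y)) Y = \<eta>" if "\<eta> \<in> configs Y" for \<eta> :: "nat \<Rightarrow> 'o"
    using that by (intro ext) (auto simp: configs_def PiE_def extensional_def map_of_zip_map)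
  show "map (restrict (\<lambda>y. the (map_of (zip ys xs) y)) Y) ys = xs" if "xs \<in> vecs (length ys)" for xs :: "'o list"
  proof (rule nth_equalityI)
    fix i assume "i < length (map (restrict (\<lambda>y. the (map_of (zip ys xs) y)) Y) ys)"
    then have i: "i < length ys" by simp
    moreover have "ys ! i \<in> Y" using nth_mem[OF i] by simp
    moreover have "map_of (zip ys xs) (ys ! i) = Some (xs ! i)"
      using that i by (simp add: map_of_zip_nth vecs_def)
    ultimately show "map (restrict (\<lambda>y. the (map_of (zip ys xs) y)) Y) ys ! i = xs ! i" by simp
  qed (use that in \<open>simp add: vecs_def\<close>)
qed simp

text \<open>The right-hand side is the summand of \<open>dep\<close> at \<tau>, so that summing over
  all pinned values gives \<open>dep\<close> itself.\<close>

lemma tv_dep: "Q zs \<tau> * tv = (\<Sum>\<eta>\<in>vecs (length ys).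
     \<bar>Q (zs @ ys) (\<tau> @ \<eta>) - Q zs \<tau> * (\<Prod>i<length ys. Q (zs @ [ys ! i]) (\<tau> @ [\<eta> ! i]) / Q zs \<tau>)\<bar>)"
proof -
  have "Q zs \<tau> * \<bar>\<nu> \<eta> - (\<Prod>y\<in>Y. q y (\<eta> y))\<bar> =
     \<bar>Q (zs @ ys) (\<tau> @ map \<eta> ys) - Q zs \<tau> * (\<Prod>i<length ys. Q (zs @ [ys ! i]) (\<tau> @ [map \<eta> ys ! i]) / Q zs \<tau>)\<bar>" for \<eta>
  proof -
    have "(\<Prod>y\<in>Y. q y (\<eta> y)) = (\<Prod>i<length ys. q (ys ! i) (\<eta> (ys ! i)))"
      using prod.reindex_bij_betw[OF bij_betw_nth[of ys "{..<length ys}" Y], of "\<lambda>y. q y (\<eta> y)"] by simp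
    also have "\<dots> = (\<Prod>i<length ys. Q (zs @ [ys ! i]) (\<tau> @ [map \<eta> ys ! i]) / Q zs \<tau>)"
      by (intro prod.cong) (auto simp: q_def)
    finally have e: "(\<Prod>y\<in>Y. q y (\<eta> y)) = (\<Prod>i<length ys. Q (zs @ [ys ! i]) (\<tau> @ [map \<eta> ys ! i]) / Q zs \<tau>)" .
    have "Q zs \<tau> * \<bar>\<nu> \<eta> - (\<Prod>y\<in>Y. q y (\<eta> y))\<bar> = \<bar>Q zs \<tau> * (\<nu> \<eta> - (\<Prod>y\<in>Y. q y (\<eta> y)))\<bar>"
      using Q_pos by (simp add: abs_mult)
    then show ?thesis using Q_pos unfolding e by (simp add: \<nu>_def right_diff_distrib)
  qed
  then show ?thesis
    unfolding tv_def sum_distrib_left by (simp add: sum.reindex_bij_betw[OF bij_ys, symmetric])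
qed

text \<open>The slice of the subcube that shows \<open>u\<close> on the cavity, with
  \<open>f\<close> summed against the reduced weight. That weight reads only \<open>\<beta>\<close>,
  so \<open>u\<close> enters through \<open>f\<close> alone.\<close>

definition "ck u f = (\<Sum>\<beta>\<in>configs ({..<n} - U). if map \<beta> zs = \<tau> then rest_wt G U \<beta> * f (merge_on U u \<beta>) else 0)"

lemma merge_zs: "map (merge_on U u \<beta>) zs = map \<beta> zs"
  using zsV by (auto simp: merge_on_def)

lemma merge_rest: "rest_wt G U (merge_on U u \<beta>) = rest_wt G U \<beta>"
  by (rule rest_wt_cong) (simp add: merge_on_def)

lemma sum_S:
  "(\<Sum>\<sigma>\<in>S. rest_wt G U \<sigma> * f \<sigma>) = (\<Sum>u\<in>configs U. ck u f)"
proof -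
  have V: "{..<n} = U \<union> ({..<n} - U)" using U_sub by auto
  have "(\<Sum>\<sigma>\<in>S. rest_wt G U \<sigma> * f \<sigma>) =
    (\<Sum>\<sigma>\<in>configs (U \<union> ({..<n} - U)). if map \<sigma> zs = \<tau> then rest_wt G U \<sigma> * f \<sigma> else 0)"
    unfolding fibre_def V[symmetric] by (subst sum.inter_filter) auto
  then show ?thesis
    by (subst (asm) sum_configs_Un) (auto simp: ck_def merge_zs merge_rest cong: if_cong)
qed

lemma ck_restrict:
  assumes u: "u \<in> configs U"
  shows "(\<Sum>\<sigma>\<in>S. if restrict \<sigma> U = u then rest_wt G U \<sigma> * f \<sigma> else 0) = ck u f"
proof -
  have r: "restrict (merge_on U u' \<beta>) U = u'" if "u' \<in> configs U" for u' \<beta>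
    using that by (auto simp: configs_def PiE_def extensional_def merge_on_def fun_eq_iff)
  have "(\<Sum>\<sigma>\<in>S. if restrict \<sigma> U = u then rest_wt G U \<sigma> * f \<sigma> else 0) =
    (\<Sum>\<sigma>\<in>S. rest_wt G U \<sigma> * (if restrict \<sigma> U = u then f \<sigma> else 0))"
    by (intro sum.cong) auto
  also have "\<dots> = (\<Sum>u'\<in>configs U. if u' = u then ck u f else 0)"
    unfolding sum_S by (intro sum.cong refl) (auto simp: ck_def r cong: if_cong)
  finally show ?thesis using u by simp
qed

text \<open>The reduced mass of one slice. It is the same for every \<open>u\<close>, so an
  arbitrary argument is inserted.\<close>

definition "\<kappa> = ck undefined (\<lambda>_. 1)"

lemma ck_const: "ck u (\<lambda>_. 1) = \<kappa>" by (simp add: ck_def \<kappa>_def)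

lemma cfg_merge:
  assumes "map \<beta> zs = \<tau>" "x \<in> U \<union> Y \<union> W"
  shows "merge_on U u \<beta> x = cfg (restrict \<beta> Y) u x"
proof -
  have "\<beta> x = tval x" if "x \<in> W"
  proof -
    have "map_of (zip zs (map \<beta> zs)) x = Some (\<beta> x)" using that by (simp add: map_of_zip_map)
    then show ?thesis using assms by (simp add: tval_def)
  qed
  then show ?thesis using assms by (auto simp: merge_on_def cfg_def)
qed

lemma \<kappa>_pos: "0 < \<kappa>"
proof -
  have "0 < (\<Sum>\<sigma>\<in>S. rest_wt G U \<sigma> * 1)" using S_nonempty by (intro sum_pos) (auto intro: rest_wt_pos)
  also have "\<dots> = real (card (configs U :: (nat \<Rightarrow> 'o) set)) * \<kappa>" unfolding sum_S by (simp add: ck_const)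
  finally show ?thesis by (simp add: zero_less_mult_iff)
qed

text \<open>Cavity spins are free under the reduced weight: numerator and denominator of
  \<open>\<nu>\<close> both contain the number of cavity configurations, which cancels.\<close>

lemma \<nu>_ck: "\<kappa> * \<nu> \<eta> = (\<Sum>\<beta>\<in>configs ({..<n} - U). if map \<beta> zs = \<tau> \<and> map \<beta> ys = map \<eta> ys then rest_wt G U \<beta> else 0)"
proof -
  let ?c = "real (card (configs U :: (nat \<Rightarrow> 'o) set))"
  let ?Z = "\<Sum>\<sigma>\<in>configs {..<n}. rest_wt G U \<sigma>"
  have mys: "map (merge_on U u \<beta>) ys = map \<beta> ys" for u \<beta> :: "nat \<Rightarrow> 'o"
    using Y_sub by (auto simp: merge_on_def)
  have c0: "0 < ?c" by (simp add: card_gt_0_iff)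
  have "(\<Sum>\<sigma>\<in>configs {..<n}. if map \<sigma> (zs @ ys) = \<tau> @ map \<eta> ys then rest_wt G U \<sigma> else 0) =
    (\<Sum>\<sigma>\<in>S. rest_wt G U \<sigma> * (if map \<sigma> ys = map \<eta> ys then 1 else 0))"
    unfolding fibre_def by (subst sum.inter_filter) (auto intro!: sum.cong simp: len)
  also have "\<dots> = ?c * (\<Sum>\<beta>\<in>configs ({..<n} - U). if map \<beta> zs = \<tau> \<and> map \<beta> ys = map \<eta> ys then rest_wt G U \<beta> else 0)"
    unfolding sum_S ck_def mys by (auto intro!: sum.cong)
  finally have num: "Q (zs @ ys) (\<tau> @ map \<eta> ys) = ?c * (\<Sum>\<beta>\<in>configs ({..<n} - U). if map \<beta> zs = \<tau> \<and> map \<beta> ys = map \<eta> ys then rest_wt G U \<beta> else 0) / ?Z"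
    by (simp add: law_def)
  have "(\<Sum>\<sigma>\<in>S. rest_wt G U \<sigma> * 1) = ?c * \<kappa>" unfolding sum_S by (simp add: ck_const)
  then have den: "Q zs \<tau> = ?c * \<kappa> / ?Z" by (simp add: Q_zs)
  show ?thesis unfolding \<nu>_def num den using c0 \<kappa>_pos rest.total_pos[of U] by simp
qed

text \<open>Once the pins are met, \<open>f\<close> depends on the slice configuration only through
  its outer spins, and the sum is grouped by these.\<close>

lemma ck_eq:
  assumes f: "determined (U \<union> Y \<union> W) f"
  shows "ck u f = \<kappa> * (\<Sum>\<eta>\<in>configs Y. \<nu> \<eta> * f (cfg \<eta> u))"
proof -
  have "ck u f = (\<Sum>\<beta>\<in>configs ({..<n} - U). \<Sum>\<eta>\<in>configs Y. if restrict \<beta> Y = \<eta> then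
      (if map \<beta> zs = \<tau> then rest_wt G U \<beta> else 0) * f (cfg \<eta> u) else 0)"
    unfolding ck_def
  proof (intro sum.cong refl)
    fix \<beta> :: "nat \<Rightarrow> 'o"
    have "restrict \<beta> Y \<in> configs Y" by (simp add: configs_def)
    moreover have "f (merge_on U u \<beta>) = f (cfg (restrict \<beta> Y) u)" if "map \<beta> zs = \<tau>"
      by (rule determinedD[OF f]) (rule cfg_merge[OF that])
    ultimately show "(if map \<beta> zs = \<tau> then rest_wt G U \<beta> * f (merge_on U u \<beta>) else 0) =
      (\<Sum>\<eta>\<in>configs Y. if restrict \<beta> Y = \<eta> then
      (if map \<beta> zs = \<tau> then rest_wt G U \<beta> else 0) * f (cfg \<eta> u) else 0)"
      by simp
  qed
  also have "\<dots> = (\<Sum>\<eta>\<in>configs Y. (\<kappa> * \<nu> \<eta>) * f (cfg \<eta> u))"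
  proof (subst sum.swap, intro sum.cong refl)
    fix \<eta> :: "nat \<Rightarrow> 'o" assume "\<eta> \<in> configs Y"
    then have "restrict \<beta> Y = \<eta> \<longleftrightarrow> map \<beta> ys = map \<eta> ys" for \<beta>
      by (auto simp: configs_def PiE_def extensional_def fun_eq_iff)
    then show "(\<Sum>\<beta>\<in>configs ({..<n} - U). if restrict \<beta> Y = \<eta> then
      (if map \<beta> zs = \<tau> then rest_wt G U \<beta> else 0) * f (cfg \<eta> u) else 0) = (\<kappa> * \<nu> \<eta>) * f (cfg \<eta> u)"
      unfolding \<nu>_ck sum_distrib_right by (auto intro!: sum.cong)
  qed
  finally show ?thesis by (simp add: sum_distrib_left mult.assoc)
qed

text \<open>The factor of a boundary constraint as a function of the outer spins, \<open>s\<close>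
  being the spin at its one cavity vertex. Giving all of \<open>U\<close> the spin \<open>s\<close>
  is correct because \<open>a\<close> reads no other vertex of \<open>U\<close>.\<close>

definition "F a s \<eta> = psi_fac G a (cfg \<eta> (\<lambda>_. s))"
text \<open>The constraints at the cavity that stay in the message from \<open>a\<close> besides
  \<open>a\<close> itself; \<open>H\<close> below is their combined weight, summed over the spins of
  \<open>U\<close> other than the target.\<close>

definition "R a = {b\<in>touching G U. xto G a U \<notin> nbset G b}"
definition "H a \<eta> = (\<Sum>u\<in>configs (U - {xto G a U}). \<Prod>b\<in>R a. psi_fac G b (cfg \<eta> u))"
text \<open>The message that would result from exactly independent outer neighbours, up to a factor
  not depending on \<open>s\<close>.\<close>

definition "M a s = pmean Y q (F a s)"

lemma T_facs: "a \<in> T \<Longrightarrow> a \<in> facs G" by (simp add: touching_def)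
lemma B_facs: "a \<in> B \<Longrightarrow> a \<in> facs G" by (simp add: bdry_def)
lemma I_facs: "a \<in> I \<Longrightarrow> a \<in> facs G" by (simp add: inner_def)

lemma xto_in: "a \<in> B \<Longrightarrow> xto G a U \<in> U" "a \<in> B \<Longrightarrow> xto G a U \<in> nbset G a"
  using xto_inter[of a] by blast+

lemma T_nbset: "a \<in> T \<Longrightarrow> nbset G a \<subseteq> U \<union> Y \<union> W"
  unfolding T_split(1) by (auto simp: Y_def inner_def)

lemma F_eq:
  assumes "a \<in> B"
  shows "psi_fac G a (cfg \<eta> u) = F a (u (xto G a U)) \<eta>"
  unfolding F_def
proof (rule psi_fac_cong)
  fix x assume "x \<in> nbset G a"
  then have "x \<in> U \<Longrightarrow> x = xto G a U" using xto_inter[OF assms] by blast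
  then show "cfg \<eta> u x = cfg \<eta> (\<lambda>_. u (xto G a U)) x" by (auto simp: cfg_def)
qed

lemma F_bounds: "a \<in> B \<Longrightarrow> 1 / c \<le> F a s \<eta> \<and> F a s \<eta> \<le> c"
  unfolding F_def by (intro psi_fac_bounds B_facs)

lemma inner_eq: "a \<in> I \<Longrightarrow> psi_fac G a (cfg \<eta> u) = psi_fac G a u"
  by (rule psi_fac_cong) (auto simp: cfg_def inner_def)

lemma determined_F: "determined (nbset G a \<inter> Y) (F a s)"
  unfolding F_def by (auto simp: determined_def cfg_def intro!: psi_fac_cong)

text \<open>A constraint in \<open>R a\<close> differs from \<open>a\<close>, as it misses the
  target vertex. If it is a boundary constraint, its outer neighbours are disjoint from those of
  \<open>a\<close> by CAV3; otherwise it reads only \<open>U\<close>.\<close>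

lemma determined_H:
  assumes "a \<in> B"
  shows "determined (Y - nbset G a \<inter> Y) (H a)"
  unfolding determined_def H_def
proof (intro allI impI sum.cong prod.cong refl psi_fac_cong)
  fix \<eta> \<eta>' :: "nat \<Rightarrow> 'o" and u b x
  assume eq: "\<forall>x\<in>Y - nbset G a \<inter> Y. \<eta> x = \<eta>' x" and b: "b \<in> R a" and x: "x \<in> nbset G b"
  have ne: "b \<noteq> a" using b xto_in(2)[OF assms] by (auto simp: R_def)
  have "x \<notin> nbset G a" if "x \<in> Y"
  proof (cases "b \<in> B")
    case True
    then show ?thesis using bdry_disjoint[OF True assms ne] x that Y_sub by blast
  next
    case False
    then have "x \<in> U" using b x by (auto simp: R_def T_split(1) inner_def)
    then show ?thesis using that Y_sub by blast
  qed
  then show "cfg \<eta> u x = cfg \<eta>' u x" using eq by (auto simp: cfg_def)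
qed

lemma R_sub: "R a \<subseteq> T" "finite (R a)" "a \<in> B \<Longrightarrow> card (R a) < t"
proof -
  show "R a \<subseteq> T" by (auto simp: R_def)
  then show "finite (R a)" using T_split(5) finite_subset by blast
  show "card (R a) < t" if a: "a \<in> B"
  proof (rule psubset_card_mono[OF T_split(5)])
    have "a \<in> T" "a \<notin> R a" using a xto_in(2)[OF a] by (auto simp: R_def T_split(1))
    then show "R a \<subset> T" using \<open>R a \<subseteq> T\<close> by blast
  qed
qed

text \<open>Of the touching constraints, the inner ones read only \<open>U\<close> and come out of
  the sum, while each boundary one sees \<open>u\<close> at a single vertex.\<close>

lemma marg_num:
  assumes u: "u \<in> configs U"
  shows "(\<Sum>\<sigma>\<in>S. if restrict \<sigma> U = u then psi_G G \<sigma> else 0) =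
    \<kappa> * (\<Prod>a\<in>I. psi_fac G a u) * (\<Sum>\<eta>\<in>configs Y. \<nu> \<eta> * (\<Prod>a\<in>B. F a (u (xto G a U)) \<eta>))"
proof -
  have "determined (U \<union> Y \<union> W) (\<lambda>\<sigma>. \<Prod>a\<in>T. psi_fac G a \<sigma>)"
    using T_nbset by (intro determined_prod) (auto simp: determined_def intro!: psi_fac_cong)
  moreover have split: "(\<Prod>a\<in>T. psi_fac G a (cfg \<eta> u)) = (\<Prod>a\<in>I. psi_fac G a u) * (\<Prod>a\<in>B. F a (u (xto G a U)) \<eta>)" for \<eta>
    unfolding T_split(1) using T_split by (subst prod.union_disjoint) (auto simp: inner_eq F_eq)
  ultimately have "(\<Sum>\<sigma>\<in>S. if restrict \<sigma> U = u then psi_G G \<sigma> else 0) =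
    \<kappa> * (\<Sum>\<eta>\<in>configs Y. \<nu> \<eta> * (\<Prod>a\<in>T. psi_fac G a (cfg \<eta> u)))"
    using ck_restrict[OF u, of "\<lambda>\<sigma>. \<Prod>a\<in>T. psi_fac G a \<sigma>"] ck_eq[of "\<lambda>\<sigma>. \<Prod>a\<in>T. psi_fac G a \<sigma>" u] by (simp add: psi_G_split[of _ U] cong: if_cong)
  also have "\<dots> = \<kappa> * (\<Prod>a\<in>I. psi_fac G a u) * (\<Sum>\<eta>\<in>configs Y. \<nu> \<eta> * (\<Prod>a\<in>B. F a (u (xto G a U)) \<eta>))"
    unfolding split by (simp add: sum_distrib_left mult_ac)
  finally show ?thesis .
qed

text \<open>The message keeps the constraints not touching \<open>U\<close>, the constraint
  \<open>a\<close> and those in \<open>R a\<close>. The first give \<nu>, the second gives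
  \<open>F\<close>, and the third, summed over the other cavity spins, give
  \<open>H\<close>.\<close>

lemma msg_num:
  assumes a: "a \<in> B"
  shows "msg_w G S a (xto G a U) s = \<kappa> * (\<Sum>\<eta>\<in>configs Y. \<nu> \<eta> * (F a s \<eta> * H a \<eta>))"
proof -
  let ?x = "xto G a U"
  let ?f = "\<lambda>\<sigma>. psi_fac G a \<sigma> * (\<Prod>b\<in>R a. psi_fac G b \<sigma>)"
  have x: "?x \<in> U" "?x \<in> nbset G a" using xto_in[OF a] by auto
  have "facs G - (dvar G ?x - {a}) = (facs G - T) \<union> insert a (R a)"
    using a x B_facs[OF a] by (auto simp: R_def dvar_def touching_def)
  moreover have "(facs G - T) \<inter> insert a (R a) = {}" "a \<notin> R a"
    using a x R_sub(1)[of a] by (auto simp: T_split(1) R_def)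
  ultimately have split: "(\<Prod>b\<in>facs G - (dvar G ?x - {a}). psi_fac G b \<sigma>) = rest_wt G U \<sigma> * ?f \<sigma>" for \<sigma>
    by (simp add: prod.union_disjoint R_sub rest_wt_def)
  \<comment> \<open>The spin at the target is dropped from the summation index; constraints in
    \<open>R a\<close> do not read it.\<close>
  have H_eq: "(\<Sum>u\<in>{u\<in>configs U. u ?x = s}. \<Prod>b\<in>R a. psi_fac G b (cfg \<eta> u)) = H a \<eta>" for \<eta>
    unfolding H_def
  proof (rule sum.reindex_bij_witness[of _ "\<lambda>u. u(?x := s)" "\<lambda>u. u(?x := undefined)"])
    fix u assume "u \<in> {u\<in>configs U. u ?x = s}"
    then show "(u(?x := undefined))(?x := s) = u" by auto
    show "u(?x := undefined) \<in> configs (U - {?x})"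
      using \<open>u \<in> {u\<in>configs U. u ?x = s}\<close> by (auto simp: configs_def PiE_def extensional_def)
    show "(\<Prod>b\<in>R a. psi_fac G b (cfg \<eta> (u(?x := undefined)))) = (\<Prod>b\<in>R a. psi_fac G b (cfg \<eta> u))"
      by (intro prod.cong refl psi_fac_cong) (auto simp: cfg_def R_def)
  next
    fix u :: "nat \<Rightarrow> 'o" assume "u \<in> configs (U - {?x})"
    then show "(u(?x := s))(?x := undefined) = u" "u(?x := s) \<in> {u\<in>configs U. u ?x = s}"
      using x by (auto simp: configs_def PiE_def extensional_def fun_eq_iff)
  qed
  have "msg_w G S a ?x s = (\<Sum>\<sigma>\<in>S. rest_wt G U \<sigma> * (if \<sigma> ?x = s then ?f \<sigma> else 0))"
    unfolding msg_w_def split by (intro sum.cong) auto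
  also have "\<dots> = (\<Sum>u\<in>configs U. if u ?x = s then ck u ?f else 0)"
  proof -
    have "merge_on U u \<beta> ?x = u ?x" for u \<beta> :: "nat \<Rightarrow> 'o" using x by (simp add: merge_on_def)
    then show ?thesis unfolding sum_S by (auto intro!: sum.cong simp: ck_def cong: if_cong)
  qed
  also have "\<dots> = (\<Sum>u\<in>{u\<in>configs U. u ?x = s}. ck u ?f)"
    by (rule sum.inter_filter[symmetric]) simp
  also have "\<dots> = (\<Sum>u\<in>{u\<in>configs U. u ?x = s}. \<kappa> * (\<Sum>\<eta>\<in>configs Y. \<nu> \<eta> * (F a s \<eta> * (\<Prod>b\<in>R a. psi_fac G b (cfg \<eta> u)))))"
  proof (intro sum.cong refl)
    fix u assume u: "u \<in> {u\<in>configs U. u ?x = s}"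
    have aT: "a \<in> T" using a by (simp add: T_split(1))
    have "determined (U \<union> Y \<union> W) (\<lambda>\<sigma>. \<Prod>b\<in>insert a (R a). psi_fac G b \<sigma>)"
    proof (intro determined_prod)
      fix b assume "b \<in> insert a (R a)"
      then have "nbset G b \<subseteq> U \<union> Y \<union> W" using T_nbset[of b] aT R_sub(1)[of a] by blast
      then show "determined (U \<union> Y \<union> W) (psi_fac G b)"
        by (auto simp: determined_def intro!: psi_fac_cong)
    qed
    then have "determined (U \<union> Y \<union> W) ?f" using x R_sub(2)[of a] by (simp add: R_def)
    from ck_eq[OF this, of u] show "ck u ?f = \<kappa> * (\<Sum>\<eta>\<in>configs Y. \<nu> \<eta> * (F a s \<eta> * (\<Prod>b\<in>R a. psi_fac G b (cfg \<eta> u))))"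
      using u by (simp add: F_eq[OF a])
  qed
  also have "\<dots> = \<kappa> * (\<Sum>\<eta>\<in>configs Y. \<nu> \<eta> * (F a s \<eta> *
      (\<Sum>u\<in>{u\<in>configs U. u ?x = s}. \<Prod>b\<in>R a. psi_fac G b (cfg \<eta> u))))"
    unfolding sum_distrib_left by (rule sum.swap)
  finally show ?thesis unfolding H_eq .
qed

lemma tv_nonneg: "0 \<le> tv" unfolding tv_def by (intro sum_nonneg) auto

lemma F_disjoint:
  assumes "a \<in> B" "b \<in> B" "a \<noteq> b"
  shows "(nbset G a \<inter> Y) \<inter> (nbset G b \<inter> Y) = {}"
  using bdry_disjoint[OF assms] Y_sub by blast

abbreviation "\<delta> \<equiv> c ^ (2 * t) * tv"

lemma c_ratio: "c ^ t / (1 / c ^ t) = c ^ (2 * t)"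
  by (simp add: power_add mult_2)

text \<open>The product of the boundary factors lies between c^-t and c^t, whence the ratio c^(2 t)
  in front of \<open>tv\<close>.\<close>

lemma prod_approx:
  "\<bar>(\<Sum>\<eta>\<in>configs Y. \<nu> \<eta> * (\<Prod>a\<in>B. F a (s a) \<eta>)) - (\<Prod>a\<in>B. M a (s a))\<bar> \<le> \<delta> * (\<Prod>a\<in>B. M a (s a))"
proof -
  have eq: "pmean Y q (\<lambda>\<eta>. \<Prod>a\<in>B. F a (s a) \<eta>) = (\<Prod>a\<in>B. M a (s a))"
    unfolding M_def
    by (rule pmean_prod[OF finY q_sum T_split(4), where A = "\<lambda>a. nbset G a \<inter> Y"])
       (use F_disjoint determined_F in auto)
  have "card B \<le> t" using T_split by (intro card_mono) auto
  then have "1 / c ^ t \<le> (\<Prod>a\<in>B. F a (s a) \<eta>) \<and> (\<Prod>a\<in>B. F a (s a) \<eta>) \<le> c ^ t" for \<eta>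
    using F_bounds c1 T_split(4) by (intro conjI prod_bounds) auto
  from pmean_approx(1)[OF finY q_sum, of "1 / c ^ t" "\<lambda>\<eta>. \<Prod>a\<in>B. F a (s a) \<eta>" "c ^ t", OF this _ q_nonneg tv_def[symmetric]]
  show ?thesis using c1 unfolding eq c_ratio by simp
qed

text \<open>Under the product measure \<open>F\<close> and \<open>H\<close> are independent, and the
  mean of \<open>H\<close> does not involve \<open>s\<close>. So the message is proportional to
  \<open>M\<close> up to the relative error, and \<open>h\<close> disappears on normalising.\<close>

lemma msg_approx:
  assumes a: "a \<in> B"
  obtains h where "0 < h"
    "\<And>s. \<bar>msg_w G S a (xto G a U) s - h * M a s\<bar> \<le> \<delta> * (h * M a s)"
    "\<And>s. 0 < M a s"
proof -
  \<comment> \<open>\<open>N\<close> is the number of summands in \<open>H\<close>; it cancels in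
    the ratio of the upper to the lower bound.\<close>
  define N where "N = real (card (configs (U - {xto G a U}) :: (nat \<Rightarrow> 'o) set))"
  have N: "0 < N" by (simp add: N_def card_gt_0_iff)
  have ct: "0 < c ^ t" "1 \<le> c ^ t" using c1 by auto
  \<comment> \<open>\<open>a\<close> touches \<open>U\<close> but is not in \<open>R a\<close>, so
    each summand of \<open>H\<close> has at most t - 1 factors and \<open>F a\<close> supplies the
    remaining factor c.\<close>
  have t: "card (R a) \<le> t - 1" "0 < t" using R_sub(3)[OF a] by auto
  have Rb: "1 / c ^ (t - 1) \<le> (\<Prod>b\<in>R a. psi_fac G b \<sigma>) \<and> (\<Prod>b\<in>R a. psi_fac G b \<sigma>) \<le> c ^ (t - 1)" for \<sigma>
    using R_sub[of a] t psi_fac_bounds T_facs c1 by (intro conjI prod_bounds) auto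
  have Hb: "N * (1 / c ^ (t - 1)) \<le> H a \<eta>" "H a \<eta> \<le> N * c ^ (t - 1)" for \<eta>
    unfolding H_def N_def
    using Rb sum_bounded_below[of "configs (U - {xto G a U}) :: (nat \<Rightarrow> 'o) set" "1 / c ^ (t - 1)"]
      sum_bounded_above[of "configs (U - {xto G a U}) :: (nat \<Rightarrow> 'o) set" _ "c ^ (t - 1)"] by auto
  have H0: "0 < H a \<eta>" for \<eta> using Hb(1)[of \<eta>] N c1 by (smt (verit) divide_pos_pos mult_pos_pos zero_less_power)
  have ctt: "c ^ t = c * c ^ (t - 1)" using t(2) by (metis power_minus_mult mult.commute)
  have F0: "0 < F a s \<eta>" for s \<eta> unfolding F_def by (intro psi_fac_pos B_facs a)
  have FH: "N * (1 / c ^ t) \<le> F a s \<eta> * H a \<eta> \<and> F a s \<eta> * H a \<eta> \<le> N * c ^ t" for s \<eta>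
  proof
    have "(1 / c) * (N * (1 / c ^ (t - 1))) \<le> F a s \<eta> * H a \<eta>"
      using F_bounds[OF a, of s \<eta>] Hb[of \<eta>] N c1 F0[of s \<eta>] by (intro mult_mono) auto
    then show "N * (1 / c ^ t) \<le> F a s \<eta> * H a \<eta>" by (simp add: ctt)
    have "F a s \<eta> * H a \<eta> \<le> c * (N * c ^ (t - 1))"
      using F_bounds[OF a, of s \<eta>] Hb[of \<eta>] H0[of \<eta>] c1 by (intro mult_mono) auto
    then show "F a s \<eta> * H a \<eta> \<le> N * c ^ t" by (simp add: ctt mult_ac)
  qed
  have eq: "pmean Y q (\<lambda>\<eta>. F a s \<eta> * H a \<eta>) = M a s * pmean Y q (H a)" for s
    unfolding M_def
    by (rule pmean_mult[OF finY q_sum _ determined_F determined_H[OF a]]) auto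
  have \<alpha>: "0 < N * (1 / c ^ (t - 1))" "0 < 1 / c" using N c1 by auto
  have Hm: "0 < pmean Y q (H a)"
    using pmean_approx(2)[where F = "H a", OF finY q_sum conjI[OF Hb] \<alpha>(1) q_nonneg tv_def[symmetric]] \<alpha>(1) by linarith
  have M0: "0 < M a s" for s
    using pmean_approx(2)[where F = "F a s", OF finY q_sum F_bounds[OF a] \<alpha>(2) q_nonneg tv_def[symmetric]] \<alpha>(2)
    unfolding M_def by linarith
  have ratio: "N * c ^ t / (N * (1 / c ^ t)) = c ^ (2 * t)"
    using N c_ratio by simp
  show ?thesis
  proof (rule that[of "\<kappa> * pmean Y q (H a)"])
    show "0 < \<kappa> * pmean Y q (H a)" using \<kappa>_pos Hm by simp
    show "\<bar>msg_w G S a (xto G a U) s - \<kappa> * pmean Y q (H a) * M a s\<bar> \<le> \<delta> * (\<kappa> * pmean Y q (H a) * M a s)" for s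
    proof -
      have "0 < N * (1 / c ^ t)" using N ct by simp
      from pmean_approx(1)[where F = "\<lambda>\<eta>. F a s \<eta> * H a \<eta>", OF finY q_sum FH this q_nonneg tv_def[symmetric]]
      have "\<bar>(\<Sum>\<eta>\<in>configs Y. \<nu> \<eta> * (F a s \<eta> * H a \<eta>)) - M a s * pmean Y q (H a)\<bar>
         \<le> \<delta> * (M a s * pmean Y q (H a))"
        unfolding ratio eq .
      from mult_left_mono[OF this, of \<kappa>]
      have "\<bar>\<kappa> * ((\<Sum>\<eta>\<in>configs Y. \<nu> \<eta> * (F a s \<eta> * H a \<eta>)) - M a s * pmean Y q (H a))\<bar>
         \<le> \<kappa> * (\<delta> * (M a s * pmean Y q (H a)))"
        using \<kappa>_pos by (simp add: abs_mult)
      then show ?thesis unfolding msg_num[OF a] by (simp add: right_diff_distrib mult_ac)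
    qed
  qed (rule M0)
qed

text \<open>Changing the spin at a cavity vertex does not leave the subcube, as no pinned vertex
  lies in \<open>U\<close>; hence every spin value occurs.\<close>

lemma msg_w_pos:
  assumes a: "a \<in> B"
  shows "0 < msg_w G S a (xto G a U) s"
proof -
  let ?x = "xto G a U"
  obtain \<sigma> where \<sigma>: "\<sigma> \<in> S" using S_nonempty by blast
  let ?\<sigma> = "\<sigma>(?x := s)"
  have x: "?x \<in> U" using xto_in[OF a] by simp
  then have "?x \<notin> W" "?x \<in> {..<n}" using zsV U_sub by auto
  then have mem: "?\<sigma> \<in> S"
    using \<sigma> by (auto simp: fibre_def configs_def PiE_def extensional_def)
  have pos: "0 < (\<Prod>b\<in>facs G - (dvar G ?x - {a}). psi_fac G b \<sigma>)" for \<sigma>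
    by (rule prod_pos) (use psi_fac_pos in blast)
  show ?thesis unfolding msg_w_def
  proof (rule sum_pos2[OF finS mem])
    show "0 < (if ?\<sigma> ?x = s then \<Prod>b\<in>facs G - (dvar G ?x - {a}). psi_fac G b ?\<sigma> else 0)"
      using pos by simp
    show "0 \<le> (if \<sigma> ?x = s then \<Prod>b\<in>facs G - (dvar G ?x - {a}). psi_fac G b \<sigma> else 0)" for \<sigma>
      using less_imp_le[OF pos] by simp
  qed
qed

lemma msg_w_sum_pos: "a \<in> B \<Longrightarrow> 0 < (\<Sum>s\<in>UNIV. msg_w G S a (xto G a U) s)"
  by (rule sum_pos) (auto intro: msg_w_pos)

text \<open>True marginal and Bethe formula are compared with the same product \<open>g\<close>: the
  former is a multiple of it with relative error \<delta>, the latter with relative error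
  \<open>(2 ^ t - 1) * \<delta>\<close>. If \<delta> exceeds 1, the trivial bound 2 is already
  smaller.\<close>

lemma bethe_err_bound: "bethe_err G U S \<le> 4 * 2 ^ t * \<delta>"
proof (cases "\<delta> \<le> 1")
  case False
  have "4 * 1 * 1 \<le> 4 * 2 ^ t * \<delta>" using False by (intro mult_mono) auto
  then show ?thesis using bethe_err_le_2[OF finU finS] by linarith
next
  case True
  have \<delta>0: "0 \<le> \<delta>" using tv_nonneg c1 by simp
  define g where "g u = (\<Prod>a\<in>I. psi_fac G a u) * (\<Prod>a\<in>B. M a (u (xto G a U)))" for u
  define num where "num u = (\<Sum>\<sigma>\<in>S. if restrict \<sigma> U = u then psi_G G \<sigma> else 0)" for u
  obtain h where h: "\<And>a. a \<in> B \<Longrightarrow> 0 < h a"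
    "\<And>a s. a \<in> B \<Longrightarrow> \<bar>msg_w G S a (xto G a U) s - h a * M a s\<bar> \<le> \<delta> * (h a * M a s)"
    and M0: "\<And>a s. a \<in> B \<Longrightarrow> 0 < M a s"
  proof -
    have "\<exists>h. \<forall>a\<in>B. 0 < h a \<and> (\<forall>s. \<bar>msg_w G S a (xto G a U) s - h a * M a s\<bar> \<le> \<delta> * (h a * M a s)) \<and> (\<forall>s. 0 < M a s)"
      by (intro bchoice ballI) (meson msg_approx)
    then show thesis using that by blast
  qed
  have ac: "x * y * (z * w) = z * (x * (y * w))" and ac': "y * (x * z * w) = x * (y * z) * w" for x y z w :: real
    by simp_all
  have inner0: "0 < (\<Prod>a\<in>I. psi_fac G a u)" for u
    by (intro prod_pos) (auto intro: psi_fac_pos I_facs)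
  have g0: "0 < g u" for u unfolding g_def by (intro mult_pos_pos inner0 prod_pos) (auto intro: M0)
  have num: "\<bar>num u - \<kappa> * g u\<bar> \<le> \<delta> * (\<kappa> * g u)" if u: "u \<in> configs U" for u
  proof -
    let ?m = "\<kappa> * (\<Prod>a\<in>I. psi_fac G a u)"
    let ?P = "\<Prod>a\<in>B. M a (u (xto G a U))"
    let ?N = "\<Sum>\<eta>\<in>configs Y. \<nu> \<eta> * (\<Prod>a\<in>B. F a (u (xto G a U)) \<eta>)"
    have "num u - \<kappa> * g u = ?m * (?N - ?P)"
      unfolding num_def marg_num[OF u] g_def by (simp add: right_diff_distrib)
    then have "\<bar>num u - \<kappa> * g u\<bar> = ?m * \<bar>?N - ?P\<bar>"
      using \<kappa>_pos inner0[of u] by (simp add: abs_mult)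
    moreover have "?m * \<bar>?N - ?P\<bar> \<le> ?m * (\<delta> * ?P)"
      using \<kappa>_pos inner0[of u] by (intro mult_left_mono prod_approx) auto
    moreover have "?m * (\<delta> * ?P) = \<delta> * (\<kappa> * g u)" unfolding g_def by (rule ac)
    ultimately show ?thesis by argo
  qed
  have num0: "0 < num u" if "u \<in> configs U" for u
  proof -
    have "0 \<le> num u" unfolding num_def by (intro sum_nonneg) (auto intro: less_imp_le psi_G_pos)
    moreover have "num u \<noteq> 0"
    proof -
      obtain \<sigma> where \<sigma>: "\<sigma> \<in> S" using S_nonempty by blast
      let ?\<sigma> = "merge_on U u \<sigma>"
      have "restrict ?\<sigma> U = u" using that by (auto simp: merge_on_def configs_def PiE_def extensional_def fun_eq_iff)
      moreover have "?\<sigma> \<in> S"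
        using \<sigma> U_sub by (auto simp: fibre_def merge_zs) (auto simp: configs_def PiE_def extensional_def merge_on_def split: if_splits)
      ultimately have "psi_G G ?\<sigma> \<le> num u" unfolding num_def
        using member_le_sum[of ?\<sigma> S "\<lambda>\<sigma>. if restrict \<sigma> U = u then psi_G G \<sigma> else 0"]
        by (auto simp: less_imp_le[OF psi_G_pos])
      then show ?thesis using psi_G_pos[of ?\<sigma>] by linarith
    qed
    ultimately show ?thesis by linarith
  qed
  \<comment> \<open>\<open>K\<close> collects the factors that do not depend on the spins;
    \<open>p\<close> is the ratio of the true to the ideal unnormalised message.\<close>
  define K where "K = (\<Prod>a\<in>B. h a / (\<Sum>s\<in>UNIV. msg_w G S a (xto G a U) s))"
  define p where "p a s = msg_w G S a (xto G a U) s / (h a * M a s)" for a s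
  have p1: "\<bar>p a s - 1\<bar> \<le> \<delta>" if "a \<in> B" for a s
  proof -
    have pos: "0 < h a * M a s" using h(1) M0 that by simp
    have "p a s - 1 = (msg_w G S a (xto G a U) s - h a * M a s) / (h a * M a s)"
      using h(1)[OF that] M0[OF that, of s] by (simp add: p_def diff_divide_distrib)
    then show ?thesis using h(2)[OF that, of s] pos by (simp add: abs_divide pos_divide_le_eq)
  qed
  have K0: "0 < K" unfolding K_def by (intro prod_pos divide_pos_pos ballI) (auto intro: h msg_w_sum_pos)
  have bar: "bar_w G U S u = K * g u * (\<Prod>a\<in>B. p a (u (xto G a U)))" for u
  proof -
    have "msg G S a (xto G a U) s = h a / (\<Sum>s\<in>UNIV. msg_w G S a (xto G a U) s) * M a s * p a s" if "a \<in> B" for a s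
      using h(1)[OF that] M0[OF that, of s] by (simp add: msg_def p_def)
    then have "(\<Prod>a\<in>B. msg G S a (xto G a U) (u (xto G a U))) = (\<Prod>a\<in>B. h a /
       (\<Sum>s\<in>UNIV. msg_w G S a (xto G a U) s) * M a (u (xto G a U)) * p a (u (xto G a U)))"
      by (rule prod.cong[OF refl])
    also have "\<dots> = K * (\<Prod>a\<in>B. M a (u (xto G a U))) * (\<Prod>a\<in>B. p a (u (xto G a U)))"
      by (simp only: K_def prod.distrib)
    finally have "(\<Prod>a\<in>B. msg G S a (xto G a U) (u (xto G a U))) =
      K * (\<Prod>a\<in>B. M a (u (xto G a U))) * (\<Prod>a\<in>B. p a (u (xto G a U)))" .
    then show ?thesis unfolding bar_w_def g_def by (simp only: ac')
  qed
  let ?\<delta> = "(2 ^ t - 1) * \<delta>"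
  have "card B \<le> t" using T_split by (intro card_mono) auto
  then have le: "(2 ^ card B - 1) * \<delta> \<le> ?\<delta>" using \<delta>0 by (intro mult_right_mono) auto
  have P1: "\<bar>(\<Prod>a\<in>B. p a (u (xto G a U))) - 1\<bar> \<le> ?\<delta>" for u
    using prod_near_1[OF T_split(4), of "\<lambda>a. p a (u (xto G a U))" \<delta>] p1 True \<delta>0 le by force
  have barg: "\<bar>bar_w G U S u - K * g u\<bar> \<le> ?\<delta> * (K * g u)" for u
  proof -
    let ?p = "\<Prod>a\<in>B. p a (u (xto G a U))"
    have "bar_w G U S u - K * g u = (K * g u) * (?p - 1)"
      unfolding bar by (simp add: right_diff_distrib)
    then have "\<bar>bar_w G U S u - K * g u\<bar> = (K * g u) * \<bar>?p - 1\<bar>"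
      using K0 g0[of u] by (simp add: abs_mult)
    moreover have "(K * g u) * \<bar>?p - 1\<bar> \<le> (K * g u) * ?\<delta>"
      using K0 g0[of u] by (intro mult_left_mono P1) auto
    ultimately show ?thesis by (simp only: mult.commute)
  qed
  have bar0: "0 < bar_w G U S u" for u
    unfolding bar_w_def msg_def
    by (intro mult_pos_pos prod_pos divide_pos_pos) (auto intro: psi_fac_pos I_facs msg_w_pos msg_w_sum_pos)
  have d1: "(\<Sum>u\<in>configs U. \<bar>num u / sum num (configs U) - g u / sum g (configs U)\<bar>) \<le> 2 * \<delta>"
    using num num0 g0 \<kappa>_pos by (intro normalised_diff) auto
  have d2: "(\<Sum>u\<in>configs U. \<bar>bar_w G U S u / sum (bar_w G U S) (configs U) - g u / sum g (configs U)\<bar>) \<le> 2 * ?\<delta>"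
    using barg bar0 g0 K0 by (intro normalised_diff) auto
  have "bethe_err G U S = (\<Sum>u\<in>configs U. \<bar>num u / sum num (configs U) - bar_w G U S u / sum (bar_w G U S) (configs U)\<bar>)"
    unfolding bethe_err_def marg_alt[OF finU finS] bar_mu_def num_def by simp
  also have "\<dots> \<le> (\<Sum>u\<in>configs U. \<bar>num u / sum num (configs U) - g u / sum g (configs U)\<bar> +
      \<bar>bar_w G U S u / sum (bar_w G U S) (configs U) - g u / sum g (configs U)\<bar>)"
    by (intro sum_mono) linarith
  also have "\<dots> \<le> 2 * \<delta> + 2 * ?\<delta>" unfolding sum.distrib using d1 d2 by (rule add_mono)
  also have "\<dots> = 2 * (2 ^ t * \<delta>)" by (simp add: algebra_simps)
  also have "\<dots> \<le> 4 * 2 ^ t * \<delta>"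
    using \<delta>0 by (simp add: mult.commute)
  finally show ?thesis .
qed

end

section \<open>Averaging over the subcubes\<close>

definition avg_err :: "nat \<Rightarrow> 'o::finite fg \<Rightarrow> nat set \<Rightarrow> nat list \<Rightarrow> real" where
  "avg_err n G U zs = (\<Sum>\<tau>\<in>vecs (length zs). gibbs_set G (fibre n zs \<tau>) * bethe_err G U (fibre n zs \<tau>))"

text \<open>All touching constraints are used, since these are what the random splitting provides;
  the inner ones contribute nothing outside \<open>U\<close>.\<close>

definition outside :: "'o fg \<Rightarrow> nat set \<Rightarrow> nat list \<Rightarrow> nat list" where
  "outside G U zs = sorted_list_of_set ((\<Union>a\<in>touching G U. nbset G a) - U - set zs)"

context valid_graph
begin

lemma Zfn_pos: "0 < Zfn G"
  unfolding Zfn_def vars_G by (intro sum_pos) (auto intro: psi_G_pos)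

lemma gibbs_set_nonneg: "0 \<le> gibbs_set G S"
  unfolding gibbs_set_def using Zfn_pos by (intro sum_nonneg) (auto intro!: divide_nonneg_pos less_imp_le[OF psi_G_pos])

lemma gibbs_fibre_sum: "(\<Sum>\<tau>\<in>vecs (length zs). gibbs_set G (fibre n zs \<tau>)) = 1"
proof -
  have "(\<Sum>\<tau>\<in>vecs (length zs). gibbs_set G (fibre n zs \<tau>)) =
    (\<Sum>\<tau>\<in>vecs (length zs). \<Sum>\<sigma>\<in>configs {..<n}. if map \<sigma> zs = \<tau> then psi_G G \<sigma> / Zfn G else 0)"
    unfolding gibbs_set_def fibre_def by (intro sum.cong sum.inter_filter) auto
  also have "\<dots> = (\<Sum>\<sigma>\<in>configs {..<n}. psi_G G \<sigma> / Zfn G)"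
    by (subst sum.swap) simp
  also have "\<dots> = 1" using Zfn_pos by (simp add: sum_divide_distrib[symmetric] Zfn_def vars_G)
  finally show ?thesis .
qed

lemma avg_err_le_2:
  assumes "finite U"
  shows "avg_err n G U zs \<le> 2"
proof -
  have "avg_err n G U zs \<le> (\<Sum>\<tau>\<in>vecs (length zs). gibbs_set G (fibre n zs \<tau>) * 2)"
    unfolding avg_err_def
    by (intro sum_mono mult_left_mono gibbs_set_nonneg bethe_err_le_2 assms) (simp add: fibre_def)
  then show ?thesis by (simp add: sum_distrib_right[symmetric] gibbs_fibre_sum)
qed

context
  fixes U zs
  assumes cav: "cavity G U" and zs: "distinct zs" "set zs \<subseteq> {..<n} - U"
begin

text \<open>The average is taken with the Gibbs measure, but \<open>dep\<close> belongs to the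
  reduced graph. The change of measure costs c^(2 t), and the error at the cavity brings a further
  2^t c^(2 t).\<close>

lemma avg_err_bound:
  "avg_err n G U zs \<le> 4 * (2 * c ^ 4) ^ card (touching G U) * dep {..<n} (rest_wt G U) zs (outside G U zs)"
proof -
  let ?t = "card (touching G U)"
  have "avg_err n G U zs \<le> (\<Sum>\<tau>\<in>vecs (length zs). 4 * (2 * c ^ 4) ^ ?t * (\<Sum>\<eta>\<in>vecs (length (outside G U zs)).
     \<bar>law {..<n} (rest_wt G U) (zs @ outside G U zs) (\<tau> @ \<eta>) - law {..<n} (rest_wt G U) zs \<tau> *
       (\<Prod>i<length (outside G U zs). law {..<n} (rest_wt G U) (zs @ [outside G U zs ! i]) (\<tau> @ [\<eta> ! i]) /
          law {..<n} (rest_wt G U) zs \<tau>)\<bar>))"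
    unfolding avg_err_def
  proof (intro sum_mono)
    fix \<tau> :: "'o list" assume "\<tau> \<in> vecs (length zs)"
    then interpret cavity_fibre k n c G U zs \<tau>
      by unfold_locales (use cav zs in \<open>auto simp: vecs_def\<close>)
    have "(\<Union>a\<in>touching G U. nbset G a) - U - set zs = Y"
      unfolding Y_def T_split(1) by (auto simp: inner_def)
    then have ys: "outside G U zs = ys" by (simp add: outside_def ys_def)
    have "gibbs_set G S * bethe_err G U S \<le> (c ^ (2 * ?t) * Q zs \<tau>) * (4 * 2 ^ ?t * (c ^ (2 * ?t) * tv))"
      using gibbs_fibre_le[of zs \<tau> U] bethe_err_bound Q_pos c1
      by (intro mult_mono) (auto simp: bethe_err_def intro!: sum_nonneg)
    also have "\<dots> = 4 * (2 * c ^ 4) ^ ?t * (Q zs \<tau> * tv)"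
    proof -
      have "(2 * c ^ 4) ^ ?t = 2 ^ ?t * (c ^ (2 * ?t) * c ^ (2 * ?t))"
        by (simp add: power_mult_distrib power_mult[symmetric] power_add[symmetric])
      then show ?thesis by (simp add: mult_ac)
    qed
    finally show "gibbs_set G S * bethe_err G U S \<le> 4 * (2 * c ^ 4) ^ ?t * (\<Sum>\<eta>\<in>vecs (length (outside G U zs)).
     \<bar>Q (zs @ outside G U zs) (\<tau> @ \<eta>) - Q zs \<tau> *
       (\<Prod>i<length (outside G U zs). Q (zs @ [outside G U zs ! i]) (\<tau> @ [\<eta> ! i]) / Q zs \<tau>)\<bar>)"
      unfolding tv_dep ys .
  qed
  then show ?thesis by (simp add: dep_def sum_distrib_left)
qed

end

end

section \<open>Counting cavities\<close>

text \<open>A union of connected components of the induced subgraph, given by its variable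
  nodes.\<close>

definition closed_in :: "'o fg \<Rightarrow> nat set \<Rightarrow> nat set \<Rightarrow> bool" where
  "closed_in G U A \<longleftrightarrow> A \<subseteq> U \<and> (\<forall>a\<in>inner G U. nbset G a \<subseteq> A \<or> nbset G a \<inter> A = {})"

text \<open>Connectivity as the absence of proper nonempty closed parts; paths appear only in the
  translation to \<open>sub_ncomp\<close>.\<close>

definition connected_in :: "'o fg \<Rightarrow> nat set \<Rightarrow> bool" where
  "connected_in G C \<longleftrightarrow> C \<noteq> {} \<and> (\<forall>A. A \<noteq> {} \<longrightarrow> closed_in G C A \<longrightarrow> A = C)"

abbreviation sub_rel :: "'o fg \<Rightarrow> nat set \<Rightarrow> ((nat + nat) \<times> (nat + nat)) set" where
  "sub_rel G U \<equiv> {(v, w). sub_adj G U v w}"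

lemma finite_inner [simp]: "finite (inner G U)"
  by (simp add: inner_def)

lemma inner_mono: "A \<subseteq> U \<Longrightarrow> inner G A \<subseteq> inner G U"
  by (auto simp: inner_def)

lemma sub_adj_mono: "A \<subseteq> U \<Longrightarrow> sub_adj G A v w \<Longrightarrow> sub_adj G U v w"
  unfolding sub_adj_def using inner_mono by blast

lemma sub_adj_verts: "sub_adj G U v w \<Longrightarrow> v \<in> sub_verts G U \<and> w \<in> sub_verts G U"
  unfolding sub_adj_def sub_verts_def by blast

context valid_graph
begin

lemma inner_nonempty: "a \<in> inner G U \<Longrightarrow> nbset G a \<noteq> {}"
  using nbset_nonempty by (auto simp: inner_def)

lemma closed_adj:
  assumes A: "closed_in G U A" and "v \<in> sub_verts G A" "sub_adj G U v w"
  shows "sub_adj G A v w"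
proof -
  obtain x a where xa: "x \<in> U" "a \<in> inner G U" "x \<in> nbset G a"
    "(v = Inl x \<and> w = Inr a) \<or> (v = Inr a \<and> w = Inl x)"
    using assms(3) unfolding sub_adj_def by blast
  have "nbset G a \<inter> A \<noteq> {}"
    using assms(2) xa inner_nonempty[of a A] by (auto simp: sub_verts_def inner_def)
  then have "nbset G a \<subseteq> A" using A xa(2) by (auto simp: closed_in_def)
  then have "a \<in> inner G A" "x \<in> A" using xa by (auto simp: inner_def)
  then show ?thesis using xa(3,4) unfolding sub_adj_def by blast
qed

lemma closed_rtrancl:
  assumes A: "closed_in G U A" and v: "v \<in> sub_verts G A"
  shows "(sub_rel G U)\<^sup>* `` {v} = (sub_rel G A)\<^sup>* `` {v}"
proof -
  have "(v, w) \<in> (sub_rel G A)\<^sup>* \<and> w \<in> sub_verts G A" if "(v, w) \<in> (sub_rel G U)\<^sup>*" for w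
    using that
  proof (induction rule: rtrancl_induct)
    case base
    then show ?case using v by simp
  next
    case (step y z)
    then have adj: "sub_adj G A y z" using closed_adj[OF A] by auto
    then show ?case using step sub_adj_verts[OF adj] by (auto intro: rtrancl_into_rtrancl)
  qed
  moreover have "(sub_rel G A)\<^sup>* \<subseteq> (sub_rel G U)\<^sup>*"
    using A by (intro rtrancl_mono) (auto simp: closed_in_def intro: sub_adj_mono)
  ultimately show ?thesis by auto
qed

lemma sub_verts_split:
  assumes "closed_in G U A"
  shows "sub_verts G U = sub_verts G A \<union> sub_verts G (U - A)" "sub_verts G A \<inter> sub_verts G (U - A) = {}"
proof -
  have "inner G U = inner G A \<union> inner G (U - A)"
    using assms by (auto simp: closed_in_def inner_def)
  moreover have "U = A \<union> (U - A)" using assms by (auto simp: closed_in_def)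
  ultimately show "sub_verts G U = sub_verts G A \<union> sub_verts G (U - A)"
    unfolding sub_verts_def by blast
  show "sub_verts G A \<inter> sub_verts G (U - A) = {}"
    using inner_nonempty by (fastforce simp: sub_verts_def inner_def)
qed

lemma closed_compl: "closed_in G U A \<Longrightarrow> closed_in G U (U - A)"
  by (auto simp: closed_in_def inner_def)

lemma finite_sub_verts: "finite U \<Longrightarrow> finite (sub_verts G U)"
  by (simp add: sub_verts_def)

text \<open>The set reachable from a vertex of a closed part stays in that part and is the same
  whether computed there or in \<open>U\<close>.\<close>

lemma sub_ncomp_add:
  assumes A: "closed_in G U A" and fin: "finite U"
  shows "sub_ncomp G U = sub_ncomp G A + sub_ncomp G (U - A)"
proof -
  let ?q = "\<lambda>A. sub_verts G A // (sub_rel G A)\<^sup>*"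
  have q: "?q B = (\<lambda>v. (sub_rel G U)\<^sup>* `` {v}) ` sub_verts G B" if "closed_in G U B" for B
    unfolding quotient_def using closed_rtrancl[OF that] by auto
  have qU: "?q U = ?q A \<union> ?q (U - A)"
    unfolding q[OF A] q[OF closed_compl[OF A]] using sub_verts_split(1)[OF A] by (auto simp: quotient_def)
  have sub: "X \<subseteq> sub_verts G B \<and> X \<noteq> {}" if X: "X \<in> ?q B" for B X
  proof -
    obtain v where v: "v \<in> sub_verts G B" "X = (sub_rel G B)\<^sup>* `` {v}" using X by (rule quotientE)
    have "w \<in> sub_verts G B" if "(v, w) \<in> (sub_rel G B)\<^sup>*" for w
      using that by (induction rule: rtrancl_induct) (use v in \<open>auto dest: sub_adj_verts\<close>)
    then show ?thesis using v by auto
  qed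
  have "?q A \<inter> ?q (U - A) = {}"
    using sub sub_verts_split(2)[OF A] by blast
  moreover have "finite A" using A fin finite_subset by (auto simp: closed_in_def)
  then have "finite (?q A)" "finite (?q (U - A))"
    using fin finite_sub_verts unfolding quotient_def by auto
  ultimately show ?thesis unfolding sub_ncomp_def qU by (simp add: card_Un_disjoint)
qed

text \<open>The variables reachable from a given one form a closed set, hence all of
  \<open>C\<close>, and each inner constraint is adjacent to some variable.\<close>

lemma ncomp_connected:
  assumes C: "connected_in G C"
  shows "sub_ncomp G C = 1"
proof -
  obtain x where x: "x \<in> C" using C by (auto simp: connected_in_def)
  let ?R = "(sub_rel G C)\<^sup>*"
  have adj: "(Inl y, Inr a) \<in> sub_rel G C" "(Inr a, Inl y) \<in> sub_rel G C"
    if "y \<in> nbset G a" "a \<in> inner G C" for y a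
    using that unfolding sub_adj_def inner_def by blast+
  have reach: "(Inl y, Inl z) \<in> ?R" if y: "y \<in> C" and z: "z \<in> C" for y z
  proof -
    define A where "A = {z\<in>C. (Inl y, Inl z) \<in> ?R}"
    have "closed_in G C A"
      unfolding closed_in_def
    proof (intro conjI ballI disjCI subsetI)
      fix a w assume a: "a \<in> inner G C" and "nbset G a \<inter> A \<noteq> {}" and w: "w \<in> nbset G a"
      then obtain v where v: "v \<in> nbset G a" "(Inl y, Inl v) \<in> ?R" by (auto simp: A_def)
      have "(Inl y, Inl w) \<in> ?R"
        using v(2) adj(1)[OF v(1) a] adj(2)[OF w a] by (meson rtrancl_into_rtrancl)
      moreover have "w \<in> C" using a w by (auto simp: inner_def)
      ultimately show "w \<in> A" by (simp add: A_def)
    qed (auto simp: A_def)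
    moreover have "A \<noteq> {}" using y by (auto simp: A_def)
    ultimately have "A = C" using C by (auto simp: connected_in_def)
    then show ?thesis using z by (auto simp: A_def)
  qed
  have to: "\<exists>y\<in>C. (v, Inl y) \<in> ?R \<and> (Inl y, v) \<in> ?R" if "v \<in> sub_verts G C" for v
  proof (cases v)
    case (Inl y)
    then show ?thesis using that by (auto simp: sub_verts_def)
  next
    case (Inr a)
    then have a: "a \<in> inner G C" using that by (auto simp: sub_verts_def)
    obtain y where y: "y \<in> nbset G a" using inner_nonempty[OF a] by blast
    then have "y \<in> C" using a by (auto simp: inner_def)
    then show ?thesis using adj[OF y a] Inr by blast
  qed
  have "?R `` {v} = sub_verts G C" if v: "v \<in> sub_verts G C" for v
  proof
    have "w \<in> sub_verts G C" if "(v, w) \<in> ?R" for w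
      using that by (induction rule: rtrancl_induct) (use v in \<open>auto dest: sub_adj_verts\<close>)
    then show "?R `` {v} \<subseteq> sub_verts G C" by auto
    show "sub_verts G C \<subseteq> ?R `` {v}"
    proof
      fix w assume w: "w \<in> sub_verts G C"
      obtain y z where yz: "y \<in> C" "(v, Inl y) \<in> ?R" "z \<in> C" "(Inl z, w) \<in> ?R"
        using to[OF v] to[OF w] by blast
      then have "(v, w) \<in> ?R" using reach[OF yz(1,3)] by (meson rtrancl_trans)
      then show "w \<in> ?R `` {v}" by simp
    qed
  qed
  moreover have "sub_verts G C \<noteq> {}" using x by (auto simp: sub_verts_def)
  ultimately have "sub_verts G C // ?R = {sub_verts G C}" unfolding quotient_def by auto
  then show ?thesis by (simp add: sub_ncomp_def)
qed

lemma ncomp_empty: "sub_ncomp G {} = 0"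
proof -
  have "inner G {} = {}" using inner_nonempty[of _ "{}"] by (auto simp: inner_def)
  then show ?thesis by (simp add: sub_ncomp_def sub_verts_def quotient_def)
qed

text \<open>Explore \<open>C\<close> from a vertex: each new constraint node contributes at most \<open>k - 1\<close> new variables.\<close>

lemma card_connected:
  assumes C: "connected_in G C" and fin: "finite C"
  shows "card C \<le> 1 + (k - 1) * card (inner G C)"
proof -
  obtain x where x: "x \<in> C" using C by (auto simp: connected_in_def)
  let ?V = "\<lambda>X. insert x (\<Union>a\<in>X. nbset G a)"
  define XS where "XS = {X. X \<subseteq> inner G C \<and> card (?V X) \<le> 1 + (k - 1) * card X}"
  have finXS: "finite XS" unfolding XS_def by (rule finite_subset[of _ "Pow (inner G C)"]) auto
  have "{} \<in> XS" by (simp add: XS_def)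
  then obtain X where X: "X \<in> XS" and max: "\<And>X'. X' \<in> XS \<Longrightarrow> X \<subseteq> X' \<Longrightarrow> X = X'"
    using finite_has_maximal[OF finXS] by blast
  have Xin: "X \<subseteq> inner G C" and cX: "card (?V X) \<le> 1 + (k - 1) * card X" using X by (auto simp: XS_def)
  have finX: "finite X" using Xin finite_subset by (metis finite_inner)
  have VC: "?V X \<subseteq> C" using x Xin by (auto simp: inner_def)
  have finV: "finite (?V X)" by (rule finite_subset[OF VC fin])
  \<comment> \<open>If the explored set were not closed, some constraint would leave it. That
    constraint already meets it and adds at most k - 1 variables, which contradicts the maximality
    of \<open>X\<close>.\<close>
  have "closed_in G C (?V X)"
  proof (rule ccontr)
    assume "\<not> ?thesis"
    then obtain a where a: "a \<in> inner G C" "\<not> nbset G a \<subseteq> ?V X" "nbset G a \<inter> ?V X \<noteq> {}"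
      using VC unfolding closed_in_def by blast
    have "a \<notin> X" using a by blast
    have af: "a \<in> facs G" using a by (simp add: inner_def)
    have finb: "finite (nbset G a)" by (simp add: nbset_def)
    have "?V (insert a X) = ?V X \<union> (nbset G a - ?V X)" by auto
    then have "card (?V (insert a X)) = card (?V X \<union> (nbset G a - ?V X))" by (rule arg_cong)
    also have "\<dots> = card (?V X) + card (nbset G a - ?V X)"
      by (rule card_Un_disjoint) (use finV finb in auto)
    also have "card (nbset G a - ?V X) \<le> k - 1"
    proof -
      have "card (nbset G a - ?V X) < card (nbset G a)"
        using a finb by (intro psubset_card_mono) auto
      then show ?thesis using card_nbset[OF af] by linarith
    qed
    finally have "card (?V (insert a X)) \<le> 1 + (k - 1) * card (insert a X)"
      using cX \<open>a \<notin> X\<close> finX by simp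
    then have "insert a X \<in> XS" using a Xin by (simp add: XS_def)
    then have "X = insert a X" using max by blast
    then show False using \<open>a \<notin> X\<close> by blast
  qed
  then have "?V X = C" using C by (auto simp: connected_in_def)
  then have "card C \<le> 1 + (k - 1) * card X" using cX by simp
  also have "\<dots> \<le> 1 + (k - 1) * card (inner G C)"
    using card_mono[OF finite_inner Xin] by simp
  finally show ?thesis .
qed

lemma inner_split:
  assumes "closed_in G U A"
  shows "inner G U = inner G A \<union> inner G (U - A)" "inner G A \<inter> inner G (U - A) = {}"
proof -
  show "inner G U = inner G A \<union> inner G (U - A)" using assms by (auto simp: closed_in_def inner_def)
  have "nbset G a = {}" if "a \<in> inner G A" "a \<in> inner G (U - A)" for a
    using that by (auto simp: inner_def)
  then show "inner G A \<inter> inner G (U - A) = {}" using inner_nonempty by blast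
qed

lemma closed_trans:
  assumes "closed_in G U A" "closed_in G A B"
  shows "closed_in G U B"
  unfolding closed_in_def
proof (intro conjI ballI)
  show "B \<subseteq> U" using assms by (auto simp: closed_in_def)
  fix a assume a: "a \<in> inner G U"
  then consider "nbset G a \<subseteq> A" | "nbset G a \<inter> A = {}" using assms(1) by (auto simp: closed_in_def)
  then show "nbset G a \<subseteq> B \<or> nbset G a \<inter> B = {}"
  proof cases
    case 1
    then have "a \<in> inner G A" using a by (simp add: inner_def)
    then show ?thesis using assms(2) by (simp add: closed_in_def)
  next
    case 2
    then show ?thesis using assms(2) by (auto simp: closed_in_def)
  qed
qed

lemma closed_Un: "closed_in G U A \<Longrightarrow> closed_in G U B \<Longrightarrow> closed_in G U (A \<union> B)"
  unfolding closed_in_def by blast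

text \<open>\<open>B\<close> is the union of the components that attain equality in \<open>card_connected\<close>.\<close>

lemma good_part:
  assumes "finite U"
  shows "\<exists>B. closed_in G U B \<and> card B = sub_ncomp G B + (k - 1) * card (inner G B) \<and>
     card U - (k - 1) * card (inner G U) \<le> sub_ncomp G B"
  using assms
proof (induction "card U" arbitrary: U rule: less_induct)
  case less
  show ?case
  proof (cases "U = {}")
    case True
    then show ?thesis using inner_nonempty[of _ "{}"]
      by (intro exI[of _ "{}"]) (auto simp: closed_in_def ncomp_empty inner_def)
  next
    case False
    \<comment> \<open>A minimal nonempty closed set is a connected component.\<close>
    define CS where "CS = {C. closed_in G U C \<and> C \<noteq> {}}"
    have "finite CS" unfolding CS_def
      by (rule finite_subset[of _ "Pow U"]) (use less.prems in \<open>auto simp: closed_in_def\<close>)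
    moreover have "U \<in> CS" using False by (auto simp: CS_def closed_in_def inner_def)
    ultimately obtain C where C: "C \<in> CS" and min: "\<And>C'. C' \<in> CS \<Longrightarrow> C' \<subseteq> C \<Longrightarrow> C = C'"
      using finite_has_minimal[of CS] by blast
    have clC: "closed_in G U C" "C \<noteq> {}" using C by (auto simp: CS_def)
    have finC: "finite C" using clC less.prems finite_subset by (auto simp: closed_in_def)
    have conn: "connected_in G C"
      unfolding connected_in_def
    proof (intro conjI allI impI)
      fix A assume A: "A \<noteq> {}" "closed_in G C A"
      then have "A \<in> CS" "A \<subseteq> C" using closed_trans[OF clC(1)] by (auto simp: CS_def closed_in_def)
      then show "A = C" using min by blast
    qed fact
    let ?U = "U - C"
    have CU: "C \<subseteq> U" using clC by (simp add: closed_in_def)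
    have "card ?U < card U" using CU clC(2) less.prems by (intro psubset_card_mono) auto
    from less.hyps[OF this] less.prems obtain B where B: "closed_in G ?U B"
      "card B = sub_ncomp G B + (k - 1) * card (inner G B)" "card ?U - (k - 1) * card (inner G ?U) \<le> sub_ncomp G B"
      by auto
    have clU: "closed_in G U ?U" by (rule closed_compl[OF clC(1)])
    have clB: "closed_in G U B" by (rule closed_trans[OF clU B(1)])
    have cU: "card U = card C + card ?U" using CU less.prems finC by (simp add: card_Diff_subset card_mono)
    have iU: "card (inner G U) = card (inner G C) + card (inner G ?U)"
      using inner_split[OF clC(1)] by (simp add: card_Un_disjoint)
    have le: "card C \<le> 1 + (k - 1) * card (inner G C)" by (rule card_connected[OF conn finC])
    show ?thesis
    proof (cases "card C = 1 + (k - 1) * card (inner G C)")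
      case False
      \<comment> \<open>\<open>C\<close> misses equality, so it contributes at most 0 to the
        left-hand side and is left out of \<open>B\<close>.\<close>
      then have "card U - (k - 1) * card (inner G U) \<le> sub_ncomp G B"
        using B(3) le unfolding cU iU distrib_left by linarith
      then show ?thesis using clB B(2) by blast
    next
      case True
      have disj: "B \<inter> C = {}" "(B \<union> C) - C = B" using B(1) by (auto simp: closed_in_def)
      have finB: "finite (B \<union> C)" using B(1) finC less.prems finite_subset by (auto simp: closed_in_def)
      have cl: "closed_in G U (B \<union> C)" by (rule closed_Un[OF clB clC(1)])
      have cl': "closed_in G (B \<union> C) C"
        using clC(1) cl unfolding closed_in_def inner_def by blast
      have "sub_ncomp G (B \<union> C) = 1 + sub_ncomp G B"
        using sub_ncomp_add[OF cl' finB] ncomp_connected[OF conn] disj by simp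
      moreover have "card (inner G (B \<union> C)) = card (inner G C) + card (inner G B)"
        using inner_split[OF cl'] disj by (simp add: card_Un_disjoint)
      moreover have "card (B \<union> C) = card B + card C" using finB disj by (simp add: card_Un_disjoint)
      ultimately show ?thesis
        using B(2,3) True cl unfolding cU iU distrib_left
        by (intro exI[of _ "B \<union> C"]) (simp add: distrib_left)
    qed
  qed
qed

end

section \<open>Tree components of the factor graph and replacements within cavities\<close>

definition isolated :: "nat \<Rightarrow> 'o fg \<Rightarrow> nat set \<Rightarrow> bool" where
  "isolated n G U \<longleftrightarrow> U \<subseteq> {..<n} \<and> (\<forall>a\<in>facs G. nbset G a \<subseteq> U \<or> nbset G a \<inter> U = {})"

text \<open>Whole components that are trees, represented by their variable sets.\<close>

definition blobs :: "nat \<Rightarrow> 'o fg \<Rightarrow> nat \<Rightarrow> nat set set" where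
  "blobs n G s = {T. isolated n G T \<and> card T = s \<and> connected_in G T \<and> sub_acyclic G T}"

context valid_graph
begin

lemma isolated_cases: "isolated n G A \<Longrightarrow> a \<in> facs G \<Longrightarrow> nbset G a \<subseteq> A \<or> nbset G a \<inter> A = {}"
  by (simp add: isolated_def)

lemma isolated_Un:
  assumes "isolated n G A" "isolated n G B"
  shows "isolated n G (A \<union> B)"
  unfolding isolated_def
proof (intro conjI ballI)
  show "A \<union> B \<subseteq> {..<n}" using assms by (auto simp: isolated_def)
  fix a assume a: "a \<in> facs G"
  show "nbset G a \<subseteq> A \<union> B \<or> nbset G a \<inter> (A \<union> B) = {}"
    using isolated_cases[OF assms(1) a] isolated_cases[OF assms(2) a] by auto
qed

lemma isolated_finite: "isolated n G A \<Longrightarrow> finite A"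
  using finite_subset[of A "{..<n}"] by (auto simp: isolated_def)

lemma isolated_closed: "isolated n G A \<Longrightarrow> A \<subseteq> U \<Longrightarrow> closed_in G U A"
  by (auto simp: isolated_def closed_in_def inner_def)

lemma blobs_disjoint:
  assumes "T \<in> blobs n G s" "T' \<in> blobs n G s'" "T \<inter> T' \<noteq> {}"
  shows "T = T'"
proof -
  have "T \<inter> T' = T" if "isolated n G T'" "connected_in G T" "T \<inter> T' \<noteq> {}" for T T'
  proof -
    have "closed_in G T (T \<inter> T')"
      unfolding closed_in_def
    proof (intro conjI ballI)
      fix a assume "a \<in> inner G T"
      then have "a \<in> facs G" "nbset G a \<subseteq> T" by (auto simp: inner_def)
      then show "nbset G a \<subseteq> T \<inter> T' \<or> nbset G a \<inter> (T \<inter> T') = {}"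
        using isolated_cases[OF that(1)] by auto
    qed simp
    then show ?thesis using that by (auto simp: connected_in_def)
  qed
  from this[of T' T] this[of T T'] show ?thesis using assms by (auto simp: blobs_def Int_commute)
qed

lemma finite_blobs: "finite (blobs n G s)"
  by (rule finite_subset[of _ "Pow {..<n}"]) (auto simp: blobs_def isolated_def)

text \<open>Different components are disjoint, so each one that meets \<open>X\<close> uses up an
  element of \<open>X\<close> of its own.\<close>

lemma card_meeting_blobs:
  assumes "finite X"
  shows "card {T\<in>blobs n G s. T \<inter> X \<noteq> {}} \<le> card X"
proof -
  have "\<forall>T\<in>{T\<in>blobs n G s. T \<inter> X \<noteq> {}}. \<exists>x. x \<in> T \<inter> X" by blast
  from bchoice[OF this] obtain g where g: "\<And>T. T \<in> {T\<in>blobs n G s. T \<inter> X \<noteq> {}} \<Longrightarrow> g T \<in> T \<inter> X" by blast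
  have "inj_on g {T\<in>blobs n G s. T \<inter> X \<noteq> {}}"
  proof (rule inj_onI)
    fix T T' assume T: "T \<in> {T\<in>blobs n G s. T \<inter> X \<noteq> {}}" "T' \<in> {T\<in>blobs n G s. T \<inter> X \<noteq> {}}" "g T = g T'"
    then have "g T \<in> T \<inter> T'" using g[OF T(1)] g[OF T(2)] by auto
    then show "T = T'" using T by (intro blobs_disjoint) auto
  qed
  moreover have "g ` {T\<in>blobs n G s. T \<inter> X \<noteq> {}} \<subseteq> X" using g by blast
  ultimately show ?thesis using assms by (rule card_inj_on_le)
qed

text \<open>Adjacency does not leave a closed part, so a cycle that starts there stays
  there.\<close>

lemma cycle_in_closed:
  assumes A: "closed_in G U A" and vs: "\<forall>i<length vs. sub_adj G U (vs ! i) (vs ! ((i + 1) mod length vs))"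
    and "vs ! 0 \<in> sub_verts G A" and "vs \<noteq> []"
  shows "\<forall>i<length vs. sub_adj G A (vs ! i) (vs ! ((i + 1) mod length vs))"
proof -
  have mem: "i < length vs \<Longrightarrow> vs ! i \<in> sub_verts G A" for i
  proof (induction i)
    case (Suc i)
    then have "sub_adj G U (vs ! i) (vs ! Suc i)" "vs ! i \<in> sub_verts G A" using vs[rule_format, of i] by auto
    from sub_adj_verts[OF closed_adj[OF A this(2,1)]] show ?case by simp
  qed (use assms in simp)
  then show ?thesis using closed_adj[OF A] vs by blast
qed

lemma acyclic_closed:
  assumes A: "closed_in G U A" and ac: "sub_acyclic G A" "sub_acyclic G (U - A)"
  shows "sub_acyclic G U"
  unfolding sub_acyclic_def
proof
  assume "\<exists>vs. length vs \<ge> 3 \<and> distinct vs \<and> (\<forall>i<length vs. sub_adj G U (vs ! i) (vs ! ((i + 1) mod length vs)))"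
  then obtain vs where vs: "length vs \<ge> 3" "distinct vs"
    "\<forall>i<length vs. sub_adj G U (vs ! i) (vs ! ((i + 1) mod length vs))" by blast
  have ne: "vs \<noteq> []" using vs by auto
  have "sub_adj G U (vs ! 0) (vs ! 1)" using ne vs(1) vs(3)[rule_format, of 0] by simp
  then have "vs ! 0 \<in> sub_verts G A \<or> vs ! 0 \<in> sub_verts G (U - A)"
    using sub_adj_verts sub_verts_split(1)[OF A] by blast
  then show False
    using cycle_in_closed[OF A vs(3) _ ne] cycle_in_closed[OF closed_compl[OF A] vs(3) _ ne] ac vs(1,2)
    unfolding sub_acyclic_def by blast
qed

lemma acyclic_subset: "A \<subseteq> U \<Longrightarrow> sub_acyclic G U \<Longrightarrow> sub_acyclic G A"
  unfolding sub_acyclic_def using sub_adj_mono by blast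

lemma acyclic_empty: "sub_acyclic G {}"
proof -
  have "\<not> sub_adj G {} v w" for v w by (simp add: sub_adj_def)
  then show ?thesis unfolding sub_acyclic_def by (metis not_numeral_le_zero not_gr_zero)
qed

lemma singletons:
  assumes "finite X" "\<And>x. x \<in> X \<Longrightarrow> {x} \<in> blobs n G 1"
  shows "isolated n G X \<and> sub_ncomp G X = card X \<and> sub_acyclic G X"
  using assms
proof (induction X rule: finite_induct)
  case empty
  then show ?case by (auto simp: isolated_def ncomp_empty acyclic_empty)
next
  case (insert x X)
  have x: "{x} \<in> blobs n G 1" and X: "isolated n G X \<and> sub_ncomp G X = card X \<and> sub_acyclic G X"
    using insert by auto
  have cl: "closed_in G (insert x X) {x}" using x by (intro isolated_closed) (auto simp: blobs_def)
  have d: "insert x X - {x} = X" using insert by auto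
  have "sub_ncomp G (insert x X) = sub_ncomp G {x} + sub_ncomp G X"
    using sub_ncomp_add[OF cl] insert d by simp
  moreover have "sub_acyclic G (insert x X)" using acyclic_closed[OF cl] x X d by (simp add: blobs_def)
  moreover have "isolated n G (insert x X)" using isolated_Un[of "{x}" X] x X by (simp add: blobs_def)
  ultimately show ?case using x X insert ncomp_connected[of "{x}"] by (simp add: blobs_def)
qed

text \<open>An isolated \<open>D\<close> has no boundary constraints. Deleting the closed part
  \<open>B\<close> exposes none either: a constraint meeting both \<open>B\<close> and the rest of
  \<open>U\<close> cannot lie inside \<open>U\<close>, as \<open>B\<close> is closed, and otherwise
  it is excluded by CAV2.\<close>

lemma cavity_replace:
  assumes U: "cavity G U" and B: "closed_in G U B" and D: "isolated n G D" "sub_acyclic G D" "D \<inter> U = {}"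
    and ne: "D \<noteq> {}"
  shows "cavity G ((U - B) \<union> D)" "sub_ncomp G ((U - B) \<union> D) = sub_ncomp G (U - B) + sub_ncomp G D"
proof -
  let ?U = "(U - B) \<union> D"
  have UV: "U \<subseteq> {..<n}" using U by (simp add: cavity_def vars_G)
  have finU: "finite ?U" using finite_subset[OF UV] isolated_finite[OF D(1)] by auto
  have cl: "closed_in G ?U D" using D by (intro isolated_closed) auto
  have d: "?U - D = U - B" using D(3) by auto
  show "sub_ncomp G ?U = sub_ncomp G (U - B) + sub_ncomp G D"
    using sub_ncomp_add[OF cl finU] d by simp
  have "sub_acyclic G (U - B)" using U by (intro acyclic_subset[of "U - B" U]) (auto simp: cavity_def)
  then have ac: "sub_acyclic G ?U" using acyclic_closed[OF cl] D d by simp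
  have iso: "nbset G a \<subseteq> D \<or> nbset G a \<inter> D = {}" if "a \<in> facs G" for a
    using D that by (auto simp: isolated_def)
  have cav1: "card (nbset G a \<inter> U) \<le> 1" if "a \<in> facs G" "\<not> nbset G a \<subseteq> U" for a
    using U that by (auto simp: cavity_def)
  have cav2: "nbset G a \<inter> nbset G b - U = {}"
    if "a \<in> facs G" "b \<in> facs G" "a \<noteq> b" "nbset G a \<inter> U \<noteq> {}" "nbset G b \<inter> U \<noteq> {}" for a b
    using U that by (auto simp: cavity_def)
  have clB: "nbset G a \<subseteq> B \<or> nbset G a \<inter> B = {}" if "a \<in> facs G" "nbset G a \<subseteq> U" for a
    using B that by (auto simp: closed_in_def inner_def)
  have c1: "card (nbset G a \<inter> ?U) \<le> 1" if a: "a \<in> facs G" and na: "\<not> nbset G a \<subseteq> ?U" for a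
  proof -
    have i: "nbset G a \<inter> ?U = nbset G a \<inter> (U - B)" using iso[OF a] na by auto
    show ?thesis
    proof (cases "nbset G a \<subseteq> U")
      case True
      then have "nbset G a \<inter> (U - B) = {}" using clB[OF a True] na by auto
      then show ?thesis using i by simp
    next
      case False
      have "card (nbset G a \<inter> (U - B)) \<le> card (nbset G a \<inter> U)"
        by (intro card_mono) (auto simp: nbset_def)
      then show ?thesis using cav1[OF a False] i by simp
    qed
  qed
  have away: "nbset G a \<inter> B = {}" if a: "a \<in> facs G" and t: "nbset G a \<inter> (U - B) \<noteq> {}" for a
  proof (cases "nbset G a \<subseteq> U")
    case True
    then show ?thesis using clB[OF a True] t by auto
  next
    case False
    show ?thesis
    proof (rule ccontr)
      assume "nbset G a \<inter> B \<noteq> {}"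
      then obtain x y where xy: "x \<in> nbset G a \<inter> (U - B)" "y \<in> nbset G a \<inter> B" using t by blast
      then have "{x, y} \<subseteq> nbset G a \<inter> U" "x \<noteq> y" using B by (auto simp: closed_in_def)
      then have "2 \<le> card (nbset G a \<inter> U)"
        using card_mono[of "nbset G a \<inter> U" "{x, y}"] by (simp add: nbset_def)
      then show False using cav1[OF a False] by simp
    qed
  qed
  have c2: "nbset G a \<inter> nbset G b - ?U = {}"
    if ab: "a \<in> facs G" "b \<in> facs G" "a \<noteq> b" and t: "nbset G a \<inter> ?U \<noteq> {}" "nbset G b \<inter> ?U \<noteq> {}" for a b
  proof (cases "nbset G a \<inter> D = {} \<and> nbset G b \<inter> D = {}")
    case True
    then have tt: "nbset G a \<inter> (U - B) \<noteq> {}" "nbset G b \<inter> (U - B) \<noteq> {}" using t by auto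
    then have "nbset G a \<inter> nbset G b - U = {}" using cav2[OF ab] by blast
    then show ?thesis using away[OF ab(1) tt(1)] by blast
  next
    case False
    then show ?thesis using iso[OF ab(1)] iso[OF ab(2)] by blast
  qed
  show "cavity G ?U"
    unfolding cavity_def vars_G using ac c1 c2 ne D(1) UV
    by (auto simp: isolated_def)
qed

text \<open>The part \<open>B\<close> with \<open>p\<close> components and \<open>f\<close> inner
  constraints has p + (k - 1) f vertices. One tree of size 1 + (k - 1) f together with p - 1 single
  vertices has the same size and also \<open>p\<close> components. Exchanging \<open>B\<close> for
  such a family keeps l and r and leaves \<open>p\<close> free choices.\<close>

lemma card_cavities:
  assumes U\<^sub>0: "U\<^sub>0 \<in> cav_set G l r" and l: "1 \<le> l"
    and N: "\<And>f. f \<le> l \<Longrightarrow> N \<le> card (blobs n G (1 + (k - 1) * f))" and large: "3 * l \<le> N" and k2: "2 \<le> k"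
  shows "(real (N - 2 * l) / real l) ^ (l - (k - 1) * card (inner G U\<^sub>0)) \<le> 4 ^ l * real (card (cav_set G l r))"
proof -
  have cav: "cavity G U\<^sub>0" and cU: "card U\<^sub>0 = l" and rU: "sub_ncomp G U\<^sub>0 = r" using U\<^sub>0 by (auto simp: cav_set_def)
  have UV: "U\<^sub>0 \<subseteq> {..<n}" using cav by (simp add: cavity_def vars_G)
  have finU: "finite U\<^sub>0" using finite_subset[OF UV] by simp
  have finC: "finite (cav_set G l r)"
    by (rule finite_subset[of _ "Pow {..<n}"]) (auto simp: cav_set_def cavity_def vars_G)
  obtain B where B: "closed_in G U\<^sub>0 B" "card B = sub_ncomp G B + (k - 1) * card (inner G B)"
    "l - (k - 1) * card (inner G U\<^sub>0) \<le> sub_ncomp G B"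
    using good_part[OF finU] cU by blast
  define p where "p = sub_ncomp G B"
  define f where "f = card (inner G B)"
  have BU: "B \<subseteq> U\<^sub>0" using B by (simp add: closed_in_def)
  have finB: "finite B" using BU finU finite_subset by blast
  have cB: "card B = p + (k - 1) * f" "card B \<le> l" using B(2) card_mono[OF finU BU] cU by (auto simp: p_def f_def)
  have base: "1 \<le> real (N - 2 * l) / real l" using large l by simp
  have cav1: "1 \<le> card (cav_set G l r)" using U\<^sub>0 finC by (simp add: Suc_le_eq card_gt_0_iff) blast
  show ?thesis
  proof (cases "p = 0")
    case True
    then have "l - (k - 1) * card (inner G U\<^sub>0) = 0" using B(3) by (simp add: p_def)
    moreover have "(1 :: real) \<le> 4 ^ l * real (card (cav_set G l r))"
      using mult_mono[of "1 :: real" "4 ^ l" 1 "real (card (cav_set G l r))"] cav1 by simp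
    ultimately show ?thesis by simp
  next
    case False
    have fl: "f \<le> l"
    proof -
      have "f \<le> (k - 1) * f" using k2 by (cases "k - 1") auto
      then show ?thesis using cB by linarith
    qed
    define s where "s = 1 + (k - 1) * f"
    have sl: "s \<le> l" using cB False by (simp add: s_def)
    \<comment> \<open>The tree has to avoid the old cavity; the single vertices avoid both the old
      cavity and the tree.\<close>
    define TT where "TT = {T\<in>blobs n G s. T \<inter> U\<^sub>0 = {}}"
    define IV where "IV T = {x. {x} \<in> blobs n G 1 \<and> x \<notin> U\<^sub>0 \<union> T}" for T
    define VV where "VV T = {X. X \<subseteq> IV T \<and> card X = p - 1}" for T
    have finTT: "finite TT" using finite_blobs by (simp add: TT_def)
    have finIV: "finite (IV T)" for T
      by (rule finite_subset[of _ "{..<n}"]) (auto simp: IV_def blobs_def isolated_def)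
    have finVV: "finite (VV T)" for T
      by (rule finite_subset[of _ "Pow (IV T)"]) (auto simp: VV_def finIV)
    \<comment> \<open>The old cavity blocks at most \<open>l\<close> trees; further below, cavity
      and tree together block at most 2 l single vertices.\<close>
    have cTT: "N - 2 * l \<le> card TT"
    proof -
      have "blobs n G s = TT \<union> {T\<in>blobs n G s. T \<inter> U\<^sub>0 \<noteq> {}}" by (auto simp: TT_def)
      then have "card (blobs n G s) = card (TT \<union> {T\<in>blobs n G s. T \<inter> U\<^sub>0 \<noteq> {}})" by (rule arg_cong)
      also have "\<dots> \<le> card TT + card {T\<in>blobs n G s. T \<inter> U\<^sub>0 \<noteq> {}}" by (rule card_Un_le)
      finally have "card (blobs n G s) \<le> card TT + card {T\<in>blobs n G s. T \<inter> U\<^sub>0 \<noteq> {}}" .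
      then show ?thesis using card_meeting_blobs[OF finU, of s] N[OF fl] cU by (simp add: s_def)
    qed
    have cIV: "N - 2 * l \<le> card (IV T)" if T: "T \<in> TT" for T
    proof -
      have finT: "finite T" "card T = s" using T isolated_finite by (auto simp: TT_def blobs_def)
      have "blobs n G 1 \<subseteq> (\<lambda>x. {x}) ` (IV T) \<union> {T'\<in>blobs n G 1. T' \<inter> (U\<^sub>0 \<union> T) \<noteq> {}}"
      proof
        fix T' assume T': "T' \<in> blobs n G 1"
        then obtain x where x: "T' = {x}" by (auto simp: blobs_def card_1_singleton_iff)
        then show "T' \<in> (\<lambda>x. {x}) ` (IV T) \<union> {T'\<in>blobs n G 1. T' \<inter> (U\<^sub>0 \<union> T) \<noteq> {}}"
          using T' by (auto simp: IV_def)
      qed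
      then have "card (blobs n G 1) \<le> card ((\<lambda>x. {x}) ` (IV T) \<union> {T'\<in>blobs n G 1. T' \<inter> (U\<^sub>0 \<union> T) \<noteq> {}})"
        using finIV finite_blobs by (intro card_mono) auto
      also have "\<dots> \<le> card ((\<lambda>x. {x}) ` (IV T)) + card {T'\<in>blobs n G 1. T' \<inter> (U\<^sub>0 \<union> T) \<noteq> {}}" by (rule card_Un_le)
      also have "card ((\<lambda>x. {x}) ` (IV T)) \<le> card (IV T)" using finIV by (rule card_image_le)
      also have "card {T'\<in>blobs n G 1. T' \<inter> (U\<^sub>0 \<union> T) \<noteq> {}} \<le> card (U\<^sub>0 \<union> T)"
        using finU finT by (intro card_meeting_blobs) auto
      also have "card (U\<^sub>0 \<union> T) \<le> 2 * l" using card_Un_le[of U\<^sub>0 T] cU finT sl by linarith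
      finally show ?thesis using N[of 0] by simp
    qed
    have cVV: "(real (N - 2 * l) / real l) ^ (p - 1) \<le> real (card (VV T))" if T: "T \<in> TT" for T
    \<comment> \<open>There are then no single vertices to choose. The case is separate because the
      binomial estimate divides by p - 1.\<close>
    proof (cases "p = 1")
      case True
      have "VV T = {{}}" using finIV finite_subset by (fastforce simp: VV_def True)
      then show ?thesis using True by simp
    next
      case False
      have pl: "p - 1 \<le> l" using cB by simp
      have le: "p - 1 \<le> card (IV T)" using cIV[OF T] pl large by linarith
      have "real (N - 2 * l) / real l \<le> real (card (IV T)) / real (p - 1)"
        using cIV[OF T] pl False \<open>p \<noteq> 0\<close> by (intro frac_le) auto
      then have "(real (N - 2 * l) / real l) ^ (p - 1) \<le> (real (card (IV T)) / real (p - 1)) ^ (p - 1)"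
        by (intro power_mono) auto
      also have "\<dots> \<le> real (card (IV T) choose (p - 1))" by (rule binomial_ge_n_over_k_pow_k[OF le])
      also have "card (IV T) choose (p - 1) = card (VV T)"
        unfolding VV_def by (rule n_subsets[OF finIV, symmetric])
      finally show ?thesis .
    qed
    let ?\<Phi> = "\<lambda>T X. (U\<^sub>0 - B) \<union> (X \<union> T)"
    have mem: "?\<Phi> T X \<in> cav_set G l r" if T: "T \<in> TT" and X: "X \<in> VV T" for T X
    proof -
      have T': "isolated n G T" "card T = s" "connected_in G T" "sub_acyclic G T" "T \<inter> U\<^sub>0 = {}" "T \<noteq> {}"
        using T by (auto simp: TT_def blobs_def connected_in_def)
      have X': "X \<subseteq> IV T" "card X = p - 1" "finite X" using X finIV finite_subset by (auto simp: VV_def)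
      have sX: "isolated n G X" "sub_ncomp G X = p - 1" "sub_acyclic G X" using singletons[of X] X' by (auto simp: IV_def)
      have disj: "X \<inter> T = {}" "X \<inter> U\<^sub>0 = {}" using X' by (auto simp: IV_def)
      have d: "X \<union> T - X = T" using disj by auto
      have iso: "isolated n G (X \<union> T)" by (rule isolated_Un[OF sX(1) T'(1)])
      have cl: "closed_in G (X \<union> T) X" by (rule isolated_closed[OF sX(1)]) simp
      have nD: "sub_ncomp G (X \<union> T) = p"
        using sub_ncomp_add[OF cl isolated_finite[OF iso]] d sX ncomp_connected[OF T'(3)] False by simp
      have aD: "sub_acyclic G (X \<union> T)" using acyclic_closed[OF cl] d sX T' by simp
      have DU: "(X \<union> T) \<inter> U\<^sub>0 = {}" using disj T' by auto
      have neD: "X \<union> T \<noteq> {}" using T' by auto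
      note rep = cavity_replace[OF cav B(1) iso aD DU neD]
      have "card (X \<union> T) = card B"
        using disj X' isolated_finite[OF T'(1)] T'(2) cB False by (simp add: card_Un_disjoint s_def)
      then have "card (?\<Phi> T X) = card U\<^sub>0"
        using DU BU finU finB isolated_finite[OF iso] card_mono[OF finU BU]
        by (subst card_Un_disjoint) (auto simp: card_Diff_subset)
      moreover have "sub_ncomp G U\<^sub>0 = p + sub_ncomp G (U\<^sub>0 - B)"
        using sub_ncomp_add[OF B(1) finU] by (simp add: p_def)
      ultimately show ?thesis using rep nD cU rU by (simp add: cav_set_def)
    qed
    \<comment> \<open>The pair (T, X) need not be recoverable from the new cavity, but both are
      subsets of it, so each cavity arises from at most 4^l pairs.\<close>
    have "inj_on (\<lambda>(T, X). (?\<Phi> T X, T, X)) (Sigma TT VV)" by (auto simp: inj_on_def)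
    moreover have "(\<lambda>(T, X). (?\<Phi> T X, T, X)) ` Sigma TT VV \<subseteq> (SIGMA U:cav_set G l r. Pow U \<times> Pow U)"
      using mem by auto
    moreover have finp: "finite (SIGMA U:cav_set G l r. Pow U \<times> Pow U)"
    proof (rule finite_SigmaI[OF finC])
      fix U assume "U \<in> cav_set G l r"
      then have "finite U" using finite_subset[of U "{..<n}"] by (auto simp: cav_set_def cavity_def vars_G)
      then show "finite (Pow U \<times> Pow U)" by simp
    qed
    ultimately have "card (Sigma TT VV) \<le> card (SIGMA U:cav_set G l r. Pow U \<times> Pow U)"
      by (rule card_inj_on_le)
    also have "\<dots> = (\<Sum>U\<in>cav_set G l r. card (Pow U \<times> Pow U))"
    proof (intro card_SigmaI finC ballI)
      fix U assume "U \<in> cav_set G l r"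
      then have "finite U" using finite_subset[of U "{..<n}"] by (auto simp: cav_set_def cavity_def vars_G)
      then show "finite (Pow U \<times> Pow U)" by simp
    qed
    also have "\<dots> = (\<Sum>U\<in>cav_set G l r. 4 ^ l)"
    proof (intro sum.cong refl)
      fix U assume "U \<in> cav_set G l r"
      then have "finite U" "card U = l"
        using finite_subset[of U "{..<n}"] by (auto simp: cav_set_def cavity_def vars_G)
      then show "card (Pow U \<times> Pow U) = 4 ^ l"
        by (simp add: card_cartesian_product card_Pow power_mult_distrib[symmetric])
    qed
    also have "\<dots> = 4 ^ l * card (cav_set G l r)" by (simp only: sum_constant mult.commute of_nat_id)
    finally have "real (card (Sigma TT VV)) \<le> real (4 ^ l * card (cav_set G l r))" by (rule of_nat_mono)
    then have up: "real (card (Sigma TT VV)) \<le> 4 ^ l * real (card (cav_set G l r))"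
      by (simp only: of_nat_mult of_nat_power of_nat_numeral)
    have "(real (N - 2 * l) / real l) ^ p = (real (N - 2 * l) / real l) * (real (N - 2 * l) / real l) ^ (p - 1)"
      using False by (metis power_eq_if)
    also have "\<dots> \<le> real (card TT) * (real (N - 2 * l) / real l) ^ (p - 1)"
    proof (rule mult_right_mono)
      have "real (N - 2 * l) / real l \<le> real (N - 2 * l) / 1" using l by (intro frac_le) auto
      then show "real (N - 2 * l) / real l \<le> real (card TT)" using cTT by simp
    qed (use base in simp)
    also have "\<dots> = (\<Sum>T\<in>TT. (real (N - 2 * l) / real l) ^ (p - 1))" by simp
    also have "\<dots> \<le> (\<Sum>T\<in>TT. real (card (VV T)))" by (intro sum_mono cVV)
    also have "\<dots> = real (card (Sigma TT VV))" using finTT finVV by (simp add: card_SigmaI)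
    finally have "(real (N - 2 * l) / real l) ^ p \<le> 4 ^ l * real (card (cav_set G l r))" using up by linarith
    moreover have "(real (N - 2 * l) / real l) ^ (l - (k - 1) * card (inner G U\<^sub>0)) \<le> (real (N - 2 * l) / real l) ^ p"
      by (rule power_increasing[OF B(3)[folded p_def] base])
    ultimately show ?thesis by linarith
  qed
qed

end

section \<open>Isolated stars\<close>

text \<open>The star on \<open>T\<close> with centre \<open>Min T\<close> and the other vertices cut, in increasing order,
  into \<open>f\<close> blocks of length \<open>k - 1\<close>.\<close>

definition star_on :: "nat \<Rightarrow> nat \<Rightarrow> nat set \<Rightarrow> nat list list" where
  "star_on k f T = map (\<lambda>j. hd (sorted_list_of_set T) #
     take (k - 1) (drop (j * (k - 1)) (tl (sorted_list_of_set T)))) [0..<f]"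

text \<open>The constraints touching \<open>T\<close> must read the blocks literally and in the
  order of their indices. This makes the event a single value of the touching list, while the
  expected count stays linear. For \<open>f = 0\<close> it says that the one vertex lies in no
  constraint.\<close>

definition stars :: "nat \<Rightarrow> nat \<Rightarrow> nat \<Rightarrow> (nat list \<times> ('o list \<Rightarrow> real)) list \<Rightarrow> nat set set" where
  "stars n k f cs = {T. T \<subseteq> {..<n} \<and> card T = 1 + (k - 1) * f \<and>
     map fst (filter (\<lambda>c. \<not> avoid T c) cs) = star_on k f T}"

context
  fixes k f :: nat and T :: "nat set"
  assumes T: "finite T" "card T = 1 + (k - 1) * f" and k: "2 \<le> k"
begin

abbreviation "centre \<equiv> hd (sorted_list_of_set T)"
abbreviation "leaves \<equiv> tl (sorted_list_of_set T)"

lemma T_list: "sorted_list_of_set T = centre # leaves"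
proof -
  have "length (sorted_list_of_set T) \<noteq> 0" using T by simp
  then show ?thesis by (metis list.collapse list.size(3))
qed

lemma T_facts: "T = insert centre (set leaves)" "centre \<notin> set leaves" "distinct leaves" "length leaves = (k - 1) * f"
proof -
  have "set (centre # leaves) = T" "distinct (centre # leaves)" "length (centre # leaves) = card T"
    unfolding T_list[symmetric] using T(1) by simp_all
  then show "T = insert centre (set leaves)" "centre \<notin> set leaves" "distinct leaves" "length leaves = (k - 1) * f"
    using T(2) by auto
qed

lemma length_star_on: "length (star_on k f T) = f"
  by (simp add: star_on_def)

lemma block_le: "j < f \<Longrightarrow> j * (k - 1) + (k - 1) \<le> (k - 1) * f"
proof -
  assume "j < f"
  then have "Suc j * (k - 1) \<le> f * (k - 1)" by (intro mult_right_mono) auto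
  then show ?thesis by (simp add: mult.commute)
qed

lemma star_on_nth:
  assumes j: "j < f"
  shows "set (star_on k f T ! j) = insert centre {leaves ! (j * (k - 1) + t) |t. t < k - 1}"
    "length (star_on k f T ! j) = k"
proof -
  let ?d = "k - 1"
  have le: "j * ?d + ?d \<le> length leaves" using block_le[OF j] T_facts(4) by simp
  have "set (take ?d (drop (j * ?d) leaves)) = {leaves ! (j * ?d + t) |t. t < ?d}"
  proof -
    have len: "length (take ?d (drop (j * ?d) leaves)) = ?d" using le by simp
    have nth: "take ?d (drop (j * ?d) leaves) ! t = leaves ! (j * ?d + t)" if "t < ?d" for t
      using that le by simp
    show ?thesis unfolding set_conv_nth len setcompr_eq_image
      by (rule image_cong) (rule refl, rule nth, simp)
  qed
  then show "set (star_on k f T ! j) = insert centre {leaves ! (j * ?d + t) |t. t < ?d}"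
    using j by (simp add: star_on_def)
  show "length (star_on k f T ! j) = k" using j le k by (simp add: star_on_def)
qed

lemma star_on_sub: "xs \<in> set (star_on k f T) \<Longrightarrow> centre \<in> set xs \<and> set xs \<subseteq> T \<and> length xs = k"
proof -
  assume "xs \<in> set (star_on k f T)"
  then obtain j where j: "j < f" "xs = star_on k f T ! j"
    by (auto simp: in_set_conv_nth length_star_on)
  have "j * (k - 1) + t < length leaves" if "t < k - 1" for t
    using block_le[OF j(1)] T_facts(4) that by simp
  then have "{leaves ! (j * (k - 1) + t) |t. t < k - 1} \<subseteq> set leaves" by auto
  then show ?thesis using star_on_nth[OF j(1)] T_facts(1) j(2) by auto
qed

lemma star_on_cover:
  assumes x: "x \<in> T" "x \<noteq> centre"
  shows "\<exists>xs\<in>set (star_on k f T). x \<in> set xs"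
proof -
  have "x \<in> set leaves" using x T_facts(1) by auto
  then obtain i where "i < length leaves" "x = leaves ! i" by (metis in_set_conv_nth)
  then have i: "i < (k - 1) * f" "x = leaves ! i" using T_facts(4) by linarith+
  define j where "j = i div (k - 1)"
  have d: "0 < k - 1" using k by simp
  have j: "j < f" unfolding j_def using i(1) d by (simp add: div_less_iff_less_mult mult.commute)
  have "i = j * (k - 1) + i mod (k - 1)" unfolding j_def by (rule div_mult_mod_eq[symmetric])
  moreover have "i mod (k - 1) < k - 1" using d by simp
  ultimately have "\<exists>t<k - 1. i = j * (k - 1) + t" by blast
  then have "x \<in> {leaves ! (j * (k - 1) + t) |t. t < k - 1}" using i(2) by blast
  then have "x \<in> set (star_on k f T ! j)" using star_on_nth(1)[OF j] by auto
  moreover have "star_on k f T ! j \<in> set (star_on k f T)" using j by (simp add: length_star_on)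
  ultimately show ?thesis by blast
qed

lemma star_on_unique:
  assumes ij: "i < f" "j < f" and x: "x \<in> set (star_on k f T ! i)" "x \<in> set (star_on k f T ! j)" "x \<noteq> centre"
  shows "i = j"
proof -
  obtain t u where tu: "t < k - 1" "u < k - 1" "x = leaves ! (i * (k - 1) + t)" "x = leaves ! (j * (k - 1) + u)"
    using x star_on_nth(1)[OF ij(1)] star_on_nth(1)[OF ij(2)] by auto
  have "i * (k - 1) + t < length leaves" "j * (k - 1) + u < length leaves"
    using block_le[OF ij(1)] block_le[OF ij(2)] T_facts(4) tu(1,2) by linarith+
  then have "i * (k - 1) + t = j * (k - 1) + u"
    using tu T_facts(3) nth_eq_iff_index_eq by metis
  then have "(i * (k - 1) + t) div (k - 1) = (j * (k - 1) + u) div (k - 1)" by simp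
  then show ?thesis using tu by simp
qed

end

text \<open>Locates two different constraint nodes that touch a star at different positions of the
  filtered list, that is, in different blocks of the star.\<close>

lemma filter_nth_mono:
  assumes "a < b" "b < length cs" "Q (cs ! a)" "Q (cs ! b)"
  shows "\<exists>i j. i < j \<and> j < length (filter Q cs) \<and> filter Q cs ! i = cs ! a \<and> filter Q cs ! j = cs ! b"
  using assms
proof (induction cs arbitrary: a b)
  case (Cons c cs)
  obtain b' where b': "b = Suc b'" using Cons.prems by (cases b) auto
  show ?case
  proof (cases a)
    case 0
    have "cs ! b' \<in> set (filter Q cs)" using Cons.prems b' by auto
    then obtain j where "j < length (filter Q cs)" "filter Q cs ! j = cs ! b'" by (auto simp only: in_set_conv_nth)
    then show ?thesis using 0 b' Cons.prems by (intro exI[of _ 0] exI[of _ "Suc j"]) auto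
  next
    case (Suc a')
    then obtain i j where "i < j" "j < length (filter Q cs)" "filter Q cs ! i = cs ! a'" "filter Q cs ! j = cs ! b'"
      using Cons.IH[of a' b'] Cons.prems b' by auto
    note ij = this
    show ?thesis
    proof (cases "Q c")
      case True
      show ?thesis by (rule exI[of _ "Suc i"], rule exI[of _ "Suc j"]) (use True ij Suc b' in auto)
    next
      case False
      show ?thesis by (rule exI[of _ i], rule exI[of _ j]) (use False ij Suc b' in auto)
    qed
  qed
qed simp

text \<open>Length at least 3 makes predecessor and successor on the cycle different.\<close>

lemma cycle_neighbours:
  assumes vs: "3 \<le> length vs" "distinct vs"
    and adj: "\<forall>i<length vs. sub_adj G U (vs ! i) (vs ! ((i + 1) mod length vs))" and i: "i < length vs"
  shows "\<exists>j<length vs. \<exists>j'<length vs. vs ! j \<noteq> vs ! j' \<and> sub_adj G U (vs ! j) (vs ! i) \<and> sub_adj G U (vs ! i) (vs ! j')"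
proof -
  define j where "j = (if i = 0 then length vs - 1 else i - 1)"
  define j' where "j' = (if i + 1 = length vs then 0 else i + 1)"
  have j: "j < length vs" "(j + 1) mod length vs = i" "j' < length vs" "(i + 1) mod length vs = j'" "j \<noteq> j'"
    using vs i by (auto simp: j_def j'_def)
  then have "vs ! j \<noteq> vs ! j'" using vs by (simp add: nth_eq_iff_index_eq)
  then show ?thesis using j adj i by metis
qed

text \<open>Connected through the centre, which every block contains. Acyclic because a leaf lies in
  only one block: every variable on a cycle would have to be the centre, and a constraint on it
  would have the centre on both sides.\<close>

lemma stars_sub_blobs:
  assumes vg: "valid_graph k n c (n, cs)" and k: "2 \<le> k" and TS: "T \<in> stars n k f cs"
  shows "T \<in> blobs n (n, cs) (1 + (k - 1) * f)"
proof -
  let ?G = "(n, cs)"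
  interpret valid_graph k n c ?G by (rule vg)
  have TV: "T \<subseteq> {..<n}" and cT: "card T = 1 + (k - 1) * f"
    and ev: "map fst (filter (\<lambda>c. \<not> avoid T c) cs) = star_on k f T" using TS by (auto simp: stars_def)
  have finT: "finite T" using TV finite_subset by blast
  note ctx = finT cT k
  let ?v = "hd (sorted_list_of_set T)"
  have vT: "?v \<in> T" using T_facts(1)[OF ctx] by blast
  have nb: "nbset ?G a = set (fst (cs ! a))" for a by (simp add: nbset_def nb_def)
  have fac: "a \<in> facs ?G \<longleftrightarrow> a < length cs" for a by (simp add: facs_def)
  have touch: "fst (cs ! a) \<in> set (star_on k f T)" if "a < length cs" "nbset ?G a \<inter> T \<noteq> {}" for a
    unfolding ev[symmetric] using that by (auto simp: avoid_def nb)
  have iso: "nbset ?G a \<subseteq> T \<or> nbset ?G a \<inter> T = {}" if "a \<in> facs ?G" for a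
    using touch[of a] star_on_sub[OF ctx, of "fst (cs ! a)"] that by (auto simp: nb fac)
  have isoT: "isolated n ?G T" unfolding isolated_def using TV iso by blast
  have via: "\<exists>a\<in>inner ?G T. ?v \<in> nbset ?G a \<and> x \<in> nbset ?G a" if x: "x \<in> T" "x \<noteq> ?v" for x
  proof -
    obtain xs where xs: "xs \<in> set (star_on k f T)" "x \<in> set xs" using star_on_cover[OF ctx x] by blast
    then obtain con where "con \<in> set cs" "fst con = xs" unfolding ev[symmetric] by auto
    then obtain a where "a < length cs" "fst (cs ! a) = xs" by (metis in_set_conv_nth)
    then show ?thesis using star_on_sub[OF ctx xs(1)] xs(2) by (intro bexI[of _ a]) (auto simp: nb fac inner_def)
  qed
  have conn: "connected_in ?G T"
    unfolding connected_in_def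
  proof (intro conjI allI impI)
    fix A assume A: "A \<noteq> {}" "closed_in ?G T A"
    then obtain x where x: "x \<in> A" by blast
    have cl: "nbset ?G a \<subseteq> A \<or> nbset ?G a \<inter> A = {}" if "a \<in> inner ?G T" for a
      using A that by (simp add: closed_in_def)
    have AT: "A \<subseteq> T" using A by (simp add: closed_in_def)
    have vA: "?v \<in> A"
    proof (cases "x = ?v")
      case False
      then obtain a where "a \<in> inner ?G T" "?v \<in> nbset ?G a" "x \<in> nbset ?G a" using via[of x] x AT by blast
      then show ?thesis using cl[of a] x by blast
    qed (use x in simp)
    have "y \<in> A" if y: "y \<in> T" for y
    proof (cases "y = ?v")
      case False
      then obtain a where "a \<in> inner ?G T" "?v \<in> nbset ?G a" "y \<in> nbset ?G a" using via[of y] y by blast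
      then show ?thesis using cl[of a] vA by blast
    qed (use vA in simp)
    then show "A = T" using AT by blast
  qed (use vT in blast)
  have uniq: "a = b" if ab: "a \<in> inner ?G T" "b \<in> inner ?G T" and x: "x \<in> nbset ?G a" "x \<in> nbset ?G b" "x \<noteq> ?v" for a b x
  proof (rule ccontr)
    have distinct_idx: "\<not> a < b" if ab: "a \<in> inner ?G T" "b \<in> inner ?G T" and x: "x \<in> nbset ?G a" "x \<in> nbset ?G b" for a b
    proof
      assume lt: "a < b"
      have "b < length cs" using ab by (simp add: inner_def fac)
      moreover have "x \<in> T" using ab x by (auto simp: inner_def)
      then have "\<not> avoid T (cs ! a)" "\<not> avoid T (cs ! b)" using x by (auto simp: avoid_def nb)
      ultimately obtain i j where ij: "i < j" "j < length (filter (\<lambda>c. \<not> avoid T c) cs)"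
        "filter (\<lambda>c. \<not> avoid T c) cs ! i = cs ! a" "filter (\<lambda>c. \<not> avoid T c) cs ! j = cs ! b"
        using filter_nth_mono[of a b cs "\<lambda>c. \<not> avoid T c"] lt by blast
      have len: "length (filter (\<lambda>c. \<not> avoid T c) cs) = f"
        using arg_cong[OF ev, of length] length_star_on[OF ctx] by simp
      have "star_on k f T ! i = fst (cs ! a)" "star_on k f T ! j = fst (cs ! b)"
        unfolding ev[symmetric] using ij by simp_all
      then have "i = j"
        using star_on_unique[OF ctx, of i j x] ij(1,2) len x \<open>x \<noteq> ?v\<close> by (simp add: nb)
      then show False using ij by simp
    qed
    assume "a \<noteq> b"
    then show False using distinct_idx[of a b] distinct_idx[of b a] ab x by linarith
  qed
  have "sub_acyclic ?G T"
    unfolding sub_acyclic_def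
  proof
    assume "\<exists>vs. 3 \<le> length vs \<and> distinct vs \<and> (\<forall>i<length vs. sub_adj ?G T (vs ! i) (vs ! ((i + 1) mod length vs)))"
    then obtain vs where vs: "3 \<le> length vs" "distinct vs"
      and adj: "\<forall>i<length vs. sub_adj ?G T (vs ! i) (vs ! ((i + 1) mod length vs))" by blast
    note nbr = cycle_neighbours[OF vs adj]
    have var: "x = ?v" if i: "i < length vs" "vs ! i = Inl x" for i x
    proof (rule ccontr)
      assume ne: "x \<noteq> ?v"
      obtain j j' where jj: "vs ! j \<noteq> vs ! j'" "sub_adj ?G T (vs ! j) (vs ! i)" "sub_adj ?G T (vs ! i) (vs ! j')"
        using nbr[OF i(1)] by blast
      obtain a where a: "vs ! j = Inr a" "a \<in> inner ?G T" "x \<in> nbset ?G a"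
        using jj(2) i(2) by (auto simp: sub_adj_def)
      obtain b where b: "vs ! j' = Inr b" "b \<in> inner ?G T" "x \<in> nbset ?G b"
        using jj(3) i(2) by (auto simp: sub_adj_def)
      show False using uniq[OF a(2) b(2) a(3) b(3) ne] a(1) b(1) jj(1) by simp
    qed
    have notfac: False if i: "i < length vs" "vs ! i = Inr a" for i a
    proof -
      obtain j j' where jj: "j < length vs" "j' < length vs" "vs ! j \<noteq> vs ! j'"
        "sub_adj ?G T (vs ! j) (vs ! i)" "sub_adj ?G T (vs ! i) (vs ! j')"
        using nbr[OF i(1)] by blast
      obtain x y where "vs ! j = Inl x" "vs ! j' = Inl y"
        using jj(4,5) i(2) by (auto simp: sub_adj_def)
      then show False using var jj by metis
    qed
    have 0: "0 < length vs" "1 < length vs" using vs(1) by auto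
    have "sub_adj ?G T (vs ! 0) (vs ! 1)" using adj[rule_format, of 0] vs(1) 0 by simp
    then obtain x a where "vs ! 0 = Inr a \<or> vs ! 1 = Inr a" by (auto simp: sub_adj_def)
    then show False using notfac 0 by blast
  qed
  then show ?thesis using isoT cT conn by (simp add: blobs_def)
qed

lemma finite_stars [simp]: "finite (stars n k f cs)"
  by (rule finite_subset[of _ "Pow {..<n}"]) (auto simp: stars_def)

text \<open>A star that is lost meets the old or the new tuple. Stars are disjoint components of the
  old graph, so at most 2 k of them do.\<close>

lemma stars_Lipschitz:
  assumes vg: "valid_graph k n c (n, xs @ a # ys)" and k: "2 \<le> k" and b: "valid_con k n c b"
  shows "card (stars n k f (xs @ a # ys)) \<le> card (stars n k f (xs @ b # ys)) + 2 * k"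
proof -
  interpret valid_graph k n c "(n, xs @ a # ys)" by (rule vg)
  let ?X = "set (fst a) \<union> set (fst b)"
  let ?S = "stars n k f (xs @ a # ys)"
  let ?B = "{T\<in>blobs n (n, xs @ a # ys) (1 + (k - 1) * f). T \<inter> ?X \<noteq> {}}"
  have "?S \<subseteq> stars n k f (xs @ b # ys) \<union> ?B"
  proof
    fix T assume T: "T \<in> ?S"
    show "T \<in> stars n k f (xs @ b # ys) \<union> ?B"
    proof (cases "T \<inter> ?X = {}")
      case True
      then have "avoid T a" "avoid T b" by (auto simp: avoid_def)
      then show ?thesis using T by (simp add: stars_def)
    next
      case False
      then show ?thesis using stars_sub_blobs[OF vg k T] by simp
    qed
  qed
  then have "card ?S \<le> card (stars n k f (xs @ b # ys) \<union> ?B)"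
    using finite_blobs by (intro card_mono) auto
  also have "\<dots> \<le> card (stars n k f (xs @ b # ys)) + card ?B" by (rule card_Un_le)
  also have "card ?B \<le> card ?X" by (intro card_meeting_blobs) simp
  also have "card ?X \<le> card (set (fst a)) + card (set (fst b))" by (rule card_Un_le)
  also have "\<dots> \<le> length (fst a) + length (fst b)" by (intro add_mono card_length)
  also have "\<dots> = 2 * k" using b valid by (auto simp: valid_con_def tuples_def valid_fg_def)
  finally show ?thesis by simp
qed

section \<open>Avoidance probabilities and the expected number of stars\<close>

lemma rand_con_sum:
  assumes n: "0 < n" and fin: "finite (set_pmf P)"
  shows "(\<Sum>c\<in>set_pmf (rand_con k P n). pmf (rand_con k P n) c * h (fst c)) = (\<Sum>t\<in>tuples k n. h t) / real n ^ k"
proof -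
  have "(\<Sum>c\<in>set_pmf (rand_con k P n). pmf (rand_con k P n) c * h (fst c)) =
    (\<Sum>t\<in>tuples k n. \<Sum>\<psi>\<in>set_pmf P. pmf (rand_con k P n) (t, \<psi>) * h t)"
    unfolding set_rand_con[OF n] by (simp add: sum.cartesian_product case_prod_beta)
  also have "\<dots> = (\<Sum>t\<in>tuples k n. \<Sum>\<psi>\<in>set_pmf P. pmf P \<psi> * (h t / real n ^ k))"
    by (intro sum.cong refl) (simp add: rand_con_alt pmf_pair tuples_nonempty[OF n] card_tuples)
  also have "\<dots> = (\<Sum>t\<in>tuples k n. h t / real n ^ k)"
    unfolding sum_distrib_right[symmetric] using sum_pmf_eq_1[OF fin order_refl] by simp
  finally show ?thesis by (simp add: sum_divide_distrib)
qed

lemma avoid_prob: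
  assumes n: "0 < n" and fin: "finite (set_pmf P)" and U: "U \<subseteq> {..<n}"
  shows "(\<Sum>c\<in>set_pmf (rand_con k P n). pmf (rand_con k P n) c * of_bool (avoid U c)) = (real (n - card U) / real n) ^ k"
proof -
  have finU: "finite U" using U finite_subset by blast
  have "{t\<in>tuples k n. set t \<inter> U = {}} = {xs. set xs \<subseteq> {..<n} - U \<and> length xs = k}" by (auto simp: tuples_def)
  then have "card {t\<in>tuples k n. set t \<inter> U = {}} = (n - card U) ^ k"
    using card_lists_length_eq[of "{..<n} - U" k] U finU by (simp add: card_Diff_subset)
  then have "(\<Sum>t\<in>tuples k n. of_bool (set t \<inter> U = {})) = real (n - card U) ^ k"
    by (simp add: of_bool_def sum.If_cases Int_def)
  then show ?thesis
    unfolding avoid_def using rand_con_sum[OF n fin, of k "\<lambda>t. of_bool (set t \<inter> U = {})"]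
    by (simp add: power_divide)
qed

lemma of_bool_all: "of_bool (\<forall>c\<in>set cs. Q c) = prod_list (map (\<lambda>c. of_bool (Q c) :: real) cs)"
  by (induction cs) (simp_all add: of_bool_conj)

lemma iid_mean_avoid:
  assumes n: "0 < n" and fin: "finite (set_pmf P)" and U: "U \<subseteq> {..<n}"
  shows "iid_mean (rand_con k P n) m (\<lambda>gs. of_bool (\<forall>c\<in>set gs. avoid U c)) = (real (n - card U) / real n) ^ (k * m)"
  unfolding of_bool_all iid_mean_prod_list avoid_prob[OF assms] by (simp add: power_mult)

lemma iid_mean_fst:
  assumes n: "0 < n" and fin: "finite (set_pmf P)" and L: "set L \<subseteq> tuples k n"
  shows "iid_mean (rand_con k P n) (length L) (\<lambda>ts. of_bool (map fst ts = L)) = (1 / real n ^ k) ^ length L"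
  using L
proof (induction L)
  case (Cons t L)
  have "iid_mean (rand_con k P n) (length (t # L)) (\<lambda>ts. of_bool (map fst ts = t # L)) =
    (\<Sum>c\<in>set_pmf (rand_con k P n). pmf (rand_con k P n) c *
      (of_bool (fst c = t) * iid_mean (rand_con k P n) (length L) (\<lambda>ts. of_bool (map fst ts = L))))"
    by (simp add: iid_mean_cmult[symmetric] of_bool_conj)
  also have "\<dots> = (\<Sum>t'\<in>tuples k n. of_bool (t' = t) * (1 / real n ^ k) ^ length L) / real n ^ k"
    using Cons rand_con_sum[OF n fin, of k "\<lambda>t'. of_bool (t' = t) * (1 / real n ^ k) ^ length L"] by simp
  also have "(\<Sum>t'\<in>tuples k n. of_bool (t' = t) * (1 / real n ^ k) ^ length L) = (1 / real n ^ k) ^ length L"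
    using Cons.prems by (simp add: of_bool_def if_distrib[of "\<lambda>x. x * _"] cong: if_cong)
  finally show ?case by simp
qed simp

text \<open>Only the term with exactly \<open>f\<close> constraints touching \<open>T\<close> is
  kept: their tuples take one prescribed value, with probability n^(-k f), and the others avoid
  \<open>T\<close>.\<close>

lemma stars_mean:
  assumes n: "0 < n" and fin: "finite (set_pmf P)" and k: "2 \<le> k" and f: "f \<le> m"
  defines "s \<equiv> 1 + (k - 1) * f"
  shows "real (n choose s) * (real (m choose f) * ((1 / real n ^ k) ^ f * (real (n - s) / real n) ^ (k * (m - f))))
    \<le> iid_mean (rand_con k P n) m (\<lambda>cs. real (card (stars n k f cs)))"
proof -
  let ?p = "rand_con k P n"
  let ?TT = "{T. T \<subseteq> {..<n} \<and> card T = s}"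
  have finTT: "finite ?TT" by (rule finite_subset[of _ "Pow {..<n}"]) auto
  have "real (card (stars n k f cs)) = (\<Sum>T\<in>?TT. of_bool (map fst (filter (\<lambda>c. \<not> avoid T c) cs) = star_on k f T))"
    for cs :: "(nat list \<times> ('a list \<Rightarrow> real)) list"
  proof -
    have "stars n k f cs = {T\<in>?TT. map fst (filter (\<lambda>c. \<not> avoid T c) cs) = star_on k f T}"
      by (auto simp: stars_def s_def)
    then show ?thesis using finTT by (simp add: of_bool_def sum.If_cases Int_def)
  qed
  then have "iid_mean ?p m (\<lambda>cs. real (card (stars n k f cs))) =
    (\<Sum>T\<in>?TT. iid_mean ?p m (\<lambda>cs. of_bool (map fst (filter (\<lambda>c. \<not> avoid T c) cs) = star_on k f T)))"
    by (simp only: iid_mean_sum)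
  also have "\<dots> \<ge> (\<Sum>T\<in>?TT. real (m choose f) * ((1 / real n ^ k) ^ f * (real (n - s) / real n) ^ (k * (m - f))))"
  proof (rule sum_mono)
    fix T assume "T \<in> ?TT"
    then have T: "T \<subseteq> {..<n}" "card T = s" by auto
    have finT: "finite T" using T finite_subset by blast
    note ctx = finT T(2)[unfolded s_def] k
    let ?g = "\<lambda>ts gs. of_bool (map fst ts = star_on k f T) :: real"
    have nn: "0 \<le> split_mean ?p (\<lambda>c. \<not> avoid T c) t u ?g" for t u
      unfolding split_mean_def by (intro iid_mean_nonneg mult_nonneg_nonneg) auto
    have star: "set (star_on k f T) \<subseteq> tuples k n"
    proof
      fix xs assume "xs \<in> set (star_on k f T)"
      then show "xs \<in> tuples k n" using star_on_sub[OF ctx, of xs] T(1) by (auto simp: tuples_def)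
    qed
    have hit: "\<forall>c\<in>set ts. \<not> avoid T c" if "map fst ts = star_on k f T" for ts :: "(nat list \<times> ('a list \<Rightarrow> real)) list"
    proof
      fix c assume "c \<in> set ts"
      then have "fst c \<in> set (star_on k f T)" unfolding that[symmetric] by simp
      then have "hd (sorted_list_of_set T) \<in> set (fst c) \<inter> T" using star_on_sub[OF ctx] T_facts(1)[OF ctx] by blast
      then show "\<not> avoid T c" by (auto simp: avoid_def)
    qed
    have "split_mean ?p (\<lambda>c. \<not> avoid T c) f (m - f) ?g =
      iid_mean ?p f (\<lambda>ts. of_bool (map fst ts = star_on k f T)) * (real (n - s) / real n) ^ (k * (m - f))"
      unfolding split_mean_def iid_mean_cmult_right[symmetric]
      using hit iid_mean_avoid[OF n fin T(1), of k "m - f"] T(2)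
      by (intro iid_mean_cong) (auto simp: of_bool_def)
    also have "iid_mean ?p f (\<lambda>ts. of_bool (map fst ts = star_on k f T)) = (1 / real n ^ k) ^ f"
      using iid_mean_fst[OF n fin star] length_star_on[OF ctx] by simp
    finally have "real (m choose f) * ((1 / real n ^ k) ^ f * (real (n - s) / real n) ^ (k * (m - f))) =
      real (m choose f) * split_mean ?p (\<lambda>c. \<not> avoid T c) f (m - f) ?g" by simp
    also have "\<dots> \<le> (\<Sum>t\<le>m. real (m choose t) * split_mean ?p (\<lambda>c. \<not> avoid T c) t (m - t) ?g)"
      using f nn by (intro member_le_sum[of f "{..m}" "\<lambda>t. real (m choose t) * split_mean ?p (\<lambda>c. \<not> avoid T c) t (m - t) ?g"]) auto
    also have "\<dots> = iid_mean ?p m (\<lambda>cs. of_bool (map fst (filter (\<lambda>c. \<not> avoid T c) cs) = star_on k f T))"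
      using iid_mean_split[of ?p m ?g "\<lambda>c. \<not> avoid T c"] by simp
    finally show "real (m choose f) * ((1 / real n ^ k) ^ f * (real (n - s) / real n) ^ (k * (m - f))) \<le> \<dots>" .
  qed
  finally show ?thesis using n_subsets[of "{..<n}" s] by simp
qed

text \<open>From ln (1 - x) \<ge> - x - x^2, where x^2 \<le> x / 2.\<close>

lemma one_minus_power_ge:
  fixes x :: real
  assumes "0 \<le> x" "x \<le> 1 / 2"
  shows "exp (- 2 * x * real N) \<le> (1 - x) ^ N"
proof -
  have "x * x \<le> x * (1 / 2)" using assms by (intro mult_left_mono) auto
  then have "- 2 * x \<le> ln (1 - x)"
    using ln_one_minus_pos_lower_bound[OF assms] by (simp add: power2_eq_square)
  then have "exp (- 2 * x) \<le> 1 - x" using assms by (subst ln_ge_iff[symmetric]) auto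
  then have "exp (- 2 * x) ^ N \<le> (1 - x) ^ N" by (intro power_mono) auto
  then show ?thesis by (simp add: exp_of_nat_mult[symmetric] mult_ac)
qed

text \<open>Second moment method. The mean is at least \<open>b * real n\<close>: choosing vertices
  and constraint indices gives order n^s n^f, the tuples have probability n^(-k f), and s + f = k f
  + 1. One constraint alters the count by at most 2 k, so the variance is at most linear in n and
  Chebyshev's inequality gives a failure probability of order 1 / n.\<close>

lemma stars_abundant:
  fixes P :: "('o::finite list \<Rightarrow> real) pmf"
  assumes k: "2 \<le> k" and fin: "finite (set_pmf P)" and c: "1 \<le> c"
    and bounds: "\<forall>\<psi>\<in>set_pmf P. \<forall>xs. length xs = k \<longrightarrow> 1 / c \<le> \<psi> xs \<and> \<psi> xs \<le> c"
    and c1: "0 < c\<^sub>1" and c2: "0 < c\<^sub>2"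
  shows "\<exists>a>0. \<exists>C n\<^sub>0. \<forall>n\<ge>n\<^sub>0. \<forall>m. c\<^sub>1 * real n \<le> real m \<longrightarrow> real m \<le> c\<^sub>2 * real n \<longrightarrow>
    measure_pmf.prob (iid_list m (rand_con k P n)) {cs. real (card (stars n k f cs)) < a * real n} \<le> C / real n"
proof -
  define s where "s = 1 + (k - 1) * f"
  \<comment> \<open>The factors come from the two binomial coefficients and from the constraints
    that avoid the star; for \<open>f = 0\<close> the second factor is 1.\<close>
  define b where "b = (1 / real s) ^ s * (c\<^sub>1 / real f) ^ f * exp (- 2 * real s * real k * c\<^sub>2)"
  have b0: "0 < b"
  proof -
    have "0 < s" by (simp add: s_def)
    then have "0 < (1 / real s) ^ s" by simp
    moreover have "0 < (c\<^sub>1 / real f) ^ f" using c1 by (cases "f = 0") auto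
    ultimately show ?thesis unfolding b_def by (intro mult_pos_pos exp_gt_zero)
  qed
  have sf: "s + f = k * f + 1"
    using k by (cases k) (auto simp: s_def)
  define n\<^sub>0 where "n\<^sub>0 = max (2 * s) (nat \<lceil>real f / c\<^sub>1\<rceil>)"
  have main: "measure_pmf.prob (iid_list m (rand_con k P n)) {cs. real (card (stars n k f cs)) < b / 2 * real n}
      \<le> (16 * real k ^ 2 * c\<^sub>2 / b ^ 2) / real n"
    if n: "n \<ge> n\<^sub>0" and m: "c\<^sub>1 * real n \<le> real m" "real m \<le> c\<^sub>2 * real n" for n m
  proof -
    have n2: "2 * s \<le> n" using n by (simp add: n\<^sub>0_def)
    have n0: "0 < n" using n2 by (simp add: s_def)
    have "real f / c\<^sub>1 \<le> real n" using n unfolding n\<^sub>0_def by linarith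
    then have "real f \<le> c\<^sub>1 * real n" using c1 by (simp add: pos_divide_le_eq mult.commute)
    then have fm: "f \<le> m" using m(1) by linarith
    let ?p = "rand_con k P n"
    note finp = finite_set_rand_con[OF n0 fin, of k]
    let ?X = "\<lambda>cs. real (card (stars n k f cs))"
    define \<mu> where "\<mu> = iid_mean ?p m ?X"
    have "b * real n \<le> \<mu>"
    proof -
      have s0: "0 < s" by (simp add: s_def)
      have A: "(real n / real s) ^ s \<le> real (n choose s)"
        using n2 by (intro binomial_ge_n_over_k_pow_k) auto
      have "(c\<^sub>1 * real n / real f) ^ f \<le> (real m / real f) ^ f"
        using m c1 by (intro power_mono divide_right_mono) auto
      also have "\<dots> \<le> real (m choose f)" by (rule binomial_ge_n_over_k_pow_k[OF fm])
      finally have B: "(c\<^sub>1 * real n / real f) ^ f \<le> real (m choose f)" .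
      have x: "real s / real n \<le> 1 / 2" using n2 n0 by (simp add: field_simps)
      have "real (k * (m - f)) \<le> real k * (c\<^sub>2 * real n)"
        using m fm by (auto intro!: mult_left_mono simp: of_nat_diff)
      then have "real s / real n * real (k * (m - f)) \<le> real s / real n * (real k * (c\<^sub>2 * real n))"
        by (rule mult_left_mono) simp
      also have "\<dots> = real s * real k * c\<^sub>2" using n0 by simp
      finally have "exp (- 2 * real s * real k * c\<^sub>2) \<le> exp (- 2 * (real s / real n) * real (k * (m - f)))"
        by simp
      also have "\<dots> \<le> (1 - real s / real n) ^ (k * (m - f))"
        by (rule one_minus_power_ge[OF _ x]) simp
      also have "1 - real s / real n = real (n - s) / real n"
        using n2 n0 by (simp add: of_nat_diff diff_divide_distrib)
      finally have D: "exp (- 2 * real s * real k * c\<^sub>2) \<le> (real (n - s) / real n) ^ (k * (m - f))" .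
      have "(real n) ^ s * ((real n) ^ f * (1 / real n ^ k) ^ f) = real n"
      proof -
        have "(real n) ^ s * (real n) ^ f = real n * (real n ^ k) ^ f"
          unfolding power_add[symmetric] sf by (simp add: power_mult)
        then show ?thesis using n0 by (simp add: power_one_over field_simps)
      qed
      then have "b * real n = b * ((real n) ^ s * ((real n) ^ f * (1 / real n ^ k) ^ f))" by simp
      also have "\<dots> = (real n / real s) ^ s * ((c\<^sub>1 * real n / real f) ^ f * ((1 / real n ^ k) ^ f * exp (- 2 * real s * real k * c\<^sub>2)))"
        by (simp add: b_def power_divide power_mult_distrib mult_ac)
      also have "\<dots> \<le> real (n choose s) * (real (m choose f) * ((1 / real n ^ k) ^ f * (real (n - s) / real n) ^ (k * (m - f))))"
        using A B D c1 by (intro mult_mono mult_nonneg_nonneg) auto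
      also have "\<dots> \<le> \<mu>" unfolding \<mu>_def s_def by (rule stars_mean[OF n0 fin k fm])
      finally show ?thesis .
    qed
    note mean = this
    have vg: "valid_graph k n c (n, cs)" if "set cs \<subseteq> set_pmf ?p" for cs
      by unfold_locales (use that rand_con_valid[OF n0 bounds] c n0 k in \<open>auto simp: valid_fg_def\<close>)
    have var: "iid_mean ?p m (\<lambda>cs. (?X cs - \<mu>)\<^sup>2) \<le> real m * (real (2 * k))\<^sup>2"
      unfolding \<mu>_def
    proof (rule variance_iid[OF finp])
      fix xs ys a a' assume sub: "set (xs @ a # a' # ys) \<subseteq> set_pmf ?p"
      have "card (stars n k f (xs @ a # ys)) \<le> card (stars n k f (xs @ a' # ys)) + 2 * k"
        using sub by (intro stars_Lipschitz[OF vg k rand_con_valid[OF n0 bounds]]) auto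
      moreover have "card (stars n k f (xs @ a' # ys)) \<le> card (stars n k f (xs @ a # ys)) + 2 * k"
        using sub by (intro stars_Lipschitz[OF vg k rand_con_valid[OF n0 bounds]]) auto
      ultimately show "\<bar>?X (xs @ a # ys) - ?X (xs @ a' # ys)\<bar> \<le> real (2 * k)" by linarith
    qed simp
    have bn: "0 < b / 2 * real n" using b0 n0 by simp
    have "measure_pmf.prob (iid_list m ?p) {cs. ?X cs < b / 2 * real n} \<le>
      measure_pmf.prob (iid_list m ?p) {cs. (b / 2 * real n)\<^sup>2 \<le> (?X cs - \<mu>)\<^sup>2}"
    proof (rule measure_pmf.finite_measure_mono)
      show "{cs. ?X cs < b / 2 * real n} \<subseteq> {cs. (b / 2 * real n)\<^sup>2 \<le> (?X cs - \<mu>)\<^sup>2}"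
      proof
        fix cs assume "cs \<in> {cs. ?X cs < b / 2 * real n}"
        then have "b / 2 * real n \<le> \<mu> - ?X cs" using mean by (simp add: field_simps)
        then have "(b / 2 * real n)\<^sup>2 \<le> (\<mu> - ?X cs)\<^sup>2" using bn by (intro power_mono) auto
        then show "cs \<in> {cs. (b / 2 * real n)\<^sup>2 \<le> (?X cs - \<mu>)\<^sup>2}" by (simp add: power2_commute)
      qed
    qed simp
    also have "\<dots> \<le> iid_mean ?p m (\<lambda>cs. (?X cs - \<mu>)\<^sup>2) / (b / 2 * real n)\<^sup>2"
      by (rule iid_markov[OF finp zero_less_power[OF bn]]) simp
    also have "\<dots> \<le> (c\<^sub>2 * real n * (real (2 * k))\<^sup>2) / (b / 2 * real n)\<^sup>2"
    proof (rule divide_right_mono)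
      have "real m * (real (2 * k))\<^sup>2 \<le> c\<^sub>2 * real n * (real (2 * k))\<^sup>2" using m by (intro mult_right_mono) auto
      then show "iid_mean ?p m (\<lambda>cs. (?X cs - \<mu>)\<^sup>2) \<le> c\<^sub>2 * real n * (real (2 * k))\<^sup>2" using var by linarith
    qed simp
    also have "\<dots> = (16 * real k ^ 2 * c\<^sub>2 / b ^ 2) / real n"
      using n0 b0 by (simp add: power2_eq_square field_simps)
    finally show ?thesis .
  qed
  show ?thesis
  proof (intro exI conjI allI impI)
    show "0 < b / 2" using b0 by simp
  qed (rule main)
qed

section \<open>Averaging the error over cavities\<close>

text \<open>A tuple inside \<open>U\<close> is rarer than one touching \<open>U\<close> by a factor
  of order n^(k - 1), which this weight compensates. Its product over the touching constraints is
  the factor n^((k - 1) f) of the first moment.\<close>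

definition inner_wt :: "nat \<Rightarrow> nat \<Rightarrow> nat set \<Rightarrow> nat list \<times> ('o list \<Rightarrow> real) \<Rightarrow> real" where
  "inner_wt k n U a = (if set (fst a) \<subseteq> U then real n ^ (k - 1) else 1)"

lemma inner_wt_nonneg: "0 \<le> inner_wt k n U a"
  by (simp add: inner_wt_def)

text \<open>A tuple lies inside \<open>U\<close> with probability (l / n)^k, which the weight raises
  to order 1 / n, the order of the bound k l / n for touching \<open>U\<close> at all.\<close>

lemma touch_mean:
  fixes P :: "('o list \<Rightarrow> real) pmf"
  assumes n: "0 < n" and fin: "finite (set_pmf P)" and k: "2 \<le> k" and U: "U \<subseteq> {..<n}" "card U = l"
  shows "(\<Sum>a\<in>set_pmf (rand_con k P n). pmf (rand_con k P n) a * (of_bool (\<not> avoid U a) * inner_wt k n U a))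
    \<le> real (l ^ k + k * l) / real n"
proof -
  let ?p = "rand_con k P n"
  have finU: "finite U" using U finite_subset by blast
  have ln: "l \<le> n" using card_mono[OF _ U(1)] U(2) by simp
  have "(\<Sum>a\<in>set_pmf ?p. pmf ?p a * (of_bool (\<not> avoid U a) * inner_wt k n U a)) \<le>
    (\<Sum>a\<in>set_pmf ?p. pmf ?p a * (of_bool (set (fst a) \<subseteq> U) * real n ^ (k - 1)) +
       (pmf ?p a - pmf ?p a * of_bool (avoid U a)))"
  proof (rule sum_mono)
    fix a :: "nat list \<times> ('o list \<Rightarrow> real)"
    have "of_bool (\<not> avoid U a) * inner_wt k n U a \<le> of_bool (set (fst a) \<subseteq> U) * real n ^ (k - 1) + (1 - of_bool (avoid U a))"
      by (auto simp: inner_wt_def of_bool_def)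
    from mult_left_mono[OF this pmf_nonneg[of ?p a]]
    show "pmf ?p a * (of_bool (\<not> avoid U a) * inner_wt k n U a) \<le>
      pmf ?p a * (of_bool (set (fst a) \<subseteq> U) * real n ^ (k - 1)) + (pmf ?p a - pmf ?p a * of_bool (avoid U a))"
      by (simp add: distrib_left right_diff_distrib)
  qed
  also have "\<dots> = (\<Sum>t\<in>tuples k n. of_bool (set t \<subseteq> U) * real n ^ (k - 1)) / real n ^ k + (1 - (real (n - l) / real n) ^ k)"
    unfolding sum.distrib sum_subtractf avoid_prob[OF n fin U(1)] U(2)
    using rand_con_sum[OF n fin, of k "\<lambda>t. of_bool (set t \<subseteq> U) * real n ^ (k - 1)"]
      sum_pmf_eq_1[OF finite_set_rand_con[OF n fin, of k] order_refl] by simp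
  also have "(\<Sum>t\<in>tuples k n. of_bool (set t \<subseteq> U) * real n ^ (k - 1)) = real (l ^ k) * real n ^ (k - 1)"
  proof -
    have "{t\<in>tuples k n. set t \<subseteq> U} = {xs. set xs \<subseteq> U \<and> length xs = k}" using U by (auto simp: tuples_def)
    then have "card {t\<in>tuples k n. set t \<subseteq> U} = l ^ k" using card_lists_length_eq[OF finU, of k] U by simp
    then have "(\<Sum>t\<in>tuples k n. of_bool (set t \<subseteq> U)) = real (l ^ k)" by (simp add: of_bool_def sum.If_cases Int_def)
    then show ?thesis by (simp only: sum_distrib_right[symmetric])
  qed
  also have "real (l ^ k) * real n ^ (k - 1) / real n ^ k = real (l ^ k) / real n"
    using n k by (cases k) auto
  also have "1 - (real (n - l) / real n) ^ k \<le> real (k * l) / real n"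
  proof -
    have "1 + real k * (- (real l / real n)) \<le> (1 + - (real l / real n)) ^ k"
      using ln n by (intro Bernoulli_inequality) (simp add: field_simps)
    also have "1 + - (real l / real n) = real (n - l) / real n" using ln n by (simp add: of_nat_diff diff_divide_distrib)
    finally show ?thesis by simp
  qed
  finally show ?thesis by (simp add: add_divide_distrib)
qed

text \<open>With the touching constraints \<open>ts\<close> held fixed, \<open>h\<close> is averaged
  over a fresh sample \<open>gs\<close>. Their number is controlled by an exponential series, as (m
  choose t) (a / n)^t is at most (\<open>c\<^sub>2\<close> a)^t / t!.\<close>

lemma split_bound:
  assumes n: "0 < n" and fin: "finite (set_pmf P)" and k: "2 \<le> k" and U: "U \<subseteq> {..<n}" "card U = l"
    and m: "real m \<le> c\<^sub>2 * real n"
    and h: "\<And>t ts. t \<le> m \<Longrightarrow> length ts = t \<Longrightarrow> set ts \<subseteq> set_pmf (rand_con k P n) \<Longrightarrow>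
      iid_mean (rand_con k P n) (m - t) (\<lambda>gs. of_bool (\<forall>a\<in>set gs. avoid U a) * h ts gs) \<le> \<beta> t"
    and \<beta>: "\<And>t. 0 \<le> \<beta> t"
  shows "iid_mean (rand_con k P n) m (\<lambda>cs. prod_list (map (inner_wt k n U) (filter (\<lambda>a. \<not> avoid U a) cs)) *
      h (filter (\<lambda>a. \<not> avoid U a) cs) (filter (avoid U) cs))
    \<le> (\<Sum>t\<le>m. (c\<^sub>2 * real (l ^ k + k * l)) ^ t / fact t * \<beta> t)"
proof -
  let ?p = "rand_con k P n"
  let ?Q = "\<lambda>a. \<not> avoid U a"
  let ?\<Phi> = "\<lambda>ts. prod_list (map (inner_wt k n U) ts)"
  let ?g = "\<lambda>ts gs. ?\<Phi> ts * h ts gs"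
  let ?a = "real (l ^ k + k * l)"
  have \<Phi>0: "0 \<le> ?\<Phi> ts" for ts by (induction ts) (auto intro: mult_nonneg_nonneg inner_wt_nonneg)
  have "iid_mean ?p m (\<lambda>cs. ?g (filter ?Q cs) (filter (\<lambda>a. \<not> ?Q a) cs)) =
    (\<Sum>t\<le>m. real (m choose t) * split_mean ?p ?Q t (m - t) ?g)"
    by (rule iid_mean_split)
  also have "\<dots> \<le> (\<Sum>t\<le>m. (c\<^sub>2 * ?a) ^ t / fact t * \<beta> t)"
  proof (rule sum_mono)
    fix t assume "t \<in> {..m}"
    then have t: "t \<le> m" by simp
    have "split_mean ?p ?Q t (m - t) ?g \<le> iid_mean ?p t (\<lambda>ts. prod_list (map (\<lambda>a. of_bool (?Q a) * inner_wt k n U a) ts) * \<beta> t)"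
      unfolding split_mean_def
    proof (rule iid_mean_mono)
      fix ts :: "(nat list \<times> ('a list \<Rightarrow> real)) list"
      assume ts: "length ts = t" "set ts \<subseteq> set_pmf ?p"
      have "iid_mean ?p (m - t) (\<lambda>gs. of_bool (\<forall>c\<in>set gs. \<not> ?Q c) * (?\<Phi> ts * h ts gs)) =
         ?\<Phi> ts * iid_mean ?p (m - t) (\<lambda>gs. of_bool (\<forall>c\<in>set gs. avoid U c) * h ts gs)"
        unfolding iid_mean_cmult[symmetric] by (simp add: mult.left_commute)
      also have "\<dots> \<le> ?\<Phi> ts * \<beta> t" using h[OF t ts] \<Phi>0 by (intro mult_left_mono) auto
      finally have "of_bool (\<forall>c\<in>set ts. ?Q c) * iid_mean ?p (m - t) (\<lambda>gs. of_bool (\<forall>c\<in>set gs. \<not> ?Q c) * (?\<Phi> ts * h ts gs))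
        \<le> of_bool (\<forall>c\<in>set ts. ?Q c) * (?\<Phi> ts * \<beta> t)" by (intro mult_left_mono) auto
      also have "of_bool (\<forall>c\<in>set ts. ?Q c) * (?\<Phi> ts * \<beta> t) = prod_list (map (\<lambda>a. of_bool (?Q a) * inner_wt k n U a) ts) * \<beta> t"
      proof -
        have "of_bool (\<forall>c\<in>set ts. ?Q c) * ?\<Phi> ts = prod_list (map (\<lambda>a. of_bool (?Q a) * inner_wt k n U a) ts)"
          by (induction ts) (auto simp: of_bool_conj)
        then show ?thesis by (simp only: mult.assoc[symmetric])
      qed
      finally show "of_bool (\<forall>c\<in>set ts. ?Q c) * iid_mean ?p (m - t) (\<lambda>gs. of_bool (\<forall>c\<in>set gs. \<not> ?Q c) * (?\<Phi> ts * h ts gs))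
        \<le> prod_list (map (\<lambda>a. of_bool (?Q a) * inner_wt k n U a) ts) * \<beta> t" .
    qed
    also have "\<dots> = (\<Sum>a\<in>set_pmf ?p. pmf ?p a * (of_bool (?Q a) * inner_wt k n U a)) ^ t * \<beta> t"
      unfolding iid_mean_cmult_right iid_mean_prod_list ..
    also have "\<dots> \<le> (?a / real n) ^ t * \<beta> t"
      using touch_mean[OF n fin k U] \<beta>[of t]
      by (intro mult_right_mono power_mono sum_nonneg) (auto intro!: mult_nonneg_nonneg inner_wt_nonneg)
    finally have "real (m choose t) * split_mean ?p ?Q t (m - t) ?g \<le> real (m choose t) * ((?a / real n) ^ t * \<beta> t)"
      by (rule mult_left_mono) simp
    also have "\<dots> \<le> (real m ^ t / fact t) * ((?a / real n) ^ t * \<beta> t)"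
    proof (rule mult_right_mono)
      have "real ((m choose t) * fact t) \<le> real (m ^ t)" by (rule of_nat_mono[OF binomial_fact_pow])
      then show "real (m choose t) \<le> real m ^ t / fact t" by (simp add: pos_le_divide_eq)
    qed (use \<beta> in simp)
    also have "\<dots> = (real m * (?a / real n)) ^ t / fact t * \<beta> t" 
      unfolding power_mult_distrib by simp
    also have "\<dots> \<le> (c\<^sub>2 * ?a) ^ t / fact t * \<beta> t"
    proof (intro mult_right_mono divide_right_mono power_mono)
      have "real m * (?a / real n) \<le> c\<^sub>2 * real n * (?a / real n)" using m by (intro mult_right_mono) auto
      then show "real m * (?a / real n) \<le> c\<^sub>2 * ?a" using n by simp
    qed (use \<beta> in auto)
    finally show "real (m choose t) * split_mean ?p ?Q t (m - t) ?g \<le> (c\<^sub>2 * ?a) ^ t / fact t * \<beta> t" .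
  qed
  finally show ?thesis by simp
qed

lemma exp_partial_sum:
  fixes x :: real
  assumes "0 \<le> x" "finite A"
  shows "(\<Sum>t\<in>A. x ^ t / fact t) \<le> exp x"
proof -
  have s: "(\<lambda>t. x ^ t / fact t) sums exp x" using exp_converges[of x] by (simp add: divide_inverse mult.commute)
  have "(\<Sum>t\<in>A. x ^ t / fact t) \<le> (\<Sum>t. x ^ t / fact t)"
    using assms s by (intro sum_le_suminf) (auto simp: sums_iff)
  then show ?thesis using s by (simp add: sums_iff)
qed

text \<open>Up to \<open>M\<close> touching constraints the fine bound \<alpha> is charged, beyond
  that the trivial bound 2 with the tail of the series.\<close>

lemma exp_split_bound:
  fixes x :: real
  assumes x: "0 \<le> x" and \<alpha>: "0 \<le> \<alpha>"
  shows "(\<Sum>t\<le>m. x ^ t / fact t * (if t \<le> M then \<alpha> else 2)) \<le> \<alpha> * exp x + 2 * (exp x - (\<Sum>t\<le>M. x ^ t / fact t))"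
proof -
  let ?e = "\<lambda>t. x ^ t / fact t"
  have "(\<Sum>t\<le>m. ?e t * (if t \<le> M then \<alpha> else 2)) = (\<Sum>t\<in>{..m} \<inter> {..M}. ?e t * \<alpha>) + (\<Sum>t\<in>{..m} - {..M}. ?e t * 2)"
  proof -
    have "(\<Sum>t\<le>m. ?e t * (if t \<le> M then \<alpha> else 2)) =
      (\<Sum>t\<in>({..m} \<inter> {..M}) \<union> ({..m} - {..M}). ?e t * (if t \<le> M then \<alpha> else 2))"
      by (intro sum.cong) auto
    also have "\<dots> = (\<Sum>t\<in>{..m} \<inter> {..M}. ?e t * (if t \<le> M then \<alpha> else 2)) +
        (\<Sum>t\<in>{..m} - {..M}. ?e t * (if t \<le> M then \<alpha> else 2))"
      by (intro sum.union_disjoint) auto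
    also have "(\<Sum>t\<in>{..m} \<inter> {..M}. ?e t * (if t \<le> M then \<alpha> else 2)) = (\<Sum>t\<in>{..m} \<inter> {..M}. ?e t * \<alpha>)"
      by (intro sum.cong) auto
    also have "(\<Sum>t\<in>{..m} - {..M}. ?e t * (if t \<le> M then \<alpha> else 2)) = (\<Sum>t\<in>{..m} - {..M}. ?e t * 2)"
      by (intro sum.cong) auto
    finally show ?thesis .
  qed
  also have "(\<Sum>t\<in>{..m} \<inter> {..M}. ?e t * \<alpha>) \<le> \<alpha> * exp x"
    unfolding mult.commute[of _ \<alpha>] sum_distrib_left[symmetric]
    by (intro mult_left_mono exp_partial_sum x \<alpha>) simp
  also have "(\<Sum>t\<in>{..m} - {..M}. ?e t * 2) \<le> 2 * (exp x - (\<Sum>t\<le>M. ?e t))"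
  proof -
    have "(\<Sum>t\<in>{..m} - {..M}. ?e t) + (\<Sum>t\<le>M. ?e t) = (\<Sum>t\<in>({..m} - {..M}) \<union> {..M}. ?e t)"
      by (rule sum.union_disjoint[symmetric]) auto
    also have "\<dots> \<le> exp x" by (rule exp_partial_sum[OF x]) simp
    finally have "(\<Sum>t\<in>{..m} - {..M}. ?e t) \<le> exp x - (\<Sum>t\<le>M. ?e t)" by linarith
    from mult_right_mono[OF this, of 2] show ?thesis
      unfolding sum_distrib_right[symmetric] mult.commute[of "2 :: real"] by simp
  qed
  finally show ?thesis by linarith
qed

section \<open>Cavity quantities in terms of the touching and the other constraints\<close>

lemma prod_list_filter_nth:
  fixes h :: "'a \<Rightarrow> real"
  shows "prod_list (map h (filter Q cs)) = (\<Prod>a\<in>{a. a < length cs \<and> Q (cs ! a)}. h (cs ! a))"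
proof -
  have "prod_list (map h (filter Q cs)) = prod_list (map (\<lambda>c. if Q c then h c else 1) cs)"
    by (induction cs) auto
  also have "\<dots> = (\<Prod>a\<in>{..<length cs}. if Q (cs ! a) then h (cs ! a) else 1)"
    by (simp add: prod.list_conv_set_nth atLeast0LessThan)
  also have "\<dots> = (\<Prod>a\<in>{a\<in>{..<length cs}. Q (cs ! a)}. h (cs ! a))"
    by (rule prod.inter_filter[symmetric]) simp
  finally show ?thesis by (simp add: lessThan_def)
qed

lemma touching_alt: "touching (n, cs) U = {a. a < length cs \<and> \<not> avoid U (cs ! a)}"
  by (auto simp: touching_def facs_def avoid_def nbset_def nb_def)

lemma rest_wt_alt: "rest_wt (n, cs) U = list_wt (filter (avoid U) cs)"
proof
  fix \<sigma>
  have "facs (n, cs) - touching (n, cs) U = {a. a < length cs \<and> avoid U (cs ! a)}"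
    by (auto simp: touching_alt facs_def)
  then show "rest_wt (n, cs) U \<sigma> = list_wt (filter (avoid U) cs) \<sigma>"
    unfolding rest_wt_def list_wt_def prod_list_filter_nth by (simp add: psi_fac_con_wt)
qed

lemma card_touching: "card (touching (n, cs) U) = length (filter (\<lambda>a. \<not> avoid U a) cs)"
  by (simp add: touching_alt length_filter_conv_card)

text \<open>The list \<open>outside\<close> as a function of the touching constraints alone, so that
  it stays fixed while the other constraints are averaged.\<close>

definition outer_vars :: "nat set \<Rightarrow> nat list \<Rightarrow> (nat list \<times> ('o list \<Rightarrow> real)) list \<Rightarrow> nat list" where
  "outer_vars U zs ts = sorted_list_of_set ((\<Union>a\<in>set ts. set (fst a)) - U - set zs)"

lemma outside_alt: "outside (n, cs) U zs = outer_vars U zs (filter (\<lambda>a. \<not> avoid U a) cs)"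
proof -
  have "(\<Union>a\<in>touching (n, cs) U. nbset (n, cs) a) = (\<Union>a\<in>set (filter (\<lambda>a. \<not> avoid U a) cs). set (fst a))"
    by (force simp: touching_alt nbset_def nb_def in_set_conv_nth)
  then show ?thesis by (simp add: outside_def outer_vars_def)
qed

lemma inner_wt_prod:
  assumes vg: "valid_graph k n c (n, cs)"
  shows "prod_list (map (inner_wt k n U) (filter (\<lambda>a. \<not> avoid U a) cs)) = real n ^ ((k - 1) * card (inner (n, cs) U))"
proof -
  interpret valid_graph k n c "(n, cs)" by (rule vg)
  let ?T = "touching (n, cs) U"
  have sub: "inner (n, cs) U \<subseteq> ?T" using nbset_nonempty by (auto simp: inner_def touching_def)
  have fin: "finite ?T" by (simp add: touching_def)
  have "prod_list (map (inner_wt k n U) (filter (\<lambda>a. \<not> avoid U a) cs)) = (\<Prod>a\<in>?T. inner_wt k n U (cs ! a))"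
    by (simp only: prod_list_filter_nth touching_alt)
  also have "\<dots> = (\<Prod>a\<in>?T. if a \<in> inner (n, cs) U then real n ^ (k - 1) else 1)"
    by (intro prod.cong refl) (auto simp: inner_wt_def inner_def nbset_def nb_def touching_def)
  also have "\<dots> = (\<Prod>a\<in>inner (n, cs) U. real n ^ (k - 1))"
    using prod.inter_restrict[OF fin, of "\<lambda>_. real n ^ (k - 1)" "inner (n, cs) U"] sub by (simp add: Int_absorb1)
  finally show ?thesis by (simp add: power_mult)
qed

text \<open>Equality unless the exponent is truncated at 0; in that case the left-hand side is 1 and
  the right-hand side a power of n with nonnegative exponent.\<close>

lemma cavity_power:
  assumes vg: "valid_graph k n c (n, cs)"
  shows "1 / real n ^ (l - (k - 1) * card (inner (n, cs) U)) \<le>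
     (1 / real n ^ l) * prod_list (map (inner_wt k n U) (filter (\<lambda>a. \<not> avoid U a) cs))"
proof -
  interpret valid_graph k n c "(n, cs)" by (rule vg)
  let ?i = "(k - 1) * card (inner (n, cs) U)"
  have "real n ^ l \<le> real n ^ ((l - ?i) + ?i)" using n0 by (intro power_increasing) auto
  then have "real n ^ l \<le> real n ^ (l - ?i) * real n ^ ?i" by (simp only: power_add)
  then show ?thesis unfolding inner_wt_prod[OF vg] using n0 by (simp add: field_simps)
qed

lemma length_outer_vars:
  assumes "\<And>a. a \<in> set ts \<Longrightarrow> length (fst a) = k"
  shows "length (outer_vars U zs ts) \<le> k * length ts"
proof -
  have "card (\<Union>a\<in>set ts. set (fst a)) \<le> (\<Sum>a\<in>set ts. card (set (fst a)))" by (rule card_UN_le) simp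
  also have "\<dots> \<le> (\<Sum>a\<in>set ts. k)"
  proof (rule sum_mono)
    fix a assume "a \<in> set ts"
    then show "card (set (fst a)) \<le> k" using assms[of a] card_length[of "fst a"] by simp
  qed
  also have "\<dots> \<le> k * length ts" using card_length[of ts] by (simp add: mult.commute)
  finally have "card (\<Union>a\<in>set ts. set (fst a)) \<le> k * length ts" .
  moreover have "card ((\<Union>a\<in>set ts. set (fst a)) - U - set zs) \<le> card (\<Union>a\<in>set ts. set (fst a))"
    by (intro card_mono) auto
  ultimately show ?thesis by (simp add: outer_vars_def)
qed

section \<open>The mean error of a single candidate set\<close>

context
  fixes k n m l M :: nat and P :: "('o::finite list \<Rightarrow> real) pmf" and c c\<^sub>2 \<kappa> :: real and zs :: "nat list"
  assumes n: "0 < n" and fin: "finite (set_pmf P)" and k: "2 \<le> k" and c: "1 \<le> c"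
    and bounds: "\<forall>\<psi>\<in>set_pmf P. \<forall>xs. length xs = k \<longrightarrow> 1 / c \<le> \<psi> xs \<and> \<psi> xs \<le> c"
    and m: "real m \<le> c\<^sub>2 * real n" and c2: "0 \<le> c\<^sub>2"
begin

abbreviation "con_pmf \<equiv> rand_con k P n"
abbreviation "touch_rate \<equiv> c\<^sub>2 * real (l ^ k + k * l)"
abbreviation "cav_term r U cs \<equiv> of_bool (U \<in> cav_set (n, cs) l r) *
   (avg_err n (n, cs) U zs / real n ^ (l - (k - 1) * card (inner (n, cs) U)))"

lemma vgraph: "set cs \<subseteq> set_pmf con_pmf \<Longrightarrow> valid_graph k n c (n, cs)"
  by unfold_locales (use rand_con_valid[OF n bounds] c n k in \<open>auto simp: valid_fg_def\<close>)

text \<open>Replaces the power of n belonging to the cavity by the multiplicative weight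
  \<open>inner_wt\<close>, whose mean factorises over the constraints, and lets go of the event that
  \<open>U\<close> is a cavity.\<close>

lemma cav_term_le:
  assumes cs: "set cs \<subseteq> set_pmf con_pmf" and le: "U \<in> cav_set (n, cs) l r \<Longrightarrow> avg_err n (n, cs) U zs \<le> e" and e: "0 \<le> e"
  shows "cav_term r U cs \<le> (1 / real n ^ l) * (prod_list (map (inner_wt k n U) (filter (\<lambda>a. \<not> avoid U a) cs)) * e)"
proof (cases "U \<in> cav_set (n, cs) l r")
  case False
  have "0 \<le> prod_list (map (inner_wt k n U) (filter (\<lambda>a. \<not> avoid U a) cs))"
    unfolding inner_wt_prod[OF vgraph[OF cs]] by simp
  then show ?thesis using e False by simp
next
  case True
  have "cav_term r U cs \<le> e * (1 / real n ^ (l - (k - 1) * card (inner (n, cs) U)))"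
    using le[OF True] True by (simp add: divide_right_mono)
  also have "\<dots> \<le> e * ((1 / real n ^ l) * prod_list (map (inner_wt k n U) (filter (\<lambda>a. \<not> avoid U a) cs)))"
    by (intro mult_left_mono cavity_power[OF vgraph[OF cs]] e)
  finally show ?thesis by (simp add: mult_ac)
qed

text \<open>Charges the trivial error 2 to every cavity. This serves for sets that meet the pinned
  vertices, which are few.\<close>

lemma cav_term_mean_crude:
  assumes U: "U \<subseteq> {..<n}" "card U = l"
  shows "iid_mean con_pmf m (cav_term r U) \<le> (1 / real n ^ l) * (2 * exp touch_rate)"
proof -
  have finU: "finite U" using U finite_subset by blast
  have "iid_mean con_pmf m (cav_term r U) \<le> iid_mean con_pmf m (\<lambda>cs. (1 / real n ^ l) *
     (prod_list (map (inner_wt k n U) (filter (\<lambda>a. \<not> avoid U a) cs)) * 2))"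
    by (intro iid_mean_mono cav_term_le valid_graph.avg_err_le_2[OF vgraph] finU) auto
  also have "\<dots> \<le> (1 / real n ^ l) * (\<Sum>t\<le>m. touch_rate ^ t / fact t * 2)"
    unfolding iid_mean_cmult
  proof (rule mult_left_mono)
    show "iid_mean con_pmf m (\<lambda>cs. prod_list (map (inner_wt k n U) (filter (\<lambda>a. \<not> avoid U a) cs)) * 2) \<le> (\<Sum>t\<le>m. touch_rate ^ t / fact t * 2)"
    proof (rule split_bound[OF n fin k U m, where h = "\<lambda>_ _. 2" and \<beta> = "\<lambda>_. 2"])
      fix t
      have "iid_mean con_pmf (m - t) (\<lambda>gs. of_bool (\<forall>a\<in>set gs. avoid U a) * 2) \<le> iid_mean con_pmf (m - t) (\<lambda>gs. 2)"
        by (intro iid_mean_mono) auto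
      then show "iid_mean con_pmf (m - t) (\<lambda>gs. of_bool (\<forall>a\<in>set gs. avoid U a) * 2) \<le> 2"
        using iid_mean_const[OF finite_set_rand_con[OF n fin]] by simp
    qed simp
  qed simp
  also have "\<dots> \<le> (1 / real n ^ l) * (2 * exp touch_rate)"
    using exp_partial_sum[of touch_rate "{..m}"] c2 unfolding sum_distrib_right[symmetric]
    by (intro mult_left_mono) auto
  finally show ?thesis .
qed

text \<open>For at most \<open>M\<close> given touching constraints, the outer vertices form a fixed
  list of length at most k M that avoids \<open>U\<close> and the pins, so \<open>dep_mean\<close>
  applies to the remaining sample of m - t constraints.\<close>

lemma cav_term_mean_fine:
  assumes U: "U \<subseteq> {..<n}" "card U = l" and zs: "distinct zs" "set zs \<subseteq> {..<n} - U"
    and large: "length zs + k * M + l < n" and \<kappa>: "0 < \<kappa>"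
    and inc: "\<And>t. t \<le> M \<Longrightarrow> pin_mean k P n (m - t) l (length zs + k * M) - pin_mean k P n (m - t) l (length zs) \<le> \<kappa>\<^sup>2"
  shows "iid_mean con_pmf m (cav_term r U) \<le> (1 / real n ^ l) *
    (4 * (2 * c ^ 4) ^ M * (real (k * M) * (real CARD('o) + 1) * \<kappa>) * exp touch_rate + 2 * (exp touch_rate - (\<Sum>t\<le>M. touch_rate ^ t / fact t)))"
proof -
  have finU: "finite U" using U finite_subset by blast
  let ?C = "4 * (2 * c ^ 4) ^ M"
  let ?\<delta> = "real (k * M) * (real CARD('o) + 1) * \<kappa>"
  let ?h = "\<lambda>ts gs. if length ts \<le> M then ?C * dep {..<n} (list_wt gs) zs (outer_vars U zs ts) else 2"
  have C0: "0 \<le> ?C" using c by simp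
  have c4: "1 \<le> 2 * c ^ 4" using one_le_power[OF c, of 4] by linarith
  have dep0: "0 \<le> dep {..<n} w zs ys" for w :: "(nat \<Rightarrow> 'o) \<Rightarrow> real" and ys
    unfolding dep_def by (intro sum_nonneg) auto
  have "iid_mean con_pmf m (cav_term r U) \<le> iid_mean con_pmf m (\<lambda>cs. (1 / real n ^ l) *
     (prod_list (map (inner_wt k n U) (filter (\<lambda>a. \<not> avoid U a) cs)) * ?h (filter (\<lambda>a. \<not> avoid U a) cs) (filter (avoid U) cs)))"
  proof (intro iid_mean_mono cav_term_le)
    fix cs :: "(nat list \<times> ('o list \<Rightarrow> real)) list" assume cs: "set cs \<subseteq> set_pmf con_pmf"
    interpret valid_graph k n c "(n, cs)" by (rule vgraph[OF cs])
    show "0 \<le> ?h (filter (\<lambda>a. \<not> avoid U a) cs) (filter (avoid U) cs)" using C0 dep0 by simp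
    assume "U \<in> cav_set (n, cs) l r"
    then have cav: "cavity (n, cs) U" by (simp add: cav_set_def)
    show "avg_err n (n, cs) U zs \<le> ?h (filter (\<lambda>a. \<not> avoid U a) cs) (filter (avoid U) cs)"
    proof (cases "length (filter (\<lambda>a. \<not> avoid U a) cs) \<le> M")
      case False
      then show ?thesis using avg_err_le_2[OF finU] by simp
    next
      case True
      have "avg_err n (n, cs) U zs \<le> 4 * (2 * c ^ 4) ^ length (filter (\<lambda>a. \<not> avoid U a) cs) *
        dep {..<n} (list_wt (filter (avoid U) cs)) zs (outer_vars U zs (filter (\<lambda>a. \<not> avoid U a) cs))"
        using avg_err_bound[OF cav zs] by (simp only: card_touching rest_wt_alt outside_alt)
      also have "\<dots> \<le> ?C * dep {..<n} (list_wt (filter (avoid U) cs)) zs (outer_vars U zs (filter (\<lambda>a. \<not> avoid U a) cs))"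
        using True c4 by (intro mult_right_mono mult_left_mono power_increasing dep0) auto
      finally show ?thesis using True by simp
    qed
  qed
  also have "\<dots> \<le> (1 / real n ^ l) * (\<Sum>t\<le>m. touch_rate ^ t / fact t * (if t \<le> M then ?C * ?\<delta> else 2))"
    unfolding iid_mean_cmult
  proof (rule mult_left_mono)
    show "iid_mean con_pmf m (\<lambda>cs. prod_list (map (inner_wt k n U) (filter (\<lambda>a. \<not> avoid U a) cs)) *
        ?h (filter (\<lambda>a. \<not> avoid U a) cs) (filter (avoid U) cs)) \<le> (\<Sum>t\<le>m. touch_rate ^ t / fact t * (if t \<le> M then ?C * ?\<delta> else 2))"
    proof (rule split_bound[OF n fin k U m])
      fix t and ts :: "(nat list \<times> ('o list \<Rightarrow> real)) list"
      assume ts: "length ts = t" "set ts \<subseteq> set_pmf con_pmf"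
      show "iid_mean con_pmf (m - t) (\<lambda>gs. of_bool (\<forall>a\<in>set gs. avoid U a) * ?h ts gs) \<le> (if t \<le> M then ?C * ?\<delta> else 2)"
      proof (cases "t \<le> M")
        case False
        have "iid_mean con_pmf (m - t) (\<lambda>gs. of_bool (\<forall>a\<in>set gs. avoid U a) * 2) \<le> iid_mean con_pmf (m - t) (\<lambda>gs. 2)"
          by (intro iid_mean_mono) auto
        then show ?thesis using iid_mean_const[OF finite_set_rand_con[OF n fin]] False ts by simp
      next
        case True
        have V: "set (fst a) \<subseteq> {..<n} \<and> length (fst a) = k" if "a \<in> set ts" for a
          using ts(2) that set_rand_con[OF n, of k P] by (auto simp: tuples_def subset_eq)
        have fV: "finite ((\<Union>a\<in>set ts. set (fst a)) - U - set zs)" by simp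
        have sy: "set (outer_vars U zs ts) = (\<Union>a\<in>set ts. set (fst a)) - U - set zs" "distinct (outer_vars U zs ts)"
          unfolding outer_vars_def using fV by (simp_all only: set_sorted_list_of_set distinct_sorted_list_of_set)
        have "length (outer_vars U zs ts) \<le> k * length ts" using V by (intro length_outer_vars) auto
        also have "\<dots> \<le> k * M" using True ts by simp
        finally have len: "length (outer_vars U zs ts) \<le> k * M" .
        have "set (zs @ outer_vars U zs ts) \<subseteq> {..<n} - U" using sy(1) V zs(2) by fastforce
        moreover have "distinct (zs @ outer_vars U zs ts)" using sy zs(1) by auto
        ultimately have dm: "iid_mean con_pmf (m - t) (\<lambda>gs. of_bool (\<forall>a\<in>set gs. avoid U a) *
          dep {..<n} (list_wt gs) zs (outer_vars U zs ts)) \<le> ?\<delta>"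
          using c by (intro dep_mean[OF n fin _ bounds U _ _ len large \<kappa> inc[OF True]]) auto
        have "iid_mean con_pmf (m - t) (\<lambda>gs. of_bool (\<forall>a\<in>set gs. avoid U a) * ?h ts gs) =
          ?C * iid_mean con_pmf (m - t) (\<lambda>gs. of_bool (\<forall>a\<in>set gs. avoid U a) * dep {..<n} (list_wt gs) zs (outer_vars U zs ts))"
          unfolding iid_mean_cmult[symmetric] using True ts by (simp add: mult.left_commute)
        also have "\<dots> \<le> ?C * ?\<delta>" by (rule mult_left_mono[OF dm C0])
        finally show ?thesis using True by simp
      qed
    next
      show "0 \<le> (if t \<le> M then ?C * ?\<delta> else 2)" for t using C0 \<kappa> by simp
    qed
  qed simp
  also have "\<dots> \<le> (1 / real n ^ l) * (?C * ?\<delta> * exp touch_rate + 2 * (exp touch_rate - (\<Sum>t\<le>M. touch_rate ^ t / fact t)))"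
    using C0 \<kappa> c2 by (intro mult_left_mono exp_split_bound) auto
  finally show ?thesis .
qed

end

text \<open>The expected number of cavities of size \<open>l\<close> with \<open>f\<close> inner constraints has order
  \<open>n ^ (l - (k - 1) f)\<close>. The truncated subtraction is deliberate: for a nonpositive exponent
  the trivial lower bound of one cavity is used.\<close>

definition cav_sum :: "nat \<Rightarrow> nat \<Rightarrow> nat \<Rightarrow> nat \<Rightarrow> nat list \<Rightarrow> 'o::finite fg \<Rightarrow> real" where
  "cav_sum n k l r zs G = (\<Sum>U\<in>cav_set G l r. avg_err n G U zs / real n ^ (l - (k - 1) * card (inner G U)))"

definition fine_bound :: "nat \<Rightarrow> real \<Rightarrow> nat \<Rightarrow> real \<Rightarrow> nat \<Rightarrow> real \<Rightarrow> real" where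
  "fine_bound k c M \<kappa> q x =
     4 * (2 * c ^ 4) ^ M * (real (k * M) * (real q + 1) * \<kappa>) * exp x + 2 * (exp x - (\<Sum>t\<le>M. x ^ t / fact t))"

lemma cav_set_subsets:
  assumes "fst G = n"
  shows "cav_set G l r \<subseteq> {U. U \<subseteq> {..<n} \<and> card U = l}"
  using assms by (auto simp: cav_set_def cavity_def vars_def)

lemma binomial_le_power: "n choose r \<le> n ^ r"
  by (cases "r \<le> n") (auto intro: binomial_le_pow simp: binomial_eq_0)

lemma card_hitting:
  fixes n l :: nat
  assumes "1 \<le> l" "finite W"
  shows "card {U. U \<subseteq> {..<n} \<and> card U = l \<and> U \<inter> W \<noteq> {}} \<le> card W * n ^ (l - 1)"
proof -
  let ?S = "{U. U \<subseteq> {..<n} \<and> card U = l - 1}"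
  have finS: "finite ?S" by (rule finite_subset[of _ "Pow {..<n}"]) auto
  have "{U. U \<subseteq> {..<n} \<and> card U = l \<and> U \<inter> W \<noteq> {}} \<subseteq> (\<lambda>(w, U). insert w U) ` (W \<times> ?S)"
  proof
    fix U assume U: "U \<in> {U. U \<subseteq> {..<n} \<and> card U = l \<and> U \<inter> W \<noteq> {}}"
    then obtain w where w: "w \<in> U" "w \<in> W" by blast
    have "finite U" using U finite_subset[of U "{..<n}"] by auto
    then have "U - {w} \<in> ?S" "insert w (U - {w}) = U" using U w by auto
    then show "U \<in> (\<lambda>(w, U). insert w U) ` (W \<times> ?S)" 
      using w(2) by (intro image_eqI[of _ _ "(w, U - {w})"]) simp_all
  qed
  then have "card {U. U \<subseteq> {..<n} \<and> card U = l \<and> U \<inter> W \<noteq> {}} \<le> card ((\<lambda>(w, U). insert w U) ` (W \<times> ?S))"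
    using assms finS by (intro card_mono) auto
  also have "\<dots> \<le> card (W \<times> ?S)" using assms finS by (intro card_image_le) auto
  also have "\<dots> = card W * (n choose (l - 1))" using n_subsets[of "{..<n}" "l - 1"] by (simp add: card_cartesian_product)
  also have "\<dots> \<le> card W * n ^ (l - 1)" by (intro mult_left_mono binomial_le_power) simp
  finally show ?thesis .
qed

text \<open>At most \<theta> n^(l - 1) sets of size l meet the pinned vertices; each receives the
  crude bound of order n^(-l). All others, at most n^l in number, receive the fine bound.\<close>

lemma cav_sum_mean:
  fixes P :: "('o::finite list \<Rightarrow> real) pmf"
  assumes n: "0 < n" and fin: "finite (set_pmf P)" and k: "2 \<le> k" and c: "1 \<le> c"
    and bounds: "\<forall>\<psi>\<in>set_pmf P. \<forall>xs. length xs = k \<longrightarrow> 1 / c \<le> \<psi> xs \<and> \<psi> xs \<le> c"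
    and m: "real m \<le> c\<^sub>2 * real n" and c2: "0 \<le> c\<^sub>2" and l: "1 \<le> l"
    and large: "\<theta> + k * M + l < n" and \<kappa>: "0 < \<kappa>"
    and inc: "\<And>t. t \<le> M \<Longrightarrow> pin_mean k P n (m - t) l (\<theta> + k * M) - pin_mean k P n (m - t) l \<theta> \<le> \<kappa>\<^sup>2"
  shows "iid_mean (rand_con k P n) m (\<lambda>cs. cav_sum n k l r [0..<\<theta>] (n, cs)) \<le>
    fine_bound k c M \<kappa> CARD('o) (c\<^sub>2 * real (l ^ k + k * l)) + 2 * real \<theta> * exp (c\<^sub>2 * real (l ^ k + k * l)) / real n"
proof -
  let ?p = "rand_con k P n"
  let ?x = "c\<^sub>2 * real (l ^ k + k * l)"
  let ?zs = "[0..<\<theta>]"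
  let ?S = "{U. U \<subseteq> {..<n} \<and> card U = l}"
  let ?H = "{U. U \<subseteq> {..<n} \<and> card U = l \<and> U \<inter> {0..<\<theta>} \<noteq> {}}"
  let ?D = "{U. U \<subseteq> {..<n} \<and> card U = l \<and> U \<inter> {0..<\<theta>} = {}}"
  let ?f = "fine_bound k c M \<kappa> CARD('o) ?x"
  let ?h = "\<lambda>U cs. of_bool (U \<in> cav_set (n, cs) l r) *
    (avg_err n (n, cs) U ?zs / real n ^ (l - (k - 1) * card (inner (n, cs) U)))"
  have finS: "finite ?S" by (rule finite_subset[of _ "Pow {..<n}"]) auto
  have finH: "finite ?H" by (rule finite_subset[OF _ finS]) auto
  have finD: "finite ?D" by (rule finite_subset[OF _ finS]) auto
  have f0: "0 \<le> ?f"
    using exp_partial_sum[of ?x "{..M}"] c2 c \<kappa> unfolding fine_bound_def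
    by (intro add_nonneg_nonneg mult_nonneg_nonneg) auto
  have "cav_sum n k l r ?zs (n, cs) = (\<Sum>U\<in>?S. ?h U cs)" for cs :: "(nat list \<times> ('o list \<Rightarrow> real)) list"
  proof -
    have sub: "cav_set (n, cs) l r \<subseteq> ?S" by (rule cav_set_subsets) simp
    have "(\<Sum>U\<in>?S. ?h U cs) = (\<Sum>U\<in>cav_set (n, cs) l r. ?h U cs)"
      by (rule sum.mono_neutral_right[OF finS sub]) auto
    then show ?thesis by (simp add: cav_sum_def)
  qed
  then have "iid_mean ?p m (\<lambda>cs. cav_sum n k l r ?zs (n, cs)) = (\<Sum>U\<in>?S. iid_mean ?p m (?h U))"
    by (simp only: iid_mean_sum)
  moreover have "?S = ?H \<union> ?D" by auto
  moreover have "(\<Sum>U\<in>?H \<union> ?D. iid_mean ?p m (?h U)) = (\<Sum>U\<in>?H. iid_mean ?p m (?h U)) + (\<Sum>U\<in>?D. iid_mean ?p m (?h U))"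
    by (rule sum.union_disjoint[OF finH finD]) auto
  moreover have "(\<Sum>U\<in>?H. iid_mean ?p m (?h U)) \<le> 2 * real \<theta> * exp ?x / real n"
  proof -
  have "(\<Sum>U\<in>?H. iid_mean ?p m (?h U)) \<le> (\<Sum>U\<in>?H. (1 / real n ^ l) * (2 * exp ?x))"
    by (intro sum_mono cav_term_mean_crude[OF n fin k c bounds m c2]) auto
  also have "\<dots> = real (card ?H) * ((1 / real n ^ l) * (2 * exp ?x))" by simp
  also have "\<dots> \<le> (real \<theta> * real n ^ (l - 1)) * ((1 / real n ^ l) * (2 * exp ?x))"
  proof (rule mult_right_mono)
    have "card ?H \<le> card {0..<\<theta>} * n ^ (l - 1)" by (rule card_hitting[OF l]) simp
    then have "real (card ?H) \<le> real (card {0..<\<theta>} * n ^ (l - 1))" by (rule of_nat_mono)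
    then show "real (card ?H) \<le> real \<theta> * real n ^ (l - 1)" by simp
  qed simp
  also have "\<dots> = 2 * real \<theta> * exp ?x / real n"
    using n l by (cases l) (auto simp: field_simps)
  finally show ?thesis .
  qed
  moreover have "(\<Sum>U\<in>?D. iid_mean ?p m (?h U)) \<le> ?f"
  proof -
  have "(\<Sum>U\<in>?D. iid_mean ?p m (?h U)) \<le> (\<Sum>U\<in>?D. (1 / real n ^ l) * ?f)"
  proof (rule sum_mono)
    fix U assume U: "U \<in> ?D"
    have "{0..<\<theta>} \<subseteq> {..<n} - U" using U large by auto
    then show "iid_mean ?p m (?h U) \<le> (1 / real n ^ l) * ?f"
      unfolding fine_bound_def using U large inc
      by (intro cav_term_mean_fine[OF n fin k c bounds m c2 _ _ _ _ _ \<kappa>]) auto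
  qed
  also have "\<dots> = real (card ?D) * ((1 / real n ^ l) * ?f)" by simp
  also have "\<dots> \<le> real n ^ l * ((1 / real n ^ l) * ?f)"
  proof (rule mult_right_mono)
    have "card ?D \<le> card ?S" by (rule card_mono[OF finS]) auto
    also have "\<dots> = n choose l" using n_subsets[of "{..<n}" l] by simp
    also have "\<dots> \<le> n ^ l" by (rule binomial_le_power)
    finally show "real (card ?D) \<le> real n ^ l" by (simp flip: of_nat_power)
  qed (use f0 in simp)
  also have "\<dots> = ?f" using n by simp
  finally show ?thesis .
  qed
  ultimately show ?thesis by (simp only:)
qed

section \<open>Selecting the Bethe states\<close>

text \<open>The event of the theorem, with accuracy, range and number of states as parameters that
  can later vary with n.\<close>

definition good_states :: "real \<Rightarrow> nat \<Rightarrow> nat \<Rightarrow> 'o fg \<Rightarrow> bool" where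
  "good_states e K L G \<longleftrightarrow> (\<exists>(l :: nat) (Ss :: nat \<Rightarrow> (nat \<Rightarrow> 'o) set).
     1 \<le> l \<and> l \<le> L \<and>
     (\<forall>j<l. Ss j \<noteq> {} \<and> Ss j \<subseteq> configs (vars G)) \<and>
     (\<forall>i<l. \<forall>j<l. i \<noteq> j \<longrightarrow> Ss i \<inter> Ss j = {}) \<and>
     (\<Sum>j<l. gibbs_set G (Ss j)) \<ge> 1 - e \<and>
     (\<forall>j<l. \<forall>ell. 1 \<le> ell \<and> ell \<le> K \<longrightarrow> bethe_state G e ell (Ss j)))"

lemma good_states_mono: "good_states e K L G \<Longrightarrow> L \<le> L' \<Longrightarrow> good_states e K L' G"
  unfolding good_states_def
proof (elim exE)
  fix l Ss assume "1 \<le> l \<and> l \<le> L \<and> (\<forall>j<l. Ss j \<noteq> {} \<and> Ss j \<subseteq> configs (vars G)) \<and>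
     (\<forall>i<l. \<forall>j<l. i \<noteq> j \<longrightarrow> Ss i \<inter> Ss j = {}) \<and> (\<Sum>j<l. gibbs_set G (Ss j)) \<ge> 1 - e \<and>
     (\<forall>j<l. \<forall>ell. 1 \<le> ell \<and> ell \<le> K \<longrightarrow> bethe_state G e ell (Ss j))" and "L \<le> L'"
  then show "\<exists>l Ss. 1 \<le> l \<and> l \<le> L' \<and> (\<forall>j<l. Ss j \<noteq> {} \<and> Ss j \<subseteq> configs (vars G)) \<and>
     (\<forall>i<l. \<forall>j<l. i \<noteq> j \<longrightarrow> Ss i \<inter> Ss j = {}) \<and> (\<Sum>j<l. gibbs_set G (Ss j)) \<ge> 1 - e \<and>
     (\<forall>j<l. \<forall>ell. 1 \<le> ell \<and> ell \<le> K \<longrightarrow> bethe_state G e ell (Ss j))"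
    by (intro exI[of _ l] exI[of _ Ss]) simp
qed

lemma card_vecs: "card (vecs j :: 'o::finite list set) = CARD('o) ^ j"
  using card_lists_length_eq[of "UNIV :: 'o set" j] by (simp add: vecs_def)

context valid_graph
begin

lemma bethe_err_nonneg: "0 \<le> bethe_err G U S"
  by (simp add: bethe_err_def sum_nonneg)

lemma avg_err_nonneg: "0 \<le> avg_err n G U zs"
  unfolding avg_err_def by (intro sum_nonneg mult_nonneg_nonneg gibbs_set_nonneg bethe_err_nonneg)

lemma cav_sum_nonneg: "0 \<le> cav_sum n k l r zs G"
  unfolding cav_sum_def by (intro sum_nonneg divide_nonneg_nonneg avg_err_nonneg) simp

lemma finite_cav_set: "finite (cav_set G l r)"
proof -
  have "fst G = n" using valid by (simp add: valid_fg_def)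
  then show ?thesis
    by (rule finite_subset[OF cav_set_subsets]) (rule finite_subset[of _ "Pow {..<n}"], auto)
qed

text \<open>Markov's inequality over the pinned value, drawn from the Gibbs measure: for each pair
  (l, r) the subcubes with error at least \<open>e\<close> times the number of cavities carry little
  mass. By \<open>X\<close> every power of n in \<open>cav_sum\<close> is at most 1 / \<gamma> times
  that number, which turns the bound on \<open>cav_sum\<close> into one on the relative error.
  Discarding bad and empty subcubes leaves mass at least 1 - e, hence at least one state.\<close>

lemma states_exist:
  assumes \<gamma>: "0 < \<gamma>" and e: "0 < e" "e < 1"
    and X: "\<And>l r U. 1 \<le> l \<Longrightarrow> l \<le> K \<Longrightarrow> U \<in> cav_set G l r \<Longrightarrow>
      \<gamma> * real n ^ (l - (k - 1) * card (inner G U)) \<le> real (card (cav_set G l r))"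
    and Z: "\<And>l r. 1 \<le> l \<Longrightarrow> l \<le> K \<Longrightarrow> r \<le> K \<Longrightarrow> cav_sum n k l r zs G \<le> \<zeta>"
    and \<zeta>: "real ((K + 1) ^ 2) * \<zeta> \<le> \<gamma> * e\<^sup>2"
    and L: "CARD('o) ^ length zs \<le> L"
  shows "good_states e K L G"
proof -
  let ?F = "fibre n zs"
  let ?\<mu> = "\<lambda>\<tau>. gibbs_set G (?F \<tau>)"
  let ?TS = "vecs (length zs) :: 'o list set"
  define bad where "bad = (\<lambda>(l, r) \<tau>. cav_set G l r \<noteq> {} \<and>
    e * real (card (cav_set G l r)) \<le> (\<Sum>U\<in>cav_set G l r. bethe_err G U (?F \<tau>)))"
  define I where "I = {1..K} \<times> {..K}"
  define Gd where "Gd = {\<tau>\<in>?TS. ?F \<tau> \<noteq> {} \<and> (\<forall>i\<in>I. \<not> bad i \<tau>)}"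
  have finI: "finite I" by (simp add: I_def)
  have finG: "finite Gd" by (simp add: Gd_def)
  have mass: "(\<Sum>\<tau>\<in>?TS. ?\<mu> \<tau> * of_bool (bad i \<tau>)) \<le> \<zeta> / (\<gamma> * e)" if iI: "i \<in> I" for i
  proof -
    obtain l r where i: "i = (l, r)" "1 \<le> l" "l \<le> K" "r \<le> K" using iI by (auto simp: I_def)
    let ?C = "cav_set G l r"
    have \<zeta>0: "0 \<le> \<zeta>" using Z[OF i(2-4)] cav_sum_nonneg[of l r zs] by linarith
    show ?thesis
    proof (cases "?C = {}")
      case True
      then have "\<not> bad i \<tau>" for \<tau> by (simp add: bad_def i)
      then show ?thesis using \<zeta>0 \<gamma> e by simp
    next
      case False
      then have C0: "0 < real (card ?C)" using finite_cav_set by (simp add: card_gt_0_iff)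
      have "(\<Sum>\<tau>\<in>?TS. ?\<mu> \<tau> * of_bool (bad i \<tau>)) \<le> (\<Sum>\<tau>\<in>?TS. ?\<mu> \<tau> * ((\<Sum>U\<in>?C. bethe_err G U (?F \<tau>)) / (e * real (card ?C))))"
      proof (intro sum_mono mult_left_mono gibbs_set_nonneg)
        fix \<tau>
        have "0 \<le> (\<Sum>U\<in>?C. bethe_err G U (?F \<tau>)) / (e * real (card ?C))"
          using e by (intro divide_nonneg_nonneg sum_nonneg bethe_err_nonneg) auto
        then show "of_bool (bad i \<tau>) \<le> (\<Sum>U\<in>?C. bethe_err G U (?F \<tau>)) / (e * real (card ?C))"
          using e C0 by (auto simp: bad_def i of_bool_def)
      qed
      also have "\<dots> = (\<Sum>U\<in>?C. avg_err n G U zs) / (e * real (card ?C))"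
      proof -
        have "(\<Sum>\<tau>\<in>?TS. ?\<mu> \<tau> * ((\<Sum>U\<in>?C. bethe_err G U (?F \<tau>)) / (e * real (card ?C)))) =
          (\<Sum>\<tau>\<in>?TS. \<Sum>U\<in>?C. ?\<mu> \<tau> * bethe_err G U (?F \<tau>)) / (e * real (card ?C))"
          by (simp add: sum_divide_distrib sum_distrib_left)
        then show ?thesis unfolding avg_err_def by (simp only: sum.swap[of _ ?C])
      qed
      also have "\<dots> \<le> (real (card ?C) * (\<zeta> / \<gamma>)) / (e * real (card ?C))"
      proof (rule divide_right_mono)
        have "(\<Sum>U\<in>?C. avg_err n G U zs) \<le> (\<Sum>U\<in>?C. (avg_err n G U zs / real n ^ (l - (k - 1) * card (inner G U))) * (real (card ?C) / \<gamma>))"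
        proof (rule sum_mono)
          fix U assume U: "U \<in> ?C"
          let ?N = "real n ^ (l - (k - 1) * card (inner G U))"
          have N: "0 < ?N" using n0 by simp
          have cancel: "a / b * b = a" if "0 < b" for a b :: real using that by simp
          have "?N \<le> real (card ?C) / \<gamma>" using X[OF i(2,3) U] \<gamma> by (simp add: pos_le_divide_eq mult.commute)
          then have "avg_err n G U zs / ?N * ?N \<le> avg_err n G U zs / ?N * (real (card ?C) / \<gamma>)"
            using N by (intro mult_left_mono divide_nonneg_nonneg avg_err_nonneg) auto
          then show "avg_err n G U zs \<le> avg_err n G U zs / ?N * (real (card ?C) / \<gamma>)"
            unfolding cancel[OF N] .
        qed
        also have "\<dots> = cav_sum n k l r zs G * (real (card ?C) / \<gamma>)" by (simp only: cav_sum_def sum_distrib_right)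
        also have "\<dots> \<le> \<zeta> * (real (card ?C) / \<gamma>)" using Z[OF i(2-4)] \<gamma> by (intro mult_right_mono) auto
        finally show "(\<Sum>U\<in>?C. avg_err n G U zs) \<le> real (card ?C) * (\<zeta> / \<gamma>)" by (simp add: mult.commute)
      qed (use e in simp)
      also have "\<dots> = \<zeta> / (\<gamma> * e)" using C0 e \<gamma> by (simp add: field_simps)
      finally show ?thesis .
    qed
  qed
  have "1 - (\<Sum>\<tau>\<in>Gd. ?\<mu> \<tau>) = (\<Sum>\<tau>\<in>?TS - Gd. ?\<mu> \<tau>)"
    using gibbs_fibre_sum[of zs] by (subst sum_diff) (auto simp: Gd_def)
  also have "\<dots> \<le> (\<Sum>\<tau>\<in>?TS - Gd. \<Sum>i\<in>I. ?\<mu> \<tau> * of_bool (bad i \<tau>))"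
  proof (rule sum_mono)
    fix \<tau> assume t: "\<tau> \<in> ?TS - Gd"
    have nn: "0 \<le> ?\<mu> \<tau> * of_bool (bad i \<tau>)" for i by (intro mult_nonneg_nonneg gibbs_set_nonneg) simp
    show "?\<mu> \<tau> \<le> (\<Sum>i\<in>I. ?\<mu> \<tau> * of_bool (bad i \<tau>))"
    proof (cases "?F \<tau> = {}")
      case True
      then have "?\<mu> \<tau> = 0" by (simp add: gibbs_set_def)
      then show ?thesis by simp
    next
      case False
      then obtain i where i: "i \<in> I" "bad i \<tau>" using t by (auto simp: Gd_def)
      then have "?\<mu> \<tau> = ?\<mu> \<tau> * of_bool (bad i \<tau>)" by simp
      also have "\<dots> \<le> (\<Sum>i\<in>I. ?\<mu> \<tau> * of_bool (bad i \<tau>))" by (rule member_le_sum[OF i(1) nn finI])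
      finally show ?thesis .
    qed
  qed
  also have "\<dots> \<le> (\<Sum>\<tau>\<in>?TS. \<Sum>i\<in>I. ?\<mu> \<tau> * of_bool (bad i \<tau>))"
    by (rule sum_mono2) (auto intro!: sum_nonneg mult_nonneg_nonneg gibbs_set_nonneg)
  also have "\<dots> = (\<Sum>i\<in>I. \<Sum>\<tau>\<in>?TS. ?\<mu> \<tau> * of_bool (bad i \<tau>))" by (rule sum.swap)
  also have "\<dots> \<le> (\<Sum>i\<in>I. \<zeta> / (\<gamma> * e))" by (rule sum_mono[OF mass])
  also have "\<dots> = real (K * (K + 1)) * \<zeta> / (\<gamma> * e)" by (simp add: I_def card_cartesian_product)
  \<comment> \<open>The assumption on \<zeta> is tailored to this union over at most (K + 1)^2
    pairs.\<close>
  also have "\<dots> \<le> e"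
  proof (cases "K = 0")
    case False
    then have "0 \<le> \<zeta>" using Z[of 1 0] cav_sum_nonneg[of 1 0 zs] by simp
    then have "real (K * (K + 1)) * \<zeta> \<le> real ((K + 1) ^ 2) * \<zeta>"
      by (intro mult_right_mono) (auto simp: power2_eq_square)
    then show ?thesis using \<zeta> \<gamma> e by (simp add: pos_divide_le_eq power2_eq_square mult_ac)
  qed (use e in simp)
  finally have total: "1 - e \<le> (\<Sum>\<tau>\<in>Gd. ?\<mu> \<tau>)" by linarith
  then have "Gd \<noteq> {}" using e by auto
  then have card1: "1 \<le> card Gd" using finG by (simp add: Suc_le_eq card_gt_0_iff)
  have "card Gd \<le> card ?TS" by (rule card_mono) (auto simp: Gd_def)
  then have cardL: "card Gd \<le> L" using L by (simp add: card_vecs)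
  obtain h where h: "bij_betw h {..<card Gd} Gd" using ex_bij_betw_nat_finite[OF finG] by (auto simp: atLeast0LessThan)
  have hG: "h j \<in> Gd" if "j < card Gd" for j using h that by (auto simp: bij_betw_def)
  have inj: "h i \<noteq> h j" if "i < card Gd" "j < card Gd" "i \<noteq> j" for i j
    using h that by (auto simp: bij_betw_def inj_on_def)
  have bs: "bethe_state G e ell (?F \<tau>)" if \<tau>: "\<tau> \<in> Gd" and ell: "ell \<le> K" for \<tau> ell
    unfolding bethe_state_def
  proof (intro allI impI)
    fix l r assume a: "1 \<le> r \<and> r \<le> l \<and> l \<le> ell \<and> cav_set G l r \<noteq> {}"
    then have "(l, r) \<in> I" using ell by (auto simp: I_def)
    then have "\<not> bad (l, r) \<tau>" using \<tau> by (auto simp: Gd_def)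
    then show "(\<Sum>U\<in>cav_set G l r. \<Sum>\<sigma>\<in>configs U. \<bar>marg_cond G U (?F \<tau>) \<sigma> - bar_mu G U (?F \<tau>) \<sigma>\<bar>)
      < e * real (card (cav_set G l r))"
      using a by (simp add: bad_def bethe_err_def not_le)
  qed
  show ?thesis
    unfolding good_states_def
  proof (intro exI[of _ "card Gd"] exI[of _ "\<lambda>j. ?F (h j)"] conjI allI impI)
    show "?F (h j) \<noteq> {}" if "j < card Gd" for j using hG[OF that] by (simp add: Gd_def)
    show "?F (h j) \<subseteq> configs (vars G)" if "j < card Gd" for j by (auto simp: fibre_def vars_G)
    show "?F (h i) \<inter> ?F (h j) = {}" if "i < card Gd" "j < card Gd" "i \<noteq> j" for i j
      using inj[OF that] by (auto simp: fibre_def)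
    show "1 - e \<le> (\<Sum>j<card Gd. gibbs_set G (?F (h j)))"
      using total sum.reindex_bij_betw[OF h, of ?\<mu>] by simp
    show "bethe_state G e ell (?F (h j))" if "j < card Gd" "1 \<le> ell \<and> ell \<le> K" for j ell
      using bs[OF hG[OF that(1)]] that(2) by blast
  qed (use card1 cardL in auto)
qed

end

section \<open>Poisson concentration\<close>

text \<open>Markov's inequality for s^m, whose Poisson mean is exp (rate (s - 1)). Values s < 1 and
  s > 1 give the two tails.\<close>

lemma poisson_markov:
  assumes rate: "0 < rate" and s: "0 < s" and a: "0 < a" and A: "\<And>m. m \<in> A \<Longrightarrow> a \<le> s ^ m"
  shows "measure_pmf.prob (poisson_pmf rate) A \<le> exp (rate * (s - 1)) / a"
proof -
  have sums: "(\<lambda>m. rate ^ m / fact m * exp (- rate) * s ^ m) sums exp (rate * (s - 1))"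
  proof -
    have "(\<lambda>m. exp (- rate) * ((rate * s) ^ m /\<^sub>R fact m)) sums (exp (- rate) * exp (rate * s))"
      by (intro sums_mult exp_converges)
    moreover have "exp (- rate) * exp (rate * s) = exp (rate * (s - 1))"
      by (simp add: exp_add[symmetric] algebra_simps)
    moreover have "(\<lambda>m. exp (- rate) * ((rate * s) ^ m /\<^sub>R fact m)) = (\<lambda>m. rate ^ m / fact m * exp (- rate) * s ^ m)"
      by (simp add: fun_eq_iff power_mult_distrib divide_inverse mult_ac)
    ultimately show ?thesis by simp
  qed
  have "emeasure (measure_pmf (poisson_pmf rate)) A = (\<integral>\<^sup>+m. indicator A m \<partial>measure_pmf (poisson_pmf rate))" by simp
  also have "\<dots> \<le> (\<integral>\<^sup>+m. ennreal (s ^ m / a) \<partial>measure_pmf (poisson_pmf rate))"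
  proof (rule nn_integral_mono)
    fix m
    show "indicator A m \<le> ennreal (s ^ m / a)"
      using A[of m] a s by (cases "m \<in> A") (auto simp: ennreal_1[symmetric] pos_le_divide_eq simp del: ennreal_1)
  qed
  also have "\<dots> = (\<Sum>m. ennreal (rate ^ m / fact m * exp (- rate) * s ^ m / a))"
    using rate s a
    by (simp add: nn_integral_measure_pmf nn_integral_count_space_nat ennreal_mult'[symmetric])
  also have "\<dots> = ennreal (exp (rate * (s - 1)) / a)"
    using rate s a sums_divide[OF sums, of a] by (intro suminf_ennreal_eq) auto
  finally show ?thesis using a by (simp add: measure_pmf.emeasure_eq_measure)
qed

lemma poisson_range:
  assumes d: "0 < d" and k: "0 < (k :: nat)" and \<eta>: "0 < \<eta>"
  shows "\<exists>c\<^sub>1>0. \<exists>c\<^sub>2>0. \<exists>n\<^sub>0. \<forall>n\<ge>n\<^sub>0. 1 - \<eta> \<le>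
    measure_pmf.prob (poisson_pmf (d * real n / real k)) {m. c\<^sub>1 * real n \<le> real m \<and> real m \<le> c\<^sub>2 * real n}"
proof -
  define b where "b = d / real k"
  have b: "0 < b" using d k by (simp add: b_def)
  \<comment> \<open>With s = 1/2 and s = 2 the means of s^m are exp (- b n / 2) and exp (b n);
    dividing by ln 2 makes the thresholds for s^m equal to exp (- b n / 4) and exp (2 b n).\<close>
  define c\<^sub>1 where "c\<^sub>1 = b / (4 * ln 2)"
  define c\<^sub>2 where "c\<^sub>2 = 2 * b / ln 2"
  have l2: "0 < ln (2 :: real)" by simp
  have c: "0 < c\<^sub>1" "0 < c\<^sub>2" using b l2 by (auto simp: c\<^sub>1_def c\<^sub>2_def)
  have "((\<lambda>n. exp (- (b / 4) * real n) + exp (- b * real n)) \<longlongrightarrow> 0) sequentially"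
    using b by real_asymp
  then have "eventually (\<lambda>n. exp (- (b / 4) * real n) + exp (- b * real n) < \<eta>) sequentially"
    using \<eta> by (simp add: order_tendsto_iff)
  then obtain n\<^sub>0 where n\<^sub>0: "\<And>n. n \<ge> n\<^sub>0 \<Longrightarrow> exp (- (b / 4) * real n) + exp (- b * real n) < \<eta>"
    by (auto simp: eventually_sequentially)
  have "1 - \<eta> \<le> measure_pmf.prob (poisson_pmf (d * real n / real k)) {m. c\<^sub>1 * real n \<le> real m \<and> real m \<le> c\<^sub>2 * real n}"
    if n: "n \<ge> max 1 n\<^sub>0" for n
  proof -
    let ?r = "b * real n"
    let ?M = "poisson_pmf ?r"
    have n1: "0 < real n" using n by simp
    have r: "0 < ?r" using b n1 by simp
    have req: "d * real n / real k = ?r" by (simp add: b_def)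
    have lo: "measure_pmf.prob ?M {m. real m < c\<^sub>1 * real n} \<le> exp (- (b / 4) * real n)"
    proof -
      have "measure_pmf.prob ?M {m. real m < c\<^sub>1 * real n} \<le> exp (?r * (1 / 2 - 1)) / exp (- (b / 4) * real n)"
      proof (rule poisson_markov[OF r])
        fix m assume "m \<in> {m. real m < c\<^sub>1 * real n}"
        then have "real m * ln 2 \<le> c\<^sub>1 * real n * ln 2" using l2 by (intro mult_right_mono) auto
        also have "\<dots> = b / 4 * real n" by (simp add: c\<^sub>1_def)
        finally have "exp (- (b / 4) * real n) \<le> exp (- (real m * ln 2))" by simp
        also have "\<dots> = (1 / 2) ^ m"
          by (simp add: exp_minus exp_of_nat_mult power_one_over inverse_eq_divide)
        finally show "exp (- (b / 4) * real n) \<le> (1 / 2) ^ m" .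
      qed auto
      also have "\<dots> = exp (- (b / 4) * real n)" by (simp add: exp_diff[symmetric])
      finally show ?thesis .
    qed
    have hi: "measure_pmf.prob ?M {m. c\<^sub>2 * real n < real m} \<le> exp (- b * real n)"
    proof -
      have "measure_pmf.prob ?M {m. c\<^sub>2 * real n < real m} \<le> exp (?r * (2 - 1)) / exp (2 * b * real n)"
      proof (rule poisson_markov[OF r])
        fix m assume "m \<in> {m. c\<^sub>2 * real n < real m}"
        then have "c\<^sub>2 * real n * ln 2 \<le> real m * ln 2" using l2 by (intro mult_right_mono) auto
        moreover have "c\<^sub>2 * real n * ln 2 = 2 * b * real n" by (simp add: c\<^sub>2_def)
        ultimately have "exp (2 * b * real n) \<le> exp (real m * ln 2)" by simp
        also have "\<dots> = 2 ^ m" by (simp add: exp_of_nat_mult)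
        finally show "exp (2 * b * real n) \<le> 2 ^ m" .
      qed auto
      also have "\<dots> = exp (- b * real n)" by (simp add: exp_diff[symmetric])
      finally show ?thesis .
    qed
    let ?R = "{m. c\<^sub>1 * real n \<le> real m \<and> real m \<le> c\<^sub>2 * real n}"
    have "1 - measure_pmf.prob ?M ?R = measure_pmf.prob ?M (- ?R)"
      using measure_pmf.prob_compl[of ?R ?M] by (simp add: Compl_eq_Diff_UNIV)
    also have "\<dots> \<le> measure_pmf.prob ?M ({m. real m < c\<^sub>1 * real n} \<union> {m. c\<^sub>2 * real n < real m})"
      by (rule measure_pmf.finite_measure_mono) auto
    also have "\<dots> \<le> measure_pmf.prob ?M {m. real m < c\<^sub>1 * real n} + measure_pmf.prob ?M {m. c\<^sub>2 * real n < real m}"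
      by (rule measure_Un_le) auto
    also have "\<dots> < \<eta>" using lo hi n\<^sub>0[of n] n by simp
    finally show ?thesis unfolding req by linarith
  qed
  then show ?thesis using c by blast
qed

section \<open>Asymptotic estimates\<close>

text \<open>The exponential series converges, and only finitely many rates occur, so that one
  cut-off serves them all.\<close>

lemma fine_bound_choice:
  assumes \<omega>: "0 < \<omega>" and c2: "0 \<le> c\<^sub>2"
  shows "\<exists>M. \<forall>l\<le>K. 2 * (exp (c\<^sub>2 * real (l ^ k + k * l)) - (\<Sum>t\<le>M. (c\<^sub>2 * real (l ^ k + k * l)) ^ t / fact t)) \<le> \<omega>"
proof -
  have "\<forall>\<^sub>F M in sequentially. 2 * (exp x - (\<Sum>t\<le>M. x ^ t / fact t)) \<le> \<omega>" for x :: real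
  proof -
    have "(\<lambda>t. x ^ t / fact t) sums exp x" using exp_converges[of x] by (simp add: divide_inverse mult.commute)
    then have "(\<lambda>M. \<Sum>t\<le>M. x ^ t / fact t) \<longlonglongrightarrow> exp x" by (simp add: sums_def_le)
    then have "(\<lambda>M. 2 * (exp x - (\<Sum>t\<le>M. x ^ t / fact t))) \<longlonglongrightarrow> 2 * (exp x - exp x)"
      by (intro tendsto_intros)
    then have "\<forall>\<^sub>F M in sequentially. 2 * (exp x - (\<Sum>t\<le>M. x ^ t / fact t)) < \<omega>"
      using \<omega> by (simp add: order_tendsto_iff)
    then show ?thesis by (rule eventually_mono) simp
  qed
  then have "\<forall>\<^sub>F M in sequentially. \<forall>l\<in>{..K}. 2 * (exp (c\<^sub>2 * real (l ^ k + k * l)) - (\<Sum>t\<le>M. (c\<^sub>2 * real (l ^ k + k * l)) ^ t / fact t)) \<le> \<omega>"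
    by (intro eventually_ball_finite) auto
  from eventually_happens'[OF sequentially_bot this]
  obtain M where M: "\<forall>l\<in>{..K}. 2 * (exp (c\<^sub>2 * real (l ^ k + k * l)) - (\<Sum>t\<le>M. (c\<^sub>2 * real (l ^ k + k * l)) ^ t / fact t)) \<le> \<omega>" by blast
  show ?thesis
  proof (intro exI allI impI)
    fix l assume "l \<le> K"
    then have "l \<in> {..K}" by simp
    then show "2 * (exp (c\<^sub>2 * real (l ^ k + k * l)) - (\<Sum>t\<le>M. (c\<^sub>2 * real (l ^ k + k * l)) ^ t / fact t)) \<le> \<omega>"
      by (rule bspec[OF M])
  qed
qed

text \<open>Rounds the linear number of stars and absorbs all constants. Capping the base at 1 lets
  the exponent, at most \<open>K\<close>, be replaced by \<open>K\<close> in the constant.\<close>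

lemma cavities_abundant:
  assumes vg: "valid_graph k n c (n, cs)" and k: "2 \<le> k" and a: "0 < a"
    and stars: "\<And>f. f \<le> K \<Longrightarrow> a * real n \<le> real (card (stars n k f cs))"
    and large: "2 + 4 * real K \<le> a * real n"
    and l: "1 \<le> l" "l \<le> K" and U: "U \<in> cav_set (n, cs) l r"
  shows "(min 1 (a / (2 * real K)) ^ K / 4 ^ K) * real n ^ (l - (k - 1) * card (inner (n, cs) U)) \<le> real (card (cav_set (n, cs) l r))"
proof -
  interpret valid_graph k n c "(n, cs)" by (rule vg)
  define N where "N = nat \<lfloor>a * real n\<rfloor>"
  let ?b = "min 1 (a / (2 * real K))"
  let ?p = "l - (k - 1) * card (inner (n, cs) U)"
  have N: "real N \<le> a * real n" "a * real n - 1 \<le> real N" using large by (auto simp: N_def)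
  have lK: "real l \<le> real K" "0 < real l" using l by auto
  have N3: "3 * l \<le> N"
  proof -
    have "3 * real l \<le> real N" using N large lK by linarith
    then show ?thesis by linarith
  qed
  have Nb: "N \<le> card (blobs n (n, cs) (1 + (k - 1) * f))" if "f \<le> l" for f
  proof -
    have "real N \<le> real (card (stars n k f cs))" using stars[of f] that l N by linarith
    also have "card (stars n k f cs) \<le> card (blobs n (n, cs) (1 + (k - 1) * f))"
      using stars_sub_blobs[OF vg k] finite_blobs by (intro card_mono) auto
    finally show ?thesis by simp
  qed
  have b0: "0 \<le> ?b" "?b \<le> 1" using a by auto
  have "a * real n / 2 \<le> real N - 2 * real l" using N large lK by linarith
  moreover have "real (N - 2 * l) = real N - 2 * real l" using N3 by (simp add: of_nat_diff)
  ultimately have "a * real n / 2 / real K \<le> real (N - 2 * l) / real l"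
    using lK a by (intro frac_le) auto
  moreover have "?b * real n \<le> a / (2 * real K) * real n" by (intro mult_right_mono) auto
  ultimately have base: "?b * real n \<le> real (N - 2 * l) / real l" by simp
  have "?b ^ K * real n ^ ?p \<le> ?b ^ ?p * real n ^ ?p"
    using b0 l by (intro mult_right_mono power_decreasing) auto
  also have "\<dots> = (?b * real n) ^ ?p" by (simp add: power_mult_distrib)
  also have "\<dots> \<le> (real (N - 2 * l) / real l) ^ ?p" using base b0 by (intro power_mono) auto
  also have "\<dots> \<le> 4 ^ l * real (card (cav_set (n, cs) l r))" by (rule card_cavities[OF U l(1) Nb N3 k])
  also have "\<dots> \<le> 4 ^ K * real (card (cav_set (n, cs) l r))"
    using l by (intro mult_right_mono power_increasing) auto
  finally show ?thesis by (simp add: pos_divide_le_eq mult.commute)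
qed

text \<open>The constants are chosen one after the other: star density \<open>a0\<close>, then
  \<open>\<gamma>\<close>, \<open>\<zeta>\<close>, \<open>\<omega>\<close>, the cut-off
  \<open>M\<close>, \<open>\<kappa>\<close>, the number \<open>J\<close> of stretches, and only then
  the threshold for n. The bound \<open>L\<close> on the number of states is therefore independent
  of n and m.\<close>

lemma good_states_fixed_m:
  fixes P :: "('o::finite list \<Rightarrow> real) pmf"
  assumes k: "2 \<le> k" and fin: "finite (set_pmf P)" and c: "1 \<le> c"
    and bounds: "\<forall>\<psi>\<in>set_pmf P. \<forall>xs. length xs = k \<longrightarrow> 1 / c \<le> \<psi> xs \<and> \<psi> xs \<le> c"
    and c12: "0 < c\<^sub>1" "0 < c\<^sub>2" and e: "0 < e" "e < 1" and \<eta>: "0 < \<eta>"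
  shows "\<exists>L n\<^sub>0. \<forall>n\<ge>n\<^sub>0. \<forall>m. c\<^sub>1 * real n \<le> real m \<longrightarrow> real m \<le> c\<^sub>2 * real n \<longrightarrow>
    1 - \<eta> \<le> measure_pmf.prob (iid_list m (rand_con k P n)) {cs. good_states e K L (n, cs)}"
proof -
  have "\<forall>f. \<exists>a>0. \<exists>C n\<^sub>0. \<forall>n\<ge>n\<^sub>0. \<forall>m. c\<^sub>1 * real n \<le> real m \<longrightarrow> real m \<le> c\<^sub>2 * real n \<longrightarrow>
    measure_pmf.prob (iid_list m (rand_con k P n)) {cs. real (card (stars n k f cs)) < a * real n} \<le> C / real n"
    using stars_abundant[OF k fin c bounds c12] by blast
  then obtain a C N where aCN: "\<And>f. 0 < a f" "\<And>f n m. N f \<le> n \<Longrightarrow> c\<^sub>1 * real n \<le> real m \<Longrightarrow> real m \<le> c\<^sub>2 * real n \<Longrightarrow>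
    measure_pmf.prob (iid_list m (rand_con k P n)) {cs. real (card (stars n k f cs)) < a f * real n} \<le> C f / real n"
    by metis
  define a0 where "a0 = Min (a ` {..K})"
  have a0: "0 < a0" "\<And>f. f \<le> K \<Longrightarrow> a0 \<le> a f" using aCN(1) by (auto simp: a0_def)
  define \<gamma> where "\<gamma> = min 1 (a0 / (2 * real K)) ^ K / 4 ^ K"
  have \<gamma>: "0 < \<gamma>" using a0 by (cases "K = 0") (auto simp: \<gamma>_def)
  define \<zeta> where "\<zeta> = \<gamma> * e\<^sup>2 / real ((K + 1) ^ 2)"
  have \<zeta>: "0 < \<zeta>" using \<gamma> e by (simp add: \<zeta>_def)
  have \<zeta>le: "real ((K + 1) ^ 2) * \<zeta> \<le> \<gamma> * e\<^sup>2" by (simp add: \<zeta>_def)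
  \<comment> \<open>The mean of \<open>cav_sum\<close> allowed for each pair (l, r): Markov's
    inequality at level \<zeta> and a union over the pairs then cost \<eta> / 2. Its thirds pay for
    dependence, for sets with many touching constraints and for sets that meet the pins.\<close>
  define \<omega> where "\<omega> = \<zeta> * \<eta> / (2 * real ((K + 1) ^ 2))"
  have \<omega>: "0 < \<omega>" using \<zeta> \<eta> by (simp add: \<omega>_def)
  obtain M where M: "\<And>l. l \<le> K \<Longrightarrow> 2 * (exp (c\<^sub>2 * real (l ^ k + k * l)) - (\<Sum>t\<le>M. (c\<^sub>2 * real (l ^ k + k * l)) ^ t / fact t)) \<le> \<omega> / 3"
    using fine_bound_choice[of "\<omega> / 3" c\<^sub>2 K k] \<omega> c12 by auto
  define X where "X = exp (c\<^sub>2 * real (K ^ k + k * K))"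
  have expX: "exp (c\<^sub>2 * real (l ^ k + k * l)) \<le> X" if "l \<le> K" for l
  proof -
    have "l ^ k + k * l \<le> K ^ k + k * K" using that by (intro add_mono power_mono mult_left_mono) auto
    then have "real (l ^ k + k * l) \<le> real (K ^ k + k * K)" by (rule of_nat_mono)
    then show ?thesis using c12 unfolding X_def by (simp add: mult_left_mono)
  qed
  have X0: "0 < X" by (simp add: X_def)
  define D where "D = 4 * (2 * c ^ 4) ^ M * (real (k * M) * (real CARD('o) + 1)) * X"
  have D0: "0 \<le> D" using c X0 by (simp add: D_def)
  \<comment> \<open>\<open>D\<close> bounds the coefficient of \<kappa> in the fine bound; the added
    1 keeps the denominator positive.\<close>
  define \<kappa> where "\<kappa> = \<omega> / (3 * (D + 1))"
  have \<kappa>: "0 < \<kappa>" using \<omega> D0 by (simp add: \<kappa>_def)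
  have D\<kappa>: "D * \<kappa> \<le> \<omega> / 3"
  proof -
    have "D * \<kappa> = (\<omega> / 3) * (D / (D + 1))" by (simp add: \<kappa>_def)
    also have "\<dots> \<le> (\<omega> / 3) * 1" using \<omega> D0 by (intro mult_left_mono) auto
    finally show ?thesis by simp
  qed
  \<comment> \<open>Enough stretches for the pigeonhole step to leave an increment of at most
    \<kappa>^2.\<close>
  define J where "J = Suc (nat \<lceil>real ((K + 1) * (M + 1)) / \<kappa>\<^sup>2\<rceil>)"
  have J: "0 < J" "real ((K + 1) * (M + 1)) / real J \<le> \<kappa>\<^sup>2"
  proof -
    show J0: "0 < J" by (simp add: J_def)
    have "real ((K + 1) * (M + 1)) / \<kappa>\<^sup>2 \<le> real J" unfolding J_def by linarith
    then have "real ((K + 1) * (M + 1)) \<le> \<kappa>\<^sup>2 * real J"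
      using \<kappa> by (subst (asm) pos_divide_le_eq) (simp_all only: zero_less_power mult.commute)
    then show "real ((K + 1) * (M + 1)) / real J \<le> \<kappa>\<^sup>2"
      using J0 by (subst pos_divide_le_eq) simp_all
  qed
  define T where "T = (J - 1) * (k * M)"
  define L where "L = CARD('o) ^ T"
  define n\<^sub>0 where "n\<^sub>0 = Max (N ` {..K}) + J * (k * M) + K + 1 + nat \<lceil>(2 + 4 * real K) / a0\<rceil> +
     nat \<lceil>2 * real T * X / (\<omega> / 3)\<rceil> + nat \<lceil>(\<Sum>f\<le>K. \<bar>C f\<bar>) / (\<eta> / 2)\<rceil>"
  have "1 - \<eta> \<le> measure_pmf.prob (iid_list m (rand_con k P n)) {cs. good_states e K L (n, cs)}"
    if n: "n\<^sub>0 \<le> n" and m: "c\<^sub>1 * real n \<le> real m" "real m \<le> c\<^sub>2 * real n" for n m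
  proof -
    let ?p = "rand_con k P n"
    let ?M = "measure_pmf (iid_list m ?p)"
    have NK: "N f \<le> n" if "f \<le> K" for f
    proof -
      have "N f \<le> Max (N ` {..K})" using that by (intro Max_ge) auto
      then show ?thesis using n by (simp add: n\<^sub>0_def)
    qed
    have n1: "0 < n" "J * (k * M) + K < n" using n by (auto simp: n\<^sub>0_def)
    have "nat \<lceil>(2 + 4 * real K) / a0\<rceil> \<le> n\<^sub>0" unfolding n\<^sub>0_def by linarith
    then have "(2 + 4 * real K) / a0 \<le> real n" using n real_nat_ceiling_ge[of "(2 + 4 * real K) / a0"] by linarith
    then have n2: "2 + 4 * real K \<le> a0 * real n" using a0 by (simp add: pos_divide_le_eq mult.commute)
    have "nat \<lceil>2 * real T * X / (\<omega> / 3)\<rceil> \<le> n\<^sub>0" unfolding n\<^sub>0_def by linarith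
    then have "2 * real T * X / (\<omega> / 3) \<le> real n" using n real_nat_ceiling_ge[of "2 * real T * X / (\<omega> / 3)"] by linarith
    then have "2 * real T * X \<le> real n * (\<omega> / 3)" using \<omega> by (subst (asm) pos_divide_le_eq) auto
    then have n3: "2 * real T * X / real n \<le> \<omega> / 3" using n1 by (subst pos_divide_le_eq) (auto simp: mult.commute)
    have "nat \<lceil>(\<Sum>f\<le>K. \<bar>C f\<bar>) / (\<eta> / 2)\<rceil> \<le> n\<^sub>0" unfolding n\<^sub>0_def by linarith
    then have "(\<Sum>f\<le>K. \<bar>C f\<bar>) / (\<eta> / 2) \<le> real n" using n real_nat_ceiling_ge[of "(\<Sum>f\<le>K. \<bar>C f\<bar>) / (\<eta> / 2)"] by linarith
    then have "(\<Sum>f\<le>K. \<bar>C f\<bar>) \<le> real n * (\<eta> / 2)" using \<eta> by (subst (asm) pos_divide_le_eq) auto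
    then have n4: "(\<Sum>f\<le>K. \<bar>C f\<bar>) / real n \<le> \<eta> / 2" using n1 by (subst pos_divide_le_eq) (auto simp: mult.commute)
    note finp = finite_set_rand_con[OF n1(1) fin, of k]
    have vg: "valid_graph k n c (n, cs)" if "set cs \<subseteq> set_pmf ?p" for cs
      by (rule vgraph[OF n1(1) fin k c bounds m(2) _ that]) (use c12 in simp)
    have c0: "0 < c" using c by simp
    \<comment> \<open>\<theta> is obtained from n and m before any graph enters; the Markov
      estimates below rely on this.\<close>
    obtain \<theta> where \<theta>: "\<theta> \<le> T" "\<And>l t. l \<le> K \<Longrightarrow> t \<le> M \<Longrightarrow>
        pin_mean k P n (m - t) l (\<theta> + k * M) - pin_mean k P n (m - t) l \<theta> \<le> real ((K + 1) * (M + 1)) / real J"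
      using exists_pinning[OF n1(1) fin c0 bounds J(1) n1(2), of M m] unfolding T_def by blast
    have \<theta>n: "\<theta> + k * M + l < n" if "l \<le> K" for l
    proof -
      have "(J - 1) * (k * M) + k * M = J * (k * M)" using J(1) by (cases J) auto
      then show ?thesis using \<theta>(1) n1(2) that by (simp add: T_def)
    qed
    let ?zs = "[0..<\<theta>]"
    define bs where "bs f = {cs :: (nat list \<times> ('o list \<Rightarrow> real)) list. real (card (stars n k f cs)) < a f * real n}" for f
    define bc where "bc = (\<lambda>(l, r). {cs :: (nat list \<times> ('o list \<Rightarrow> real)) list. \<zeta> \<le> cav_sum n k l r ?zs (n, cs)})"
    let ?I = "{1..K} \<times> {..K}"
    have pbs: "measure ?M (bs f) \<le> \<bar>C f\<bar> / real n" if "f \<le> K" for f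
    proof -
      have "measure ?M (bs f) \<le> C f / real n" unfolding bs_def by (rule aCN(2)[OF NK[OF that] m])
      also have "\<dots> \<le> \<bar>C f\<bar> / real n" by (intro divide_right_mono) auto
      finally show ?thesis .
    qed
    have pbc: "measure ?M (bc i) \<le> \<omega> / \<zeta>" if iI: "i \<in> ?I" for i
    proof -
      obtain l r where i: "i = (l, r)" "1 \<le> l" "l \<le> K" using iI by auto
      let ?x = "c\<^sub>2 * real (l ^ k + k * l)"
      have "measure ?M (bc i) \<le> iid_mean ?p m (\<lambda>cs. cav_sum n k l r ?zs (n, cs)) / \<zeta>"
        unfolding bc_def i by (simp, rule iid_markov[OF finp \<zeta>]) (rule valid_graph.cav_sum_nonneg[OF vg])
      also have "\<dots> \<le> \<omega> / \<zeta>"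
      proof (rule divide_right_mono)
        have "iid_mean ?p m (\<lambda>cs. cav_sum n k l r ?zs (n, cs)) \<le> fine_bound k c M \<kappa> CARD('o) ?x + 2 * real \<theta> * exp ?x / real n"
        proof (rule cav_sum_mean[OF n1(1) fin k c bounds m(2) _ i(2) \<theta>n[OF i(3)] \<kappa>])
          fix t assume "t \<le> M"
          from \<theta>(2)[OF i(3) this] J(2)
          show "pin_mean k P n (m - t) l (\<theta> + k * M) - pin_mean k P n (m - t) l \<theta> \<le> \<kappa>\<^sup>2" by linarith
        qed (use c12 in simp)
        also have "2 * real \<theta> * exp ?x / real n \<le> 2 * real T * X / real n"
          using \<theta>(1) expX[OF i(3)] by (intro divide_right_mono mult_mono) auto
        also have "\<dots> \<le> \<omega> / 3" by (rule n3)
        also have "fine_bound k c M \<kappa> CARD('o) ?x \<le> \<omega> / 3 + \<omega> / 3"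
          unfolding fine_bound_def
        proof (rule add_mono[OF _ M[OF i(3)]])
          have "4 * (2 * c ^ 4) ^ M * (real (k * M) * (real CARD('o) + 1) * \<kappa>) * exp ?x \<le>
            4 * (2 * c ^ 4) ^ M * (real (k * M) * (real CARD('o) + 1) * \<kappa>) * X"
            using expX[OF i(3)] \<kappa> c by (intro mult_left_mono mult_nonneg_nonneg) auto
          also have "\<dots> = D * \<kappa>" by (simp add: D_def mult_ac)
          also have "\<dots> \<le> \<omega> / 3" by (rule D\<kappa>)
          finally show "4 * (2 * c ^ 4) ^ M * (real (k * M) * (real CARD('o) + 1) * \<kappa>) * exp ?x \<le> \<omega> / 3" .
        qed
        finally show "iid_mean ?p m (\<lambda>cs. cav_sum n k l r ?zs (n, cs)) \<le> \<omega>" by simp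
      qed (use \<zeta> in simp)
      finally show ?thesis .
    qed
    let ?G = "{cs. good_states e K L (n, cs)}"
    let ?B = "(\<Union>f\<in>{..K}. bs f) \<union> (\<Union>i\<in>?I. bc i)"
    have good: "cs \<in> ?G" if cs: "set cs \<subseteq> set_pmf ?p" and nb: "cs \<notin> ?B" for cs
    proof -
      interpret valid_graph k n c "(n, cs)" by (rule vg[OF cs])
      have st: "a0 * real n \<le> real (card (stars n k f cs))" if "f \<le> K" for f
      proof -
        have "a0 * real n \<le> a f * real n" using a0(2)[OF that] by (intro mult_right_mono) auto
        also have "\<dots> \<le> real (card (stars n k f cs))" using nb that by (auto simp: bs_def not_less)
        finally show ?thesis .
      qed
      have "good_states e K L (n, cs)"
      proof (rule states_exist[OF \<gamma> e _ _ \<zeta>le])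
        fix l r U assume "1 \<le> l" "l \<le> K" "U \<in> cav_set (n, cs) l r"
        then show "\<gamma> * real n ^ (l - (k - 1) * card (inner (n, cs) U)) \<le> real (card (cav_set (n, cs) l r))"
          
          unfolding \<gamma>_def by (intro cavities_abundant[OF vg[OF cs] k a0(1) _ n2]) (use st in auto)
      next
        fix l r assume "1 \<le> l" "l \<le> K" "r \<le> K"
        then have "cs \<notin> bc (l, r)" using nb by auto
        then show "cav_sum n k l r ?zs (n, cs) \<le> \<zeta>" by (simp add: bc_def not_le)
      next
        show "CARD('o) ^ length ?zs \<le> L" using \<theta>(1) by (simp add: L_def power_increasing Suc_le_eq)
      qed
      then show ?thesis by simp
    qed
    have "1 - measure ?M ?G = measure ?M (- ?G)"
      using measure_pmf.prob_compl[of ?G "iid_list m ?p"] by (simp add: Compl_eq_Diff_UNIV)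
    \<comment> \<open>The fact \<open>good\<close> concerns lists in the support, so the failure
      event is first cut down to it.\<close>
    also have "\<dots> = measure ?M (- ?G \<inter> set_pmf (iid_list m ?p))" by (rule measure_Int_set_pmf[symmetric])
    also have "\<dots> \<le> measure ?M ?B"
      by (rule measure_pmf.finite_measure_mono) (use good in \<open>auto simp: set_iid_list\<close>)
    also have "\<dots> \<le> measure ?M (\<Union>f\<in>{..K}. bs f) + measure ?M (\<Union>i\<in>?I. bc i)"
      by (rule measure_Un_le) auto
    also have "measure ?M (\<Union>f\<in>{..K}. bs f) \<le> (\<Sum>f\<in>{..K}. measure ?M (bs f))"
      by (rule measure_UNION_le) auto
    also have "\<dots> \<le> (\<Sum>f\<in>{..K}. \<bar>C f\<bar> / real n)" by (rule sum_mono) (use pbs in auto)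
    also have "\<dots> \<le> \<eta> / 2" using n4 by (simp add: sum_divide_distrib)
    also have "measure ?M (\<Union>i\<in>?I. bc i) \<le> (\<Sum>i\<in>?I. measure ?M (bc i))"
      by (rule measure_UNION_le) auto
    also have "\<dots> \<le> (\<Sum>i\<in>?I. \<omega> / \<zeta>)" by (rule sum_mono[OF pbc])
    also have "\<dots> = real (K * (K + 1)) * (\<omega> / \<zeta>)" by (simp add: card_cartesian_product)
    also have "\<dots> \<le> real ((K + 1) ^ 2) * (\<omega> / \<zeta>)"
      using \<omega> \<zeta> by (intro mult_right_mono) (auto simp: power2_eq_square)
    also have "\<dots> = \<eta> / 2" using \<zeta> unfolding \<omega>_def by simp
    finally show ?thesis by simp
  qed
  then show ?thesis by blast
qed

lemma good_states_whp:
  fixes P :: "('o::finite list \<Rightarrow> real) pmf"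
  assumes k: "2 \<le> k" and fin: "finite (set_pmf P)"
    and pos: "\<forall>\<psi>\<in>set_pmf P. \<forall>xs. length xs = k \<longrightarrow> \<psi> xs > 0"
    and d: "0 < d" and e: "0 < e" "e < 1" and \<eta>: "0 < \<eta>" "\<eta> < 1"
  shows "\<exists>L n\<^sub>0. \<forall>n\<ge>n\<^sub>0. 1 - \<eta> \<le> measure_pmf.prob (rand_fg k P d n) {G. good_states e K L G}"
proof -
  define S where "S = (\<lambda>(\<psi>, xs). \<psi> xs) ` (set_pmf P \<times> (vecs k :: 'o list set))"
  \<comment> \<open>One constant above all weights and inverse weights that occur; these are
    finitely many, because the support of \<open>P\<close> and the spin set are finite.\<close>
  define c where "c = 1 + (\<Sum>v\<in>S. v + 1 / v)"
  have finS: "finite S" using fin by (simp add: S_def)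
  have S0: "0 < v" if "v \<in> S" for v using that pos by (auto simp: S_def vecs_def)
  then have nn: "0 \<le> v + 1 / v" if "v \<in> S" for v using that by (simp add: add_nonneg_nonneg less_imp_le)
  have c1: "1 \<le> c" unfolding c_def using nn by (simp add: sum_nonneg)
  have cS: "v + 1 / v \<le> c" if "v \<in> S" for v
  proof -
    have "v + 1 / v \<le> (\<Sum>v\<in>S. v + 1 / v)"
      by (rule member_le_sum[OF that _ finS]) (use nn in auto)
    then show ?thesis unfolding c_def by linarith
  qed
  have bounds: "\<forall>\<psi>\<in>set_pmf P. \<forall>xs. length xs = k \<longrightarrow> 1 / c \<le> \<psi> xs \<and> \<psi> xs \<le> c"
  proof (intro ballI allI impI)
    fix \<psi> and xs :: "'o list" assume "\<psi> \<in> set_pmf P" "length xs = k"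
    then have v: "\<psi> xs \<in> S" by (force simp: S_def vecs_def)
    have v0: "0 < \<psi> xs" by (rule S0[OF v])
    then have "1 / \<psi> xs \<le> c" "\<psi> xs \<le> c" using cS[OF v] zero_less_divide_1_iff[of "\<psi> xs"] by linarith+
    then show "1 / c \<le> \<psi> xs \<and> \<psi> xs \<le> c" using v0 c1 by (simp add: field_simps)
  qed
  have k0: "0 < k" using k by simp
  have \<eta>2: "0 < \<eta> / 2" using \<eta> by simp
  obtain c\<^sub>1 c\<^sub>2 n\<^sub>1 where c12: "0 < c\<^sub>1" "0 < c\<^sub>2" and po: "\<And>n. n\<^sub>1 \<le> n \<Longrightarrow> 1 - \<eta> / 2 \<le>
    measure_pmf.prob (poisson_pmf (d * real n / real k)) {m. c\<^sub>1 * real n \<le> real m \<and> real m \<le> c\<^sub>2 * real n}"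
    using poisson_range[OF d k0 \<eta>2] by blast
  obtain L n\<^sub>2 where fm: "\<And>n m. n\<^sub>2 \<le> n \<Longrightarrow> c\<^sub>1 * real n \<le> real m \<Longrightarrow> real m \<le> c\<^sub>2 * real n \<Longrightarrow>
    1 - \<eta> / 2 \<le> measure_pmf.prob (iid_list m (rand_con k P n)) {cs. good_states e K L (n, cs)}"
    using good_states_fixed_m[OF k fin c1 bounds c12 e \<eta>2, of K] by blast
  have "1 - \<eta> \<le> measure_pmf.prob (rand_fg k P d n) {G. good_states e K L G}" if n: "max n\<^sub>1 n\<^sub>2 \<le> n" for n
  proof -
    let ?A = "{G :: 'o fg. good_states e K L G}"
    let ?M = "poisson_pmf (d * real n / real k)"
    let ?R = "{m. c\<^sub>1 * real n \<le> real m \<and> real m \<le> c\<^sub>2 * real n}"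
    have prob: "measure_pmf.prob (rand_fg_m k P n m) ?A = measure_pmf.prob (iid_list m (rand_con k P n)) {cs. good_states e K L (n, cs)}" for m
      by (simp add: rand_fg_m_def vimage_def)
    \<comment> \<open>One factor 1 - \<eta> / 2 pays for the Poisson number of constraints, the
      other for the graph.\<close>
    have "ennreal (1 - \<eta>) \<le> ennreal ((1 - \<eta> / 2) * (1 - \<eta> / 2))"
      using \<eta> by (intro ennreal_leI) (simp add: field_simps)
    also have "\<dots> \<le> ennreal ((1 - \<eta> / 2) * measure_pmf.prob ?M ?R)"
      using po[of n] n \<eta> by (intro ennreal_leI mult_left_mono) auto
    also have "\<dots> = (\<integral>\<^sup>+m. ennreal (1 - \<eta> / 2) * indicator ?R m \<partial>measure_pmf ?M)"
      using \<eta> by (simp add: nn_integral_cmult_indicator measure_pmf.emeasure_eq_measure ennreal_mult')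
    also have "\<dots> \<le> (\<integral>\<^sup>+m. emeasure (measure_pmf (rand_fg_m k P n m)) ?A \<partial>measure_pmf ?M)"
    proof (rule nn_integral_mono)
      fix m
      show "ennreal (1 - \<eta> / 2) * indicator ?R m \<le> emeasure (measure_pmf (rand_fg_m k P n m)) ?A"
      proof (cases "m \<in> ?R")
        case True
        then have "1 - \<eta> / 2 \<le> measure_pmf.prob (rand_fg_m k P n m) ?A" unfolding prob using fm[of n m] n by simp
        then show ?thesis using True by (simp add: measure_pmf.emeasure_eq_measure ennreal_leI)
      qed simp
    qed
    also have "\<dots> = emeasure (measure_pmf (rand_fg k P d n)) ?A" by (simp add: rand_fg_def)
    finally show ?thesis by (simp add: measure_pmf.emeasure_eq_measure)
  qed
  then show ?thesis by blast
qed

theorem theorem3p3: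
  fixes k :: nat and P :: "('o::finite list \<Rightarrow> real) pmf" and d :: real
    and L :: "nat \<Rightarrow> nat"
  assumes "k \<ge> 2"
    and "finite (set_pmf P)"
    and "\<forall>\<psi>\<in>set_pmf P. \<forall>xs. length xs = k \<longrightarrow> \<psi> xs > 0"
    and "d > 0"
    and "filterlim L at_top sequentially"
  shows "\<exists>(\<epsilon> :: nat \<Rightarrow> real) (K :: nat \<Rightarrow> nat).
           \<epsilon> \<longlonglongrightarrow> 0 \<and> filterlim K at_top sequentially \<and>
           (\<lambda>n. measure_pmf.prob (rand_fg k P d n)
              {G. \<exists>(l :: nat) (Ss :: nat \<Rightarrow> (nat \<Rightarrow> 'o) set).
                    1 \<le> l \<and> l \<le> L n \<and>
                    (\<forall>j<l. Ss j \<noteq> {} \<and> Ss j \<subseteq> configs (vars G)) \<and>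
                    (\<forall>i<l. \<forall>j<l. i \<noteq> j \<longrightarrow> Ss i \<inter> Ss j = {}) \<and>
                    (\<Sum>j<l. gibbs_set G (Ss j)) \<ge> 1 - \<epsilon> n \<and>
                    (\<forall>j<l. \<forall>ell. 1 \<le> ell \<and> ell \<le> K n \<longrightarrow> bethe_state G (\<epsilon> n) ell (Ss j))})
           \<longlonglongrightarrow> 1"
proof -
  \<comment> \<open>Adding 2 keeps the accuracy below 1 also for j = 0, as the selection of states
    requires.\<close>
  define e where "e j = 1 / (real j + 2)" for j :: nat
  have e: "0 < e j" "e j < 1" for j by (auto simp: e_def)
  have "\<forall>j. \<exists>L' n\<^sub>0. \<forall>n\<ge>n\<^sub>0. 1 - e j \<le> measure_pmf.prob (rand_fg k P d n) {G. good_states (e j) j L' G}"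
    using good_states_whp[OF assms(1-4) e e] by blast
  then obtain L' N where LN: "\<And>j n. N j \<le> n \<Longrightarrow>
      1 - e j \<le> measure_pmf.prob (rand_fg k P d n) {G. good_states (e j) j (L' j) G}" by metis
  have "\<exists>n\<^sub>0. \<forall>n\<ge>n\<^sub>0. L' j \<le> L n" for j
    using assms(5) by (auto simp: filterlim_at_top eventually_sequentially)
  then obtain N' where N': "\<And>j n. N' j \<le> n \<Longrightarrow> L' j \<le> L n" by metis
  \<comment> \<open>Diagonal choice: the largest j \<le> n whose thresholds n has passed, both for
    the probability estimate and for \<open>L' j \<le> L n\<close>. It grows as slowly as
    \<open>L\<close> demands; 0 is a default for small n.\<close>
  define J where "J n = (if {j. j \<le> n \<and> N j \<le> n \<and> N' j \<le> n} = {} then 0 else Max {j. j \<le> n \<and> N j \<le> n \<and> N' j \<le> n})" for n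
  have finJ: "finite {j. j \<le> n \<and> N j \<le> n \<and> N' j \<le> n}" for n by (rule finite_subset[of _ "{..n}"]) auto
  have Jlim: "filterlim J at_top sequentially"
    unfolding filterlim_at_top eventually_sequentially
  proof
    fix Z
    show "\<exists>n\<^sub>0. \<forall>n\<ge>n\<^sub>0. Z \<le> J n"
    proof (intro exI allI impI)
      fix n assume "max Z (max (N Z) (N' Z)) \<le> n"
      then have "Z \<in> {j. j \<le> n \<and> N j \<le> n \<and> N' j \<le> n}" by simp
      then show "Z \<le> J n" using Max_ge[OF finJ[of n], of Z] by (auto simp: J_def)
    qed
  qed
  have key: "1 - e (J n) \<le> measure_pmf.prob (rand_fg k P d n) {G. good_states (e (J n)) (J n) (L n) G}"
    if n: "max (N 0) (N' 0) \<le> n" for n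
  proof -
    have "0 \<in> {j. j \<le> n \<and> N j \<le> n \<and> N' j \<le> n}" using n by simp
    then have ne: "{j. j \<le> n \<and> N j \<le> n \<and> N' j \<le> n} \<noteq> {}" by blast
    then have "J n \<in> {j. j \<le> n \<and> N j \<le> n \<and> N' j \<le> n}" using Max_in[OF finJ ne] by (simp only: J_def ne if_False)
    then have Jn: "N (J n) \<le> n" "N' (J n) \<le> n" by auto
    have "1 - e (J n) \<le> measure_pmf.prob (rand_fg k P d n) {G. good_states (e (J n)) (J n) (L' (J n)) G}"
      by (rule LN[OF Jn(1)])
    also have "\<dots> \<le> measure_pmf.prob (rand_fg k P d n) {G. good_states (e (J n)) (J n) (L n) G}"
      by (rule measure_pmf.finite_measure_mono) (use good_states_mono N'[OF Jn(2)] in auto)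
    finally show ?thesis .
  qed
  have e0: "e \<longlonglongrightarrow> 0" unfolding e_def by real_asymp
  have eJ: "(\<lambda>n. e (J n)) \<longlonglongrightarrow> 0" by (rule filterlim_compose[OF e0 Jlim])
  have lim: "(\<lambda>n. measure_pmf.prob (rand_fg k P d n) {G. good_states (e (J n)) (J n) (L n) G}) \<longlonglongrightarrow> 1"
  proof (rule tendsto_sandwich)
    show "\<forall>\<^sub>F n in sequentially. 1 - e (J n) \<le> measure_pmf.prob (rand_fg k P d n) {G. good_states (e (J n)) (J n) (L n) G}"
      unfolding eventually_sequentially using key by blast
    show "(\<lambda>n. 1 - e (J n)) \<longlonglongrightarrow> 1" using tendsto_diff[OF tendsto_const[of 1] eJ] by simp
  qed auto
  show ?thesis
    by (rule exI[of _ "\<lambda>n. e (J n)"], rule exI[of _ J]) (use eJ Jlim lim[unfolded good_states_def] in blast)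
qed

end
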